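(* Let $\kappa,\lambda,\mu$ be infinite cardinals. If $\max\{\mu^+,\lambda^{<\mu}\}\leq\kappa\leq\lambda^\mu$, then there exist $2^\kappa$ incomparable, balanced linearly ordered continua $X$ with $w(X)=\kappa$ and $|X|=\lambda^\mu$.
   Context: $w(X)$ denotes the weight of a space $X$, and $\mu^+$ is the least cardinal greater than $\mu$. For infinite cardinals $\lambda,\mu$, $\lambda^{<\mu}$ denotes the supremum of all cardinals $\lambda^\eta$ where $\eta$ runs through the finite and infinite cardinals smaller than $\mu$ (so $\lambda^{<\aleph_0}=\lambda$). An infinite space $X$ is balanced if $|U|=|X|$ and $w(U)=w(X)$ for every nonempty open subspace $U$ of $X$. A linearly ordered space is a topological space whose topology is the order topology of some linear ordering of its point set. A continuum is a compact connected Hausdorff space with more than one point. A linearly ordered continuum is a linearly ordered space that is a continuum. Spaces $X_i$ $(i\in I)$ are called incomparable if $X_i$ is not homeomorphic to a subspace of $X_j$ whenever $i,j\in I$ and $i\neq j$. *)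

theory Defs
  imports "HOL-Analysis.Analysis"
begin

unbundle cardinal_syntax

no_notation elt_set_eq (infix \<open>=o\<close> 50)

text \<open>
  Cardinals are the relations satisfying \<^const>\<open>Card_order\<close>, compared up to \<open>=o\<close>; any two
  of them may live on different types.
\<close>

subsection \<open>The cardinal \<open>r\<^sup><\<^sup>s\<close>\<close>

definition bounds_cexp_below :: "'l rel \<Rightarrow> 'm rel \<Rightarrow> 'c rel \<Rightarrow> bool" where
  "bounds_cexp_below r s u \<longleftrightarrow>
     Card_order u \<and> (\<forall>t :: 'm rel. Card_order t \<and> t <o s \<longrightarrow> r ^c t \<le>o u)"

text \<open>
  The supremum of all cardinals \<open>r ^c t\<close> with \<open>t <o s\<close>. Restricting \<open>t\<close> to the type of \<open>s\<close> loses
  no cardinal below \<open>s\<close>, and the type of \<open>r ^c s\<close> has room for the supremum when \<open>r\<close> is nonzero;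
  \<open>cexp_less_ordLeq_iff\<close> below compares with cardinals on arbitrary types.
\<close>

definition cexp_less :: "'l rel \<Rightarrow> 'm rel \<Rightarrow> ('m \<Rightarrow> 'l) rel" where
  "cexp_less r s = (SOME u. bounds_cexp_below r s u \<and>
     (\<forall>u' :: ('m \<Rightarrow> 'l) rel. bounds_cexp_below r s u' \<longrightarrow> u \<le>o u'))"

lemma bounds_cexp_below_cexp:
  fixes r :: "'l rel" and s :: "'m rel"
  assumes "Cinfinite r" "Cinfinite s"
  shows "bounds_cexp_below r s (r ^c s)"
  unfolding bounds_cexp_below_def
proof (intro conjI allI impI)
  show "Card_order (r ^c s)" by (rule Card_order_cexp)
  fix t :: "'m rel" assume t: "Card_order t \<and> t <o s"
  show "r ^c t \<le>o r ^c s"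
  proof (cases "Field t = {}")
    case True
    have "Cnotzero r" using assms Cinfinite_Cnotzero by blast
    then have "Field r \<noteq> {}" by (rule Cnotzero_imp_not_empty)
    then have "Func (Field s) (Field r) \<noteq> {}" by (simp add: Func_non_emp)
    then show ?thesis by (simp add: cexp_def True Func_empty card_of_singl_ordLeq)
  next
    case False
    with assms t show ?thesis by (blast intro: cexp_mono2' ordLess_imp_ordLeq)
  qed
qed

lemma cexp_less_least:
  fixes r :: "'l rel" and s :: "'m rel" and u :: "('m \<Rightarrow> 'l) rel"
  assumes "Cinfinite r" "Cinfinite s"
  shows "bounds_cexp_below r s (cexp_less r s)"
    and "bounds_cexp_below r s u \<Longrightarrow> cexp_less r s \<le>o u"
proof -
  let ?R = "{u :: ('m \<Rightarrow> 'l) rel. bounds_cexp_below r s u}"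
  have ne: "?R \<noteq> {}" using bounds_cexp_below_cexp[OF assms] by blast
  have "\<forall>u\<in>?R. Card_order u" by (simp add: bounds_cexp_below_def)
  from exists_minim_Card_order[OF ne this]
  have ex: "\<exists>u :: ('m \<Rightarrow> 'l) rel. bounds_cexp_below r s u \<and>
     (\<forall>u' :: ('m \<Rightarrow> 'l) rel. bounds_cexp_below r s u' \<longrightarrow> u \<le>o u')"
    by blast
  note * = someI_ex[OF ex, folded cexp_less_def]
  show "bounds_cexp_below r s (cexp_less r s)" using * by blast
  show "bounds_cexp_below r s u \<Longrightarrow> cexp_less r s \<le>o u" using * by blast
qed

lemma cexp_less_ordLeq_iff:
  fixes r :: "'l rel" and s :: "'m rel" and k :: "'k rel"
  assumes r: "Cinfinite r" and s: "Cinfinite s" and k: "Card_order k"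
  shows "cexp_less r s \<le>o k \<longleftrightarrow> (\<forall>t :: 'm rel. Card_order t \<and> t <o s \<longrightarrow> r ^c t \<le>o k)"
proof
  assume "cexp_less r s \<le>o k"
  then show "\<forall>t :: 'm rel. Card_order t \<and> t <o s \<longrightarrow> r ^c t \<le>o k"
    using cexp_less_least(1)[OF r s] ordLeq_transitive unfolding bounds_cexp_below_def by blast
next
  assume ub: "\<forall>t :: 'm rel. Card_order t \<and> t <o s \<longrightarrow> r ^c t \<le>o k"
  show "cexp_less r s \<le>o k"
  proof (rule ccontr)
    assume "\<not> cexp_less r s \<le>o k"
    moreover have C: "Card_order (cexp_less r s)"
      using cexp_less_least(1)[OF r s] by (simp add: bounds_cexp_below_def)
    ultimately have lt: "k <o cexp_less r s"
      using k not_ordLeq_iff_ordLess[of k "cexp_less r s"] not_ordLess_iff_ordLeq[of k "cexp_less r s"]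
      by (auto simp: card_order_on_def)
    then have "\<exists>p :: ('m \<Rightarrow> 'l) rel. k =o p"
      unfolding internalize_ordLess[of k "cexp_less r s"] by auto
    then obtain p :: "('m \<Rightarrow> 'l) rel" where p: "k =o p" ..
    have "Card_order p" by (rule Card_order_ordIso2[OF k p])
    moreover have "r ^c t \<le>o p" if "Card_order t \<and> t <o s" for t :: "'m rel"
      using ub[rule_format, OF that] p by (rule ordLeq_ordIso_trans)
    ultimately have "cexp_less r s \<le>o p"
      by (intro cexp_less_least(2)[OF r s]) (simp add: bounds_cexp_below_def)
    then have "cexp_less r s \<le>o k"
      using ordIso_symmetric[OF p] by (rule ordLeq_ordIso_trans)
    then show False
      using lt by (simp add: not_ordLess_ordLeq)
  qed
qed

subsection \<open>Weight\<close>

definition base_of :: "'a topology \<Rightarrow> 'a set set \<Rightarrow> bool" where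
  "base_of X B \<longleftrightarrow> (\<forall>V\<in>B. openin X V) \<and>
     (\<forall>U x. openin X U \<and> x \<in> U \<longrightarrow> (\<exists>V\<in>B. x \<in> V \<and> V \<subseteq> U))"

definition weight :: "'a topology \<Rightarrow> 'a set rel" where
  "weight X = (SOME w. (\<exists>B. base_of X B \<and> w = |B| ) \<and> (\<forall>B. base_of X B \<longrightarrow> w \<le>o |B| ))"

lemma weight_least:
  shows "\<exists>B. base_of X B \<and> weight X = |B|"
    and "base_of X B \<Longrightarrow> weight X \<le>o |B|"
proof -
  let ?R = "{ |B| | B. base_of X B}"
  have "base_of X {U. openin X U}" by (auto simp: base_of_def)
  then have ne: "?R \<noteq> {}" by blast
  have "\<forall>w\<in>?R. Card_order w" using card_of_Card_order by blast
  from exists_minim_Card_order[OF ne this]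
  have ex: "\<exists>w. (\<exists>B. base_of X B \<and> w = |B| ) \<and> (\<forall>B. base_of X B \<longrightarrow> w \<le>o |B| )"
    by blast
  note * = someI_ex[OF ex, folded weight_def]
  show "\<exists>B. base_of X B \<and> weight X = |B|" using * by blast
  show "base_of X B \<Longrightarrow> weight X \<le>o |B|" using * by blast
qed

subsection \<open>Classes of spaces\<close>

definition balanced_space :: "'a topology \<Rightarrow> bool" where
  "balanced_space X \<longleftrightarrow> infinite (topspace X) \<and>
     (\<forall>U. openin X U \<and> U \<noteq> {} \<longrightarrow>
        |U| =o |topspace X| \<and> weight (subtopology X U) =o weight X)"

text \<open>
  A linear order is a reflexive relation \<open>r\<close>, with \<open>(x, y) \<in> r\<close> read as \<open>x \<le> y\<close>. The set \<open>A\<close> itself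
  belongs to the subbase so that the topology has the right points when \<open>A\<close> is a singleton.
\<close>

definition order_topology_of :: "'a set \<Rightarrow> 'a rel \<Rightarrow> 'a topology" where
  "order_topology_of A r = topology_generated_by
     (insert A ((\<lambda>a. {x \<in> A. x \<noteq> a \<and> (x, a) \<in> r}) ` A \<union>
                (\<lambda>a. {x \<in> A. x \<noteq> a \<and> (a, x) \<in> r}) ` A))"

definition linearly_ordered_space :: "'a topology \<Rightarrow> bool" where
  "linearly_ordered_space X \<longleftrightarrow>
     (\<exists>r. linear_order_on (topspace X) r \<and> X = order_topology_of (topspace X) r)"

definition continuum :: "'a topology \<Rightarrow> bool" where
  "continuum X \<longleftrightarrow> compact_space X \<and> connected_space X \<and> Hausdorff_space X \<and>
     (\<exists>x\<in>topspace X. \<exists>y\<in>topspace X. x \<noteq> y)"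

definition incomparable_spaces :: "'i set \<Rightarrow> ('i \<Rightarrow> 'a topology) \<Rightarrow> bool" where
  "incomparable_spaces I X \<longleftrightarrow> (\<forall>i\<in>I. \<forall>j\<in>I. i \<noteq> j \<longrightarrow>
     \<not> (\<exists>S \<subseteq> topspace (X j). X i homeomorphic_space subtopology (X j) S))"

end

theory Submission
  imports Defs
begin

text \<open>
  A connected subspace of a linearly ordered continuum is convex, and a topological embedding of one
  linearly ordered continuum into another is strictly monotone (\<open>homeomorphic_subspace_monotone\<close>).
  Incomparability is therefore a statement about orders: no space of the family may be isomorphic or
  anti-isomorphic to a closed interval of another one. So it is enough to write a subset \<open>S\<close> of
  \<open>kappa\<close> into the order of a continuum in such a way that it can be read off even when the
  continuum only appears as an interval of another one.

  The letters are one-sided characters of points. A point is right-small if some set of at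
  most \<open>mu\<close> points above it is coinitial there, and left-small in the dual situation
  (\<open>right_small\<close>, \<open>left_small\<close>). Embeddings with convex range preserve this (\<open>convex_emb_right_small\<close>). A point
  that is not right-small needs a decreasing sequence of length at least \<open>mu\<^sup>+\<close> to approach it;
  the hypothesis \<open>mu\<^sup>+ \<le> kappa\<close> leaves room for such points.

  The material is a continuum \<open>L\<close> in which every point is right-small, whose top is left-small, and
  in which every interval has \<open>lambda\<^sup>mu\<close> points and \<open>kappa\<close> disjoint subintervals, while some
  dense set has size at most \<open>kappa\<close> (\<open>base_continuum\<close>). It comes from lexicographic powers in
  which a sequence is frozen at the bottom element as soon as one of its terms leaves a prescribed
  dense set \<open>E\<close>. Such a power is complete and dense, has at least \<open>|E|\<^sup>\<eta>\<close> points for exponent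
  \<open>\<eta>\<close>, and has a dense set made of sequences in \<open>E\<close> of length below \<open>\<eta>\<close>. With exponent
  \<open>mu\<close> over a long line with a dense set of size \<open>lambda\<close> this gives a continuum \<open>K\<close> with
  \<open>lambda\<^sup>mu\<close> points and density at most \<open>lambda\<^sup><\<^sup>mu \<le> kappa\<close>; with exponent \<open>\<omega>\<close> over
  \<open>K\<close> and a dense set of size exactly \<open>kappa\<close> it gives \<open>L\<close>, because every interval of this
  second power contains a copy of \<open>K\<close> and \<open>kappa\<close> disjoint intervals.

  Stringing together \<open>\<theta> = mu\<^sup>+\<close> reversed copies of \<open>L\<close> and reversing the result gives a continuum
  whose bottom is its only point that is not right-small (\<open>piece\<close>). The space for a set \<open>C\<close> of
  positions in \<open>kappa \<times> \<omega>\<close> is a sum along \<open>kappa \<times> \<omega> \<times> \<theta>\<close> of copies of \<open>L\<close>, except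
  that every position \<open>n\<close> contributes one such special piece: it stands right after the block of \<open>n\<close> if
  \<open>n \<in> C\<close>, where its bottom is not left-small since \<open>\<theta>\<close> is regular, and inside the block
  otherwise, where its bottom is left-small (\<open>word_order_right\<close>, \<open>marker_left\<close>). In this way
  \<open>C\<close>, a word of zeros and ones of length \<open>kappa \<times> \<omega>\<close>, is recovered from the order up to
  shifts. The word of \<open>S\<close> has two consecutive ones at its beginning and nowhere else, so an increasing
  embedding cannot shift it and \<open>S\<close> is determined (\<open>word_rigid\<close>). It also contains infinitely
  many ones, so a decreasing embedding would produce an infinite descending sequence of positions
  (\<open>no_decreasing_embedding_of_words\<close>). There are \<open>2\<^sup>kappa\<close> subsets \<open>S\<close>.
\<close>

section \<open>Linear orders and ordered continua\<close>

definition lt :: "'a rel \<Rightarrow> 'a \<Rightarrow> 'a \<Rightarrow> bool" where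
  "lt r x y \<longleftrightarrow> (x, y) \<in> r \<and> x \<noteq> y"

definition is_sup :: "'a rel \<Rightarrow> 'a set \<Rightarrow> 'a \<Rightarrow> bool" where
  "is_sup r A s \<longleftrightarrow> s \<in> Field r \<and> (\<forall>a\<in>A. (a, s) \<in> r) \<and>
     (\<forall>u\<in>Field r. (\<forall>a\<in>A. (a, u) \<in> r) \<longrightarrow> (s, u) \<in> r)"

locale linord =
  fixes r :: "'a rel"
  assumes lin: "Linear_order r"
begin

lemma le_refl: "x \<in> Field r \<Longrightarrow> (x, x) \<in> r"
  using lin by (auto simp: order_on_defs refl_on_def)

lemma le_trans: "(x, y) \<in> r \<Longrightarrow> (y, z) \<in> r \<Longrightarrow> (x, z) \<in> r"
  using lin by (auto simp: order_on_defs dest: transD)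

lemma le_antisym: "(x, y) \<in> r \<Longrightarrow> (y, x) \<in> r \<Longrightarrow> x = y"
  using lin by (auto simp: order_on_defs dest: antisymD)

lemma le_lt_cases: "x \<in> Field r \<Longrightarrow> y \<in> Field r \<Longrightarrow> (x, y) \<in> r \<or> lt r y x"
  using lin unfolding order_on_defs total_on_def lt_def refl_on_def by metis

lemma lt_cases: "x \<in> Field r \<Longrightarrow> y \<in> Field r \<Longrightarrow> lt r x y \<or> x = y \<or> lt r y x"
  using le_lt_cases unfolding lt_def by blast

lemma le_Field: "(x, y) \<in> r \<Longrightarrow> x \<in> Field r \<and> y \<in> Field r"
  by (auto simp: Field_def)

lemma lt_Field: "lt r x y \<Longrightarrow> x \<in> Field r \<and> y \<in> Field r"
  by (auto simp: Field_def lt_def)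

lemma lt_le: "lt r x y \<Longrightarrow> (x, y) \<in> r"
  by (simp add: lt_def)

lemma lt_irrefl: "\<not> lt r x x"
  by (simp add: lt_def)

lemma lt_trans: "lt r x y \<Longrightarrow> lt r y z \<Longrightarrow> lt r x z"
  unfolding lt_def using le_trans le_antisym by blast

lemma le_lt_trans: "(x, y) \<in> r \<Longrightarrow> lt r y z \<Longrightarrow> lt r x z"
  unfolding lt_def using le_trans le_antisym by blast

lemma lt_le_trans: "lt r x y \<Longrightarrow> (y, z) \<in> r \<Longrightarrow> lt r x z"
  unfolding lt_def using le_trans le_antisym by blast

lemma lt_asym: "lt r x y \<Longrightarrow> \<not> (y, x) \<in> r"
  unfolding lt_def using le_antisym by blast

lemma le_iff: "(x, y) \<in> r \<longleftrightarrow> x \<in> Field r \<and> (x = y \<or> lt r x y)"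
  using le_refl le_Field unfolding lt_def by blast

lemma linord_converse: "linord (r\<inverse>)"
  by unfold_locales (use lin in simp)

end

lemma lt_converse [simp]: "lt (r\<inverse>) x y \<longleftrightarrow> lt r y x"
  by (auto simp: lt_def)

text \<open>
  Completeness is required for all subsets of the field, the empty set included, so the order has
  both end points.
\<close>

locale ordered_continuum = linord +
  assumes complete: "A \<subseteq> Field r \<Longrightarrow> \<exists>s. is_sup r A s"
    and dense: "lt r x y \<Longrightarrow> \<exists>z. lt r x z \<and> lt r z y"
    and nontrivial: "\<exists>x y. lt r x y"

definition otop :: "'a rel \<Rightarrow> 'a" where
  "otop r = (SOME m. m \<in> Field r \<and> (\<forall>x\<in>Field r. (x, m) \<in> r))"

abbreviation obot :: "'a rel \<Rightarrow> 'a" where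
  "obot r \<equiv> otop (r\<inverse>)"

context ordered_continuum
begin

lemma complete_inf:
  assumes "A \<subseteq> Field r"
  shows "\<exists>s. is_sup (r\<inverse>) A s"
proof -
  let ?L = "{l \<in> Field r. \<forall>a\<in>A. (l, a) \<in> r}"
  obtain s where s: "is_sup r ?L s" using complete[of ?L] by auto
  have "(s, a) \<in> r" if "a \<in> A" for a
    using s that assms unfolding is_sup_def by blast
  then show ?thesis using s unfolding is_sup_def by (intro exI[of _ s]) auto
qed

lemma ordered_continuum_converse: "ordered_continuum (r\<inverse>)"
proof -
  interpret C: linord "r\<inverse>" by (rule linord_converse)
  show ?thesis
  proof
    show "\<exists>s. is_sup (r\<inverse>) A s" if "A \<subseteq> Field (r\<inverse>)" for A
      using complete_inf that by simp
    show "\<exists>z. lt (r\<inverse>) x z \<and> lt (r\<inverse>) z y" if "lt (r\<inverse>) x y" for x y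
      using dense[of y x] that by auto
    show "\<exists>x y. lt (r\<inverse>) x y" using nontrivial by auto
  qed
qed

lemma otop: "otop r \<in> Field r" "x \<in> Field r \<Longrightarrow> (x, otop r) \<in> r"
proof -
  obtain s where "is_sup r (Field r) s" using complete by blast
  then have "\<exists>m. m \<in> Field r \<and> (\<forall>x\<in>Field r. (x, m) \<in> r)"
    unfolding is_sup_def by blast
  from someI_ex[OF this] show "otop r \<in> Field r" "x \<in> Field r \<Longrightarrow> (x, otop r) \<in> r"
    unfolding otop_def by blast+
qed

lemma obot: "obot r \<in> Field r" "x \<in> Field r \<Longrightarrow> (obot r, x) \<in> r"
  using ordered_continuum.otop[OF ordered_continuum_converse] by auto

lemma lt_otop_iff: "lt r x (otop r) \<longleftrightarrow> x \<in> Field r \<and> x \<noteq> otop r"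
  using otop lt_Field unfolding lt_def by blast

lemma lt_obot_iff: "lt r (obot r) x \<longleftrightarrow> x \<in> Field r \<and> x \<noteq> obot r"
  using obot lt_Field unfolding lt_def by blast

lemma obot_lt_otop: "lt r (obot r) (otop r)"
  using nontrivial obot otop lt_Field le_lt_trans lt_le_trans by meson

lemma not_lt_obot: "\<not> lt r x (obot r)"
  using obot lt_Field lt_asym by blast

lemma not_otop_lt: "\<not> lt r (otop r) x"
  using otop lt_Field lt_asym by blast

end

section \<open>The order topology of an ordered continuum\<close>

text \<open>
  Every statement about left neighbourhoods turns into one about right neighbourhoods by passing to
  the converse order, which has the same topology.
\<close>

lemma order_topology_of_converse: "order_topology_of A (r\<inverse>) = order_topology_of A r"
  unfolding order_topology_of_def by (simp add: Un_commute)

context linord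
begin

abbreviation "ot \<equiv> order_topology_of (Field r) r"

lemma topspace_ot: "topspace ot = Field r"
  unfolding order_topology_of_def topology_generated_by_topspace by auto

lemma openin_below: "openin ot {x. lt r x a}"
proof (cases "a \<in> Field r")
  case True
  have "{x. lt r x a} = {x \<in> Field r. x \<noteq> a \<and> (x, a) \<in> r}"
    using lt_Field by (auto simp: lt_def)
  then show ?thesis unfolding order_topology_of_def using True
    by (auto intro!: topology_generated_by_Basis)
next
  case False
  then have "{x. lt r x a} = {}" using lt_Field by auto
  then show ?thesis by simp
qed

lemma openin_above: "openin ot {x. lt r a x}"
  using linord.openin_below[OF linord_converse, of a] by (simp add: order_topology_of_converse)

lemma openin_between: "openin ot {x. lt r a x \<and> lt r x b}"
proof -
  have "{x. lt r a x \<and> lt r x b} = {x. lt r a x} \<inter> {x. lt r x b}" by blast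
  then show ?thesis using openin_above openin_below by auto
qed

text \<open>
  The point \<open>a\<close> only witnesses that \<open>x\<close> is not the least element, so that the one-sided basic
  neighbourhood can be bounded on the left by a point. The property holds for the subbasic rays and
  is inherited by unions and finite intersections.
\<close>

lemma openin_left_nbhd:
  assumes "openin ot U" "x \<in> U" "lt r a x"
  shows "\<exists>a'. lt r a' x \<and> (\<forall>y. lt r a' y \<and> (y, x) \<in> r \<longrightarrow> y \<in> U)"
proof -
  let ?S = "insert (Field r) ((\<lambda>a. {x \<in> Field r. x \<noteq> a \<and> (x, a) \<in> r}) ` Field r \<union>
                (\<lambda>a. {x \<in> Field r. x \<noteq> a \<and> (a, x) \<in> r}) ` Field r)"
  from assms(1) have "generate_topology_on ?S U"
    unfolding order_topology_of_def openin_topology_generated_by_iff .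
  then show ?thesis using assms(2)
  proof (induction rule: generate_topology_on.induct)
    case Empty
    then show ?case by simp
  next
    case (Int U V)
    then obtain u v where uv: "lt r u x" "\<forall>y. lt r u y \<and> (y, x) \<in> r \<longrightarrow> y \<in> U"
      "lt r v x" "\<forall>y. lt r v y \<and> (y, x) \<in> r \<longrightarrow> y \<in> V" by blast
    show ?case
    proof (cases "(u, v) \<in> r")
      case True
      then show ?thesis using uv le_lt_trans by blast
    next
      case False
      then have "lt r v u" using le_lt_cases uv lt_Field by blast
      then show ?thesis using uv lt_trans by blast
    qed
  next
    case (UN K)
    then show ?case by blast
  next
    case (Basis S)
    then consider "S = Field r" | b where "S = {x \<in> Field r. x \<noteq> b \<and> (x, b) \<in> r}"
      | b where "S = {x \<in> Field r. x \<noteq> b \<and> (b, x) \<in> r}" by blast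
    then show ?case
    proof cases
      case 1
      then show ?thesis using assms(3) lt_Field by blast
    next
      case 2
      then have "lt r x b" using Basis by (auto simp: lt_def)
      then have "\<forall>y. lt r a y \<and> (y, x) \<in> r \<longrightarrow> y \<in> S"
        using 2 le_lt_trans[of _ x b] lt_Field unfolding lt_def by blast
      then show ?thesis using assms(3) by blast
    next
      case 3
      then have "lt r b x" using Basis by (auto simp: lt_def)
      moreover have "\<forall>y. lt r b y \<and> (y, x) \<in> r \<longrightarrow> y \<in> S"
        using 3 lt_Field unfolding lt_def by blast
      ultimately show ?thesis by blast
    qed
  qed
qed

lemma openin_right_nbhd:
  assumes "openin ot U" "x \<in> U" "lt r x a"
  shows "\<exists>a'. lt r x a' \<and> (\<forall>y. lt r y a' \<and> (x, y) \<in> r \<longrightarrow> y \<in> U)"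
  using linord.openin_left_nbhd[OF linord_converse, of U x a] assms
  by (simp add: order_topology_of_converse)

lemma linearly_ordered_space_ot: "linearly_ordered_space ot"
  unfolding linearly_ordered_space_def topspace_ot using lin by blast

lemma connectedin_convex:
  assumes "connectedin ot C" "u \<in> C" "v \<in> C" "lt r u w" "lt r w v"
  shows "w \<in> C"
proof (rule ccontr)
  assume w: "w \<notin> C"
  have "C \<subseteq> Field r" using assms(1) connectedin_subset_topspace topspace_ot by metis
  then have "C \<subseteq> {x. lt r x w} \<union> {x. lt r w x}"
    using w lt_cases assms(4) lt_Field by blast
  moreover have "{x. lt r x w} \<inter> {x. lt r w x} \<inter> C = {}"
    using lt_trans lt_irrefl by blast
  ultimately show False
    using assms openin_below[of w] openin_above[of w] unfolding connectedin by blast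
qed

end

context ordered_continuum
begin

lemma Hausdorff_ot: "Hausdorff_space ot"
proof -
  have *: "\<exists>U V. openin ot U \<and> openin ot V \<and> x \<in> U \<and> y \<in> V \<and> disjnt U V" if xy: "lt r x y" for x y
  proof -
    obtain z where "lt r x z" "lt r z y" using dense xy by blast
    then show ?thesis
      using openin_below[of z] openin_above[of z] lt_trans lt_irrefl
      by (intro exI[of _ "{x. lt r x z}"] exI[of _ "{x. lt r z x}"]) (auto simp: disjnt_def)
  qed
  show ?thesis unfolding Hausdorff_space_def topspace_ot
    using * lt_cases disjnt_sym by metis
qed

text \<open>
  The least upper bound of the part of \<open>E1\<close> between \<open>x\<close> and \<open>y\<close> can lie in neither of the two
  open sets: in \<open>E1\<close> it could be increased, in \<open>E2\<close> it could be decreased.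
\<close>

lemma no_separation_of_interval:
  assumes E: "openin ot E1" "openin ot E2" "{z. (a, z) \<in> r \<and> (z, b) \<in> r} \<subseteq> E1 \<union> E2"
    "E1 \<inter> E2 \<inter> {z. (a, z) \<in> r \<and> (z, b) \<in> r} = {}"
    and xy: "x \<in> E1" "y \<in> E2" "(a, x) \<in> r" "lt r x y" "(y, b) \<in> r"
  shows False
proof -
  let ?S = "{z \<in> E1. (x, z) \<in> r \<and> (z, y) \<in> r}"
  have x: "x \<in> ?S" using xy le_refl lt_Field lt_le by blast
  have F: "x \<in> Field r" "y \<in> Field r" using xy lt_Field by auto
  have "?S \<subseteq> Field r" using le_Field by blast
  then obtain s where s: "s \<in> Field r" "\<And>z. z \<in> ?S \<Longrightarrow> (z, s) \<in> r"
    "\<And>u. u \<in> Field r \<Longrightarrow> (\<And>z. z \<in> ?S \<Longrightarrow> (z, u) \<in> r) \<Longrightarrow> (s, u) \<in> r"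
    using complete[of ?S] unfolding is_sup_def by auto
  have xs: "(x, s) \<in> r" and sy: "(s, y) \<in> r" using s(2)[OF x] s(3)[OF F(2)] by auto
  have ab: "(a, s) \<in> r" "(s, b) \<in> r" using xs sy xy le_trans by blast+
  have inI: "(a, z) \<in> r \<and> (z, b) \<in> r" if "(x, z) \<in> r" "(z, y) \<in> r" for z
    using that xy le_trans by blast
  from ab E(3) consider "s \<in> E1" | "s \<in> E2" by blast
  then show False
  proof cases
    case 1
    have "y \<noteq> s" using 1 E(4) xy ab by blast
    then have "lt r s y" using sy by (simp add: lt_def)
    from openin_right_nbhd[OF E(1) 1 this] obtain d where
      d: "lt r s d" "\<And>z. lt r z d \<Longrightarrow> (s, z) \<in> r \<Longrightarrow> z \<in> E1" by blast
    obtain m where m: "lt r s m" "(m, d) \<in> r" "(m, y) \<in> r"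
    proof (cases "(d, y) \<in> r")
      case True
      then show ?thesis using that[of d] d(1) le_refl lt_Field by blast
    next
      case False
      then have "lt r y d" using le_lt_cases[of d y] F lt_Field[OF d(1)] by blast
      then show ?thesis using that[of y] \<open>lt r s y\<close> F le_refl lt_le by blast
    qed
    obtain z where z: "lt r s z" "lt r z m" using dense m(1) by blast
    have "z \<in> E1" using d(2) z m lt_le_trans lt_le by blast
    moreover have "(x, z) \<in> r" "(z, y) \<in> r" using z m xs le_trans lt_le by blast+
    ultimately have "(z, s) \<in> r" using s(2) by blast
    then show False using z(1) lt_asym by blast
  next
    case 2
    have "x \<noteq> s" using 2 E(4) xy ab by blast
    then have "lt r x s" using xs by (simp add: lt_def)
    from openin_left_nbhd[OF E(2) 2 this] obtain c where
      c: "lt r c s" "\<And>z. lt r c z \<Longrightarrow> (z, s) \<in> r \<Longrightarrow> z \<in> E2" by blast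
    have "(s, c) \<in> r"
    proof (rule s(3))
      show "c \<in> Field r" using c lt_Field by blast
      fix z assume z: "z \<in> ?S"
      then have "z \<notin> E2" using E(4) inI by blast
      then show "(z, c) \<in> r"
        using c(2)[of z] s(2)[OF z] le_lt_cases[of z c] c(1) lt_Field le_Field by blast
    qed
    then show False using c(1) lt_asym by blast
  qed
qed

lemma connectedin_interval: "connectedin ot {z. (a, z) \<in> r \<and> (z, b) \<in> r}" (is "connectedin ot ?I")
proof -
  have "False" if "openin ot E1" "openin ot E2" "?I \<subseteq> E1 \<union> E2" "E1 \<inter> E2 \<inter> ?I = {}"
     and xy: "x \<in> E1" "y \<in> E2" "x \<in> ?I" "y \<in> ?I" for E1 E2 x y
  proof -
    have "x \<noteq> y" using that by blast
    then consider "lt r x y" | "lt r y x" using lt_cases xy le_Field by blast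
    then show False
    proof cases
      case 1
      then show False using no_separation_of_interval[of E1 E2 a b x y] that by blast
    next
      case 2
      have "?I \<subseteq> E2 \<union> E1" "E2 \<inter> E1 \<inter> ?I = {}" using that by blast+
      then show False using no_separation_of_interval[of E2 E1 a b y x] that 2 by blast
    qed
  qed
  moreover have "?I \<subseteq> topspace ot" using topspace_ot le_Field by blast
  ultimately show ?thesis unfolding connectedin by blast
qed

lemma Field_eq_interval: "Field r = {z. (obot r, z) \<in> r \<and> (z, otop r) \<in> r}"
  using obot otop le_Field by blast

lemma connected_ot: "connected_space ot"
  using connectedin_interval[of "obot r" "otop r"] Field_eq_interval topspace_ot
  by (metis connectedin_topspace)

text \<open>
  The initial segments covered by finitely many sets have a least upper bound; it belongs to such a
  segment itself and cannot be smaller than the top.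
\<close>

lemma compact_ot: "compact_space ot"
  unfolding compact_space_alt topspace_ot
proof (intro allI impI, elim conjE)
  fix \<U> assume U: "\<forall>U\<in>\<U>. openin ot U" and cov: "Field r \<subseteq> \<Union>\<U>"
  define S where "S = {x \<in> Field r. \<exists>F. finite F \<and> F \<subseteq> \<U> \<and> {z. (z, x) \<in> r} \<subseteq> \<Union>F}"
  obtain s where "is_sup r S s" using complete[of S] S_def by blast
  then have s: "s \<in> Field r" "\<And>z. z \<in> S \<Longrightarrow> (z, s) \<in> r"
    "\<And>u. u \<in> Field r \<Longrightarrow> (\<And>z. z \<in> S \<Longrightarrow> (z, u) \<in> r) \<Longrightarrow> (s, u) \<in> r"
    unfolding is_sup_def by auto
  obtain U where sU: "U \<in> \<U>" "s \<in> U" using cov s(1) by blast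
  have "s \<in> S"
  proof (cases "s = obot r")
    case True
    have "z \<in> U" if "(z, s) \<in> r" for z
    proof -
      have "(s, z) \<in> r" using True obot(2) le_Field that by blast
      then show ?thesis using le_antisym that sU by blast
    qed
    then have "{z. (z, s) \<in> r} \<subseteq> \<Union>{U}" by blast
    then show ?thesis unfolding S_def using s(1) sU(1) by (intro CollectI conjI exI[of _ "{U}"]) auto
  next
    case False
    then have "lt r (obot r) s" using lt_obot_iff s(1) by blast
    then obtain a where a: "lt r a s" "\<And>y. lt r a y \<Longrightarrow> (y, s) \<in> r \<Longrightarrow> y \<in> U"
      using openin_left_nbhd[of U s] U sU by blast
    have "\<exists>x\<in>S. (x, a) \<notin> r" using s(3)[of a] lt_asym[OF a(1)] lt_Field[OF a(1)] by blast
    then obtain x where x: "x \<in> S" "lt r a x"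
      using le_lt_cases[of _ a] lt_Field[OF a(1)] S_def by blast
    then obtain F where F: "finite F" "F \<subseteq> \<U>" "{z. (z, x) \<in> r} \<subseteq> \<Union>F" unfolding S_def by blast
    have "{z. (z, s) \<in> r} \<subseteq> \<Union>(insert U F)"
    proof
      fix z assume z: "z \<in> {z. (z, s) \<in> r}"
      show "z \<in> \<Union>(insert U F)"
      proof (cases "(z, x) \<in> r")
        case True then show ?thesis using F by blast
      next
        case False
        then have "lt r x z" using le_lt_cases z le_Field x lt_Field by blast
        then show ?thesis using a(2) z x lt_trans by blast
      qed
    qed
    then show ?thesis unfolding S_def using F sU s(1)
      by (intro CollectI conjI exI[of _ "insert U F"]) auto
  qed
  then obtain F where F: "finite F" "F \<subseteq> \<U>" "{z. (z, s) \<in> r} \<subseteq> \<Union>F" unfolding S_def by blast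
  have "s = otop r"
  proof (rule ccontr)
    assume "s \<noteq> otop r"
    then have "lt r s (otop r)" using lt_otop_iff s(1) by blast
    then obtain d where d: "lt r s d" "\<And>y. lt r y d \<Longrightarrow> (s, y) \<in> r \<Longrightarrow> y \<in> U"
      using openin_right_nbhd[of U s] U sU by blast
    then obtain z where z: "lt r s z" "lt r z d" using dense by blast
    have "{x. (x, z) \<in> r} \<subseteq> \<Union>(insert U F)"
    proof
      fix x assume x: "x \<in> {x. (x, z) \<in> r}"
      then have "(x, s) \<in> r \<or> lt r s x" using le_lt_cases s(1) le_Field by blast
      moreover have "lt r x d" using le_lt_trans x z(2) by blast
      ultimately show "x \<in> \<Union>(insert U F)" using F(3) d(2)[of x] lt_le by blast
    qed
    then have "z \<in> S" unfolding S_def using F sU lt_Field[OF z(1)]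
      by (intro CollectI conjI exI[of _ "insert U F"]) auto
    then show False using s(2) z(1) lt_asym by blast
  qed
  then have "Field r \<subseteq> \<Union>F" using F(3) otop by blast
  then show "\<exists>F. finite F \<and> F \<subseteq> \<U> \<and> Field r \<subseteq> \<Union>F" using F by blast
qed

lemma continuum_ot: "continuum ot"
proof -
  obtain x y where "lt r x y" using nontrivial by blast
  then have "x \<in> Field r" "y \<in> Field r" "x \<noteq> y" using lt_Field by (auto simp: lt_irrefl)
  then show ?thesis
    unfolding continuum_def topspace_ot using compact_ot connected_ot Hausdorff_ot by blast
qed

end

section \<open>Embeddings of ordered continua are monotone\<close>

text \<open>
  Isomorphisms onto convex subsets, without reference to the image as an order of its own.
\<close>

definition convex_emb :: "'a rel \<Rightarrow> 'b rel \<Rightarrow> ('a \<Rightarrow> 'b) \<Rightarrow> bool" where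
  "convex_emb r s f \<longleftrightarrow> (\<forall>x y. lt r x y \<longrightarrow> lt s (f x) (f y)) \<and>
     (\<forall>x\<in>Field r. \<forall>y\<in>Field r. \<forall>z. lt s (f x) z \<and> lt s z (f y) \<longrightarrow> z \<in> f ` Field r)"

lemma convex_emb_converse: "convex_emb r s f \<Longrightarrow> convex_emb (r\<inverse>) (s\<inverse>) f"
  unfolding convex_emb_def by auto

lemma intermediate_value:
  assumes r: "ordered_continuum r" and s: "linord s"
    and f: "continuous_map (order_topology_of (Field r) r) (order_topology_of (Field s) s) f"
    and ab: "(a, b) \<in> r"
    and z: "lt s (f a) z \<and> lt s z (f b) \<or> lt s (f b) z \<and> lt s z (f a)"
  shows "\<exists>d. (a, d) \<in> r \<and> (d, b) \<in> r \<and> f d = z"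
proof -
  interpret R: ordered_continuum r by (rule r)
  interpret S: linord s by (rule s)
  let ?I = "{d. (a, d) \<in> r \<and> (d, b) \<in> r}"
  have "connectedin S.ot (f ` ?I)"
    using connectedin_continuous_map_image[OF f R.connectedin_interval[of a b]] .
  moreover have "a \<in> ?I" "b \<in> ?I" using ab R.le_refl R.le_Field by auto
  ultimately have "z \<in> f ` ?I"
    using S.connectedin_convex[of "f ` ?I" "f a" "f b" z]
      S.connectedin_convex[of "f ` ?I" "f b" "f a" z] z by blast
  then show ?thesis by blast
qed

text \<open>
  By the intermediate value property an injective continuous map preserves betweenness: if the value
  at the middle one of three points were not between the other two values, then one of the latter
  would be attained twice. Comparing with the two end points then fixes the direction.
\<close>

lemma increasing_if_ends_increase:
  assumes r: "ordered_continuum r" and s: "linord s"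
    and f: "continuous_map (order_topology_of (Field r) r) (order_topology_of (Field s) s) f"
    and inj: "inj_on f (Field r)" and ends: "lt s (f (obot r)) (f (otop r))"
  shows "convex_emb r s f"
proof -
  interpret R: ordered_continuum r by (rule r)
  interpret S: linord s by (rule s)
  have img: "f x \<in> Field s" if "x \<in> Field r" for x
    using continuous_map_image_subset_topspace[OF f] that R.topspace_ot S.topspace_ot by auto
  have ivt: "\<exists>d. (a, d) \<in> r \<and> (d, b) \<in> r \<and> f d = z"
    if "(a, b) \<in> r" "lt s (f a) z \<and> lt s z (f b) \<or> lt s (f b) z \<and> lt s z (f a)" for a b z
    using intermediate_value[OF r s f that] .
  have between: "lt s (f x) (f y) \<and> lt s (f y) (f z)"
    if xyz: "lt r x y" "lt r y z" "lt s (f x) (f z)" for x y z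
  proof -
    have F: "x \<in> Field r" "y \<in> Field r" "z \<in> Field r" using xyz R.lt_Field by blast+
    have "x \<noteq> y" "y \<noteq> z" using xyz by (auto simp: lt_def)
    then have ne: "f x \<noteq> f y" "f y \<noteq> f z" using inj F unfolding inj_on_def by blast+
    have le: "(x, y) \<in> r" "(y, z) \<in> r" using xyz by (auto simp: lt_def)
    have 1: "\<not> lt s (f y) (f x)"
    proof
      assume "lt s (f y) (f x)"
      then obtain d where d: "(y, d) \<in> r" "f d = f x" using ivt[OF le(2)] xyz(3) by blast
      then have "d = x" using inj F(1) R.le_Field[OF d(1)] unfolding inj_on_def by blast
      then show False using d xyz R.lt_asym by blast
    qed
    have 2: "\<not> lt s (f z) (f y)"
    proof
      assume "lt s (f z) (f y)"
      then obtain d where d: "(d, y) \<in> r" "f d = f z" using ivt[OF le(1)] xyz(3) by blast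
      then have "d = z" using inj F(3) R.le_Field[OF d(1)] unfolding inj_on_def by blast
      then show False using d xyz R.lt_asym by blast
    qed
    show ?thesis using 1 2 ne S.lt_cases img F by blast
  qed
  have low: "lt s (f (obot r)) (f y)" if "lt r (obot r) y" for y
  proof (cases "y = otop r")
    case False
    then have "lt r y (otop r)" using R.lt_otop_iff R.lt_Field[OF that] by blast
    then show ?thesis using between[OF that _ ends] by blast
  qed (use ends in simp)
  have inc: "lt s (f x) (f y)" if "lt r x y" for x y
  proof (cases "x = obot r")
    case True
    then show ?thesis using low that by simp
  next
    case False
    then have x: "lt r (obot r) x" using R.lt_obot_iff R.lt_Field[OF that] by blast
    then have "lt r (obot r) y" using that R.lt_trans by blast
    then show ?thesis using between[OF x that] low by blast
  qed
  have "z \<in> f ` Field r" if "x \<in> Field r" "y \<in> Field r" "lt s (f x) z" "lt s z (f y)" for x y z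
  proof -
    have "(x, y) \<in> r \<or> (y, x) \<in> r" using R.le_lt_cases that R.lt_le by blast
    then show ?thesis using ivt[of x y z] ivt[of y x z] that R.le_Field by blast
  qed
  then show ?thesis unfolding convex_emb_def using inc by blast
qed

lemma embedding_monotone:
  assumes r: "ordered_continuum r" and s: "linord s"
    and f: "continuous_map (order_topology_of (Field r) r) (order_topology_of (Field s) s) f"
    and inj: "inj_on f (Field r)"
  shows "convex_emb r s f \<or> convex_emb r (s\<inverse>) f"
proof -
  interpret R: ordered_continuum r by (rule r)
  interpret S: linord s by (rule s)
  have img: "f x \<in> Field s" if "x \<in> Field r" for x
    using continuous_map_image_subset_topspace[OF f] that R.topspace_ot S.topspace_ot by auto
  have "obot r \<noteq> otop r" using R.obot_lt_otop by (simp add: lt_def)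
  then have "f (obot r) \<noteq> f (otop r)" using inj R.otop(1) R.obot(1) unfolding inj_on_def by blast
  then consider "lt s (f (obot r)) (f (otop r))" | "lt (s\<inverse>) (f (obot r)) (f (otop r))"
    using S.lt_cases img R.otop(1) R.obot(1) by auto
  then show ?thesis
  proof cases
    case 1
    then show ?thesis using increasing_if_ends_increase[OF r s f inj] by blast
  next
    case 2
    have f': "continuous_map (order_topology_of (Field r) r) (order_topology_of (Field (s\<inverse>)) (s\<inverse>)) f"
      using f by (simp add: order_topology_of_converse)
    show ?thesis using increasing_if_ends_increase[OF r S.linord_converse f' inj 2] by blast
  qed
qed

lemma homeomorphic_subspace_monotone:
  assumes r: "ordered_continuum r" and s: "linord s"
    and h: "order_topology_of (Field r) r homeomorphic_space
       subtopology (order_topology_of (Field s) s) S"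
  shows "\<exists>f. convex_emb r s f \<or> convex_emb r (s\<inverse>) f"
proof -
  interpret R: ordered_continuum r by (rule r)
  obtain f where f: "homeomorphic_map R.ot (subtopology (order_topology_of (Field s) s) S) f"
    using h homeomorphic_space by blast
  have "continuous_map R.ot (order_topology_of (Field s) s) f"
    using homeomorphic_imp_continuous_map[OF f] continuous_map_in_subtopology by blast
  moreover have "inj_on f (Field r)"
    using homeomorphic_imp_injective_map[OF f] R.topspace_ot by simp
  ultimately show ?thesis using embedding_monotone[OF r s] by blast
qed

section \<open>Weight and balance from order-theoretic data\<close>

definition dense_in :: "'a rel \<Rightarrow> 'a set \<Rightarrow> bool" where
  "dense_in r Q \<longleftrightarrow> Q \<subseteq> Field r \<and> (\<forall>x y. lt r x y \<longrightarrow> (\<exists>q\<in>Q. lt r x q \<and> lt r q y))"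

text \<open>
  A family of pairwise disjoint intervals \<open>(u i, v i)\<close> between \<open>x\<close> and \<open>y\<close>, indexed by the
  field of \<open>k\<close>: it forces every base of an open set containing it to have \<open>k\<close> members.
\<close>

definition disjoint_intervals :: "'k rel \<Rightarrow> 'a rel \<Rightarrow> 'a \<Rightarrow> 'a \<Rightarrow> ('k \<Rightarrow> 'a) \<Rightarrow> ('k \<Rightarrow> 'a) \<Rightarrow> bool" where
  "disjoint_intervals k r x y u v \<longleftrightarrow>
     (\<forall>i\<in>Field k. lt r x (u i) \<and> lt r (u i) (v i) \<and> lt r (v i) y \<and>
        (\<forall>j\<in>Field k. i \<noteq> j \<longrightarrow> (v i, u j) \<in> r \<or> (v j, u i) \<in> r))"

definition rich :: "'k rel \<Rightarrow> 'c rel \<Rightarrow> 'a rel \<Rightarrow> bool" where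
  "rich k c r \<longleftrightarrow> (\<forall>x y. lt r x y \<longrightarrow> c \<le>o |{z. lt r x z \<and> lt r z y}| \<and>
     (\<exists>u v. disjoint_intervals k r x y u v))"

text \<open>
  The order-theoretic data behind a balanced continuum of weight \<open>k\<close> and cardinality \<open>c\<close>, in a
  form that passes to converses, sums and isomorphic copies.
\<close>

definition balanced_order :: "'k rel \<Rightarrow> 'c rel \<Rightarrow> 'a rel \<Rightarrow> bool" where
  "balanced_order k c r \<longleftrightarrow> ordered_continuum r \<and> rich k c r \<and> |Field r| \<le>o c \<and> (\<exists>Q. dense_in r Q \<and> |Q| \<le>o k)"

lemma richD:
  assumes "rich k c r" "lt r x y"
  shows "c \<le>o |{z. lt r x z \<and> lt r z y}|"
    and "\<exists>u v. disjoint_intervals k r x y u v"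
  using assms(1)[unfolded rich_def, THEN spec, THEN spec, THEN mp, OF assms(2)] by (rule conjunct1 conjunct2)+

text \<open>
  It suffices that every interval of \<open>s\<close> contains an increasing image of an open interval of some
  rich order.
\<close>

lemma rich_if_intervals_contain_copies:
  fixes s :: "'b rel"
  assumes s: "linord s" and copy: "\<And>x y. lt s x y \<Longrightarrow> \<exists>(r :: 'a rel) a b h. linord r \<and> rich k c r \<and> lt r a b \<and>
     (\<forall>p q. lt r a p \<and> lt r p q \<and> lt r q b \<longrightarrow> lt s (h p) (h q)) \<and>
     (\<forall>p. lt r a p \<and> lt r p b \<longrightarrow> lt s x (h p) \<and> lt s (h p) y)"
  shows "rich k c s"
  unfolding rich_def
proof (intro allI impI)
  fix x y assume "lt s x y"
  from copy[OF this] obtain r :: "'a rel" and a b h where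
    r: "linord r" "rich k c r" "lt r a b"
    and inc: "\<And>p q. lt r a p \<Longrightarrow> lt r p q \<Longrightarrow> lt r q b \<Longrightarrow> lt s (h p) (h q)"
    and inside: "\<And>p. lt r a p \<Longrightarrow> lt r p b \<Longrightarrow> lt s x (h p) \<and> lt s (h p) y"
    by blast
  interpret R: linord r by (rule r(1))
  interpret S: linord s by (rule s)
  have le: "(h p, h q) \<in> s" if "lt r a p" "(p, q) \<in> r" "lt r q b" for p q
  proof (cases "p = q")
    case True
    then show ?thesis using inside[of p] that S.lt_Field S.le_refl by blast
  next
    case False
    then show ?thesis using inc[of p q] that S.lt_le by (simp add: lt_def[of r p q])
  qed
  have inj: "inj_on h {z. lt r a z \<and> lt r z b}"
  proof (rule inj_onI, rule ccontr)
    fix p q assume pq: "p \<in> {z. lt r a z \<and> lt r z b}" "q \<in> {z. lt r a z \<and> lt r z b}" "h p = h q" "p \<noteq> q"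
    then have "lt r p q \<or> lt r q p" using R.lt_cases R.lt_Field by blast
    then show False using inc[of p q] inc[of q p] pq S.lt_irrefl by auto
  qed
  have "c \<le>o |{z. lt r a z \<and> lt r z b}|" by (rule richD(1)[OF r(2,3)])
  also have "|{z. lt r a z \<and> lt r z b}| \<le>o |{z. lt s x z \<and> lt s z y}|"
    by (rule card_of_ordLeqI[OF inj]) (use inside in blast)
  finally have 1: "c \<le>o |{z. lt s x z \<and> lt s z y}|" .
  obtain u v where uv: "disjoint_intervals k r a b u v" using richD(2)[OF r(2,3)] by (elim exE)
  have d: "lt r a (u i)" "lt r (u i) (v i)" "lt r (v i) b" "lt r a (v i)" "lt r (u i) b" if "i \<in> Field k" for i
    using uv that R.lt_trans unfolding disjoint_intervals_def by blast+
  have "disjoint_intervals k s x y (\<lambda>i. h (u i)) (\<lambda>i. h (v i))"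
    unfolding disjoint_intervals_def
  proof (intro ballI conjI impI)
    fix i assume i: "i \<in> Field k"
    show "lt s x (h (u i))" "lt s (h (u i)) (h (v i))" "lt s (h (v i)) y"
      using inside[OF d(1)[OF i] d(5)[OF i]] inc[OF d(1-3)[OF i]] inside[OF d(4)[OF i] d(3)[OF i]] by auto
    fix j assume j: "j \<in> Field k" "i \<noteq> j"
    then have "(v i, u j) \<in> r \<or> (v j, u i) \<in> r" using uv i unfolding disjoint_intervals_def by blast
    then show "(h (v i), h (u j)) \<in> s \<or> (h (v j), h (u i)) \<in> s"
      using le[OF d(4)[OF i] _ d(5)[OF j(1)]] le[OF d(4)[OF j(1)] _ d(5)[OF i]] by blast
  qed
  then have "\<exists>u v. disjoint_intervals k s x y u v" by blast
  with 1 show "c \<le>o |{z. lt s x z \<and> lt s z y}| \<and> (\<exists>u v. disjoint_intervals k s x y u v)"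
    by (rule conjI)
qed

lemma balanced_order_converse:
  assumes "balanced_order k c r"
  shows "balanced_order k c (r\<inverse>)"
proof -
  have 1: "ordered_continuum r" and 2: "rich k c r" and 3: "|Field r| \<le>o c"
    and 4: "\<exists>Q. dense_in r Q \<and> |Q| \<le>o k" using assms unfolding balanced_order_def by auto
  have "rich k c (r\<inverse>)"
    unfolding rich_def
  proof (intro allI impI conjI)
    fix x y assume "lt (r\<inverse>) x y"
    then have yx: "lt r y x" by simp
    have "{z. lt (r\<inverse>) x z \<and> lt (r\<inverse>) z y} = {z. lt r y z \<and> lt r z x}" by auto
    then show "c \<le>o |{z. lt (r\<inverse>) x z \<and> lt (r\<inverse>) z y}|" using richD(1)[OF 2 yx] by simp
    obtain u v where "disjoint_intervals k r y x u v" using richD(2)[OF 2 yx] by (elim exE)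
    then have "disjoint_intervals k (r\<inverse>) x y v u" unfolding disjoint_intervals_def by auto
    then show "\<exists>u v. disjoint_intervals k (r\<inverse>) x y u v" by blast
  qed
  moreover have "dense_in (r\<inverse>) Q" if "dense_in r Q" for Q
    using that unfolding dense_in_def lt_converse Field_converse by blast
  then have "\<exists>Q. dense_in (r\<inverse>) Q \<and> |Q| \<le>o k" using 4 by blast
  ultimately show ?thesis unfolding balanced_order_def using ordered_continuum.ordered_continuum_converse[OF 1] 3 by simp
qed

lemma card_of_Times_bound: "|A| \<le>o r \<Longrightarrow> |B| \<le>o r \<Longrightarrow> Cinfinite r \<Longrightarrow> |A \<times> B| \<le>o r"
  by (rule card_of_Times_ordLeq_infinite_Field) (auto simp: cinfinite_def)

lemma card_of_insert_bound: "|A| \<le>o r \<Longrightarrow> Cinfinite r \<Longrightarrow> |insert a A| \<le>o r"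
proof -
  assume A: "|A| \<le>o r" and r: "Cinfinite r"
  have "|{a}| \<le>o r" by (rule card_of_singl_ordLeq[THEN ordLeq_ordIso_trans, OF _ card_of_Field_ordIso])
      (use r in \<open>auto simp: cinfinite_def\<close>)
  then show ?thesis using Un_Cinfinite_bound[OF _ A r, of "{a}"] by simp
qed

lemma card_of_image_bound: "|A| \<le>o r \<Longrightarrow> |f ` A| \<le>o r"
  using card_of_image ordLeq_transitive by blast

lemma card_of_subset_bound: "B \<subseteq> A \<Longrightarrow> |A| \<le>o r \<Longrightarrow> |B| \<le>o r"
  using card_of_mono1 ordLeq_transitive by blast

context ordered_continuum
begin

lemma open_contains_interval:
  assumes U: "openin ot U" "U \<noteq> {}"
  shows "\<exists>a b. lt r a b \<and> {z. lt r a z \<and> lt r z b} \<subseteq> U"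
proof -
  obtain x where x: "x \<in> U" using U by blast
  then have xF: "x \<in> Field r" using openin_subset[OF U(1)] topspace_ot by blast
  then consider "lt r x (otop r)" | "lt r (obot r) x"
    using lt_otop_iff lt_obot_iff obot_lt_otop by (metis lt_irrefl)
  then show ?thesis
  proof cases
    case 1
    then obtain b where "lt r x b" "\<forall>y. lt r y b \<and> (x, y) \<in> r \<longrightarrow> y \<in> U"
      using openin_right_nbhd[OF U(1) x] by blast
    then show ?thesis using lt_le by blast
  next
    case 2
    then obtain a where "lt r a x" "\<forall>y. lt r a y \<and> (y, x) \<in> r \<longrightarrow> y \<in> U"
      using openin_left_nbhd[OF U(1) x] by blast
    then show ?thesis using lt_le by blast
  qed
qed

text \<open>
  Intervals with end points in \<open>Q\<close> form a base; the option type stands for the absence of a bound,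
  which is needed for neighbourhoods of the end points of the order.
\<close>

lemma weight_open_le:
  assumes Q: "dense_in r Q" "|Q| \<le>o k" and k: "Cinfinite k"
  shows "weight (subtopology ot U) \<le>o k"
proof -
  define I where "I = (\<lambda>(a, b). {z \<in> Field r. (\<forall>a'. a = Some a' \<longrightarrow> lt r a' z) \<and> (\<forall>b'. b = Some b' \<longrightarrow> lt r z b')})"
  let ?O = "insert None (Some ` Q)"
  let ?B = "(\<lambda>p. I p \<inter> U) ` (?O \<times> ?O)"
  have "|?O| \<le>o k" using card_of_insert_bound[OF card_of_image_bound[OF Q(2)] k] .
  then have "|?O \<times> ?O| \<le>o k" by (intro card_of_Times_bound k)
  then have Bk: "|?B| \<le>o k" by (rule card_of_image_bound)
  have I_open: "openin ot (I p)" for p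
  proof -
    obtain a b where p: "p = (a, b)" by (cases p)
    let ?L = "case a of None \<Rightarrow> Field r | Some a' \<Rightarrow> {z. lt r a' z}"
    let ?R = "case b of None \<Rightarrow> Field r | Some b' \<Rightarrow> {z. lt r z b'}"
    have F: "openin ot (Field r)" using openin_topspace[of ot] topspace_ot by simp
    have "openin ot ?L" "openin ot ?R"
      using openin_above openin_below F by (auto split: option.split)
    then have "openin ot (Field r \<inter> ?L \<inter> ?R)" using F by blast
    moreover have "I p = Field r \<inter> ?L \<inter> ?R"
      unfolding I_def p by (auto split: option.splits)
    ultimately show ?thesis by simp
  qed
  have "base_of (subtopology ot U) ?B"
    unfolding base_of_def
  proof (intro conjI ballI allI impI)
    fix V assume "V \<in> ?B"
    then show "openin (subtopology ot U) V"
      unfolding openin_subtopology using I_open by blast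
  next
    fix W x assume "openin (subtopology ot U) W \<and> x \<in> W"
    then obtain T where T: "openin ot T" "W = T \<inter> U" "x \<in> T" "x \<in> U"
      unfolding openin_subtopology by blast
    then have xF: "x \<in> Field r" using openin_subset[OF T(1)] topspace_ot by blast
    have "\<exists>a\<in>?O. (\<forall>a'. a = Some a' \<longrightarrow> lt r a' x) \<and>
        (\<forall>z\<in>Field r. (\<forall>a'. a = Some a' \<longrightarrow> lt r a' z) \<and> (z, x) \<in> r \<longrightarrow> z \<in> T)"
    proof (cases "x = obot r")
      case True
      have "z = x" if "z \<in> Field r" "(z, x) \<in> r" for z
        using obot(2)[OF that(1)] le_antisym that(2) True by blast
      then show ?thesis using T(3) by (intro bexI[of _ None]) auto
    next
      case False
      then have "lt r (obot r) x" using lt_obot_iff xF by blast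
      then obtain a where a: "lt r a x" "\<forall>y. lt r a y \<and> (y, x) \<in> r \<longrightarrow> y \<in> T"
        using openin_left_nbhd[OF T(1,3)] by blast
      then obtain q where q: "q \<in> Q" "lt r a q" "lt r q x" using Q(1) unfolding dense_in_def by blast
      then have "\<forall>z. lt r q z \<and> (z, x) \<in> r \<longrightarrow> z \<in> T" using a(2) lt_trans[OF q(2)] by blast
      then show ?thesis using q by (intro bexI[of _ "Some q"]) auto
    qed
    then obtain a where a: "a \<in> ?O" "\<forall>a'. a = Some a' \<longrightarrow> lt r a' x"
      "\<forall>z\<in>Field r. (\<forall>a'. a = Some a' \<longrightarrow> lt r a' z) \<and> (z, x) \<in> r \<longrightarrow> z \<in> T" by blast
    have "\<exists>b\<in>?O. (\<forall>b'. b = Some b' \<longrightarrow> lt r x b') \<and>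
        (\<forall>z\<in>Field r. (\<forall>b'. b = Some b' \<longrightarrow> lt r z b') \<and> (x, z) \<in> r \<longrightarrow> z \<in> T)"
    proof (cases "x = otop r")
      case True
      have "z = x" if "z \<in> Field r" "(x, z) \<in> r" for z
        using otop(2)[OF that(1)] le_antisym that(2) True by blast
      then show ?thesis using T(3) by (intro bexI[of _ None]) auto
    next
      case False
      then have "lt r x (otop r)" using lt_otop_iff xF by blast
      then obtain b where b: "lt r x b" "\<forall>y. lt r y b \<and> (x, y) \<in> r \<longrightarrow> y \<in> T"
        using openin_right_nbhd[OF T(1,3)] by blast
      then obtain q where q: "q \<in> Q" "lt r x q" "lt r q b" using Q(1) unfolding dense_in_def by blast
      then have "\<forall>z. lt r z q \<and> (x, z) \<in> r \<longrightarrow> z \<in> T" using b(2) lt_trans[OF _ q(3)] by blast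
      then show ?thesis using q by (intro bexI[of _ "Some q"]) auto
    qed
    then obtain b where b: "b \<in> ?O" "\<forall>b'. b = Some b' \<longrightarrow> lt r x b'"
      "\<forall>z\<in>Field r. (\<forall>b'. b = Some b' \<longrightarrow> lt r z b') \<and> (x, z) \<in> r \<longrightarrow> z \<in> T" by blast
    have "x \<in> I (a, b)" unfolding I_def using a(2) b(2) xF by simp
    moreover have "I (a, b) \<subseteq> T"
    proof
      fix z assume "z \<in> I (a, b)"
      then have z: "z \<in> Field r" "\<forall>a'. a = Some a' \<longrightarrow> lt r a' z" "\<forall>b'. b = Some b' \<longrightarrow> lt r z b'"
        unfolding I_def by auto
      then show "z \<in> T" using a(3) b(3) le_lt_cases[OF z(1) xF] lt_le by blast
    qed
    ultimately show "\<exists>V\<in>?B. x \<in> V \<and> V \<subseteq> W"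
      using a(1) b(1) T by (intro bexI[of _ "I (a, b) \<inter> U"]) auto
  qed
  then have "weight (subtopology ot U) \<le>o |?B|" by (rule weight_least(2))
  then show ?thesis using Bk ordLeq_transitive by blast
qed

text \<open>
  A base must contain a nonempty subset of each of the disjoint intervals supplied by richness, and
  these subsets are distinct.
\<close>

lemma weight_open_ge:
  assumes rich: "rich k c r" and k: "Card_order k" and U: "openin ot U" "U \<noteq> {}"
  shows "k \<le>o weight (subtopology ot U)"
proof -
  obtain B where B: "base_of (subtopology ot U) B" "weight (subtopology ot U) = |B|"
    using weight_least(1) by blast
  obtain a b where ab: "lt r a b" "{z. lt r a z \<and> lt r z b} \<subseteq> U"
    using open_contains_interval[OF U] by blast
  obtain u v where uv0: "disjoint_intervals k r a b u v" using richD(2)[OF rich ab(1)] by (elim exE)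
  have uv: "\<And>i. i \<in> Field k \<Longrightarrow> lt r a (u i) \<and> lt r (u i) (v i) \<and> lt r (v i) b"
    "\<And>i j. i \<in> Field k \<Longrightarrow> j \<in> Field k \<Longrightarrow> i \<noteq> j \<Longrightarrow> (v i, u j) \<in> r \<or> (v j, u i) \<in> r"
    using uv0 unfolding disjoint_intervals_def by simp_all
  define J where "J i = {z. lt r (u i) z \<and> lt r z (v i)}" for i
  have "\<exists>V. V \<in> B \<and> V \<noteq> {} \<and> V \<subseteq> J i" if i: "i \<in> Field k" for i
  proof -
    obtain z where z: "z \<in> J i" using dense uv(1)[OF i] unfolding J_def by blast
    have "lt r a z \<and> lt r z b" if "z \<in> J i" for z
      using that uv(1)[OF i] lt_trans unfolding J_def by blast
    then have "J i \<subseteq> U" using ab(2) by blast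
    then have "openin (subtopology ot U) (J i)"
      unfolding openin_subtopology using openin_between[of "u i" "v i"] unfolding J_def by blast
    then show ?thesis using B(1) z unfolding base_of_def by blast
  qed
  then obtain V where V: "\<And>i. i \<in> Field k \<Longrightarrow> V i \<in> B \<and> V i \<noteq> {} \<and> V i \<subseteq> J i" by metis
  have "inj_on V (Field k)"
  proof (rule inj_onI, rule ccontr)
    fix i j assume ij: "i \<in> Field k" "j \<in> Field k" "V i = V j" "i \<noteq> j"
    then obtain z where z: "z \<in> J i" "z \<in> J j" using V by blast
    from uv(2)[OF ij(1,2,4)] show False
    proof
      assume "(v i, u j) \<in> r"
      then have "lt r z (u j)" using z lt_le_trans unfolding J_def by blast
      then show False using z lt_trans lt_irrefl unfolding J_def by blast
    next
      assume "(v j, u i) \<in> r"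
      then have "lt r z (u i)" using z lt_le_trans unfolding J_def by blast
      then show False using z lt_trans lt_irrefl unfolding J_def by blast
    qed
  qed
  moreover have "V ` Field k \<subseteq> B" using V by blast
  ultimately have "|Field k| \<le>o |B|" using card_of_ordLeq by blast
  then show ?thesis
    unfolding B(2) using ordIso_ordLeq_trans[OF ordIso_symmetric[OF card_of_Field_ordIso[OF k]]] by blast
qed

end

lemma order_topology_of_balanced_order:
  assumes g: "balanced_order k c r" and k: "Cinfinite k" and c: "Cinfinite c"
    and X: "X = order_topology_of (Field r) r"
  shows "linearly_ordered_space X" and "continuum X" and "weight X =o k"
    and "|topspace X| =o c" and "balanced_space X"
proof -
  interpret ordered_continuum r using g unfolding balanced_order_def by blast
  have rich: "rich k c r" and F: "|Field r| \<le>o c" using g unfolding balanced_order_def by auto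
  obtain Q where Q: "dense_in r Q" "|Q| \<le>o k" using g unfolding balanced_order_def by blast
  show "linearly_ordered_space X" unfolding X by (rule linearly_ordered_space_ot)
  show "continuum X" unfolding X by (rule continuum_ot)
  have w: "weight (subtopology ot U) =o k" if "openin ot U" "U \<noteq> {}" for U
    using weight_open_le[OF Q k] weight_open_ge[OF rich _ that] k ordIso_iff_ordLeq by blast
  have n: "|U| =o c" if U: "openin ot U" "U \<noteq> {}" for U
  proof -
    obtain a b where ab: "lt r a b" "{z. lt r a z \<and> lt r z b} \<subseteq> U"
      using open_contains_interval[OF U] by blast
    have "c \<le>o |{z. lt r a z \<and> lt r z b}|" by (rule richD(1)[OF rich ab(1)])
    then have "c \<le>o |U|" using card_of_mono1[OF ab(2)] ordLeq_transitive by blast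
    moreover have "|U| \<le>o c" using openin_subset[OF U(1)] topspace_ot F card_of_subset_bound by metis
    ultimately show ?thesis using ordIso_iff_ordLeq by blast
  qed
  have ne: "topspace ot \<noteq> {}" using topspace_ot otop(1) by blast
  show w0: "weight X =o k" using w[OF openin_topspace ne] X by simp
  show n0: "|topspace X| =o c" using n[OF openin_topspace ne] X by simp
  have "infinite (topspace X)"
    using n0 c card_of_ordIso_finite_Field[of c "topspace X"] ordIso_symmetric
    unfolding cinfinite_def by blast
  moreover have "|U| =o |topspace X|" "weight (subtopology X U) =o weight X"
    if "openin X U \<and> U \<noteq> {}" for U
    using n[of U, folded X] w[of U, folded X] that n0 w0 ordIso_symmetric ordIso_transitive by blast+
  ultimately show "balanced_space X" unfolding balanced_space_def by blast
qed

section \<open>Orders given by their strict part, and well-orders\<close>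

definition of_strict :: "'a set \<Rightarrow> ('a \<Rightarrow> 'a \<Rightarrow> bool) \<Rightarrow> 'a rel" where
  "of_strict A l = {(x, y). x \<in> A \<and> y \<in> A \<and> (x = y \<or> l x y)}"

lemma Field_of_strict: "Field (of_strict A l) = A"
  unfolding of_strict_def Field_def by auto

lemma lt_of_strict: "(\<And>x. x \<in> A \<Longrightarrow> \<not> l x x) \<Longrightarrow> lt (of_strict A l) x y \<longleftrightarrow> x \<in> A \<and> y \<in> A \<and> l x y"
  unfolding of_strict_def lt_def by auto

lemma linord_of_strict:
  assumes irrefl: "\<And>x. x \<in> A \<Longrightarrow> \<not> l x x"
    and trans: "\<And>x y z. x \<in> A \<Longrightarrow> y \<in> A \<Longrightarrow> z \<in> A \<Longrightarrow> l x y \<Longrightarrow> l y z \<Longrightarrow> l x z"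
    and total: "\<And>x y. x \<in> A \<Longrightarrow> y \<in> A \<Longrightarrow> x \<noteq> y \<Longrightarrow> l x y \<or> l y x"
  shows "linord (of_strict A l)"
proof
  let ?r = "of_strict A l"
  have "?r \<subseteq> A \<times> A" "refl_on A ?r" "total_on A ?r"
    using total by (auto simp: of_strict_def refl_on_def total_on_def)
  moreover have "trans ?r"
    unfolding of_strict_def trans_def using trans by blast
  moreover have "antisym ?r"
    unfolding of_strict_def antisym_def using trans irrefl by blast
  ultimately show "Linear_order ?r"
    unfolding Field_of_strict order_on_defs by blast
qed

lemma linord_Well_order: "Well_order W \<Longrightarrow> linord W"
  by unfold_locales (simp add: well_order_on_def)

lemma Well_order_least:
  assumes "Well_order W" "S \<subseteq> Field W" "S \<noteq> {}"
  shows "\<exists>m\<in>S. \<forall>s\<in>S. (m, s) \<in> W"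
proof -
  interpret wo_rel W using assms(1) by (simp add: wo_rel_def)
  show ?thesis using minim_in[OF assms(2,3)] minim_least[OF assms(2)] by blast
qed

section \<open>One-sided character of a point\<close>

text \<open>
  The coinitiality of \<open>x\<close> from the right is at most \<open>m\<close>. Phrased with an arbitrary coinitial
  set rather than a sequence, this needs cardinalities only; the top element qualifies through the
  empty set.
\<close>

definition right_small :: "'m rel \<Rightarrow> 'a rel \<Rightarrow> 'a \<Rightarrow> bool" where
  "right_small m r x \<longleftrightarrow> (\<exists>A. |A| \<le>o m \<and> (\<forall>a\<in>A. lt r x a) \<and> (\<forall>y. lt r x y \<longrightarrow> (\<exists>a\<in>A. (a, y) \<in> r)))"

abbreviation left_small :: "'m rel \<Rightarrow> 'a rel \<Rightarrow> 'a \<Rightarrow> bool" where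
  "left_small m r x \<equiv> right_small m (r\<inverse>) x"

lemma left_small_def:
  "left_small m r x \<longleftrightarrow> (\<exists>A. |A| \<le>o m \<and> (\<forall>a\<in>A. lt r a x) \<and> (\<forall>y. lt r y x \<longrightarrow> (\<exists>a\<in>A. (y, a) \<in> r)))"
  unfolding right_small_def by simp

lemma right_small_if_dense:
  assumes "linord r" "dense_in r Q" "|Q| \<le>o m"
  shows "right_small m r x"
proof -
  have "|{q \<in> Q. lt r x q}| \<le>o m" using card_of_subset_bound[OF _ assms(3)] by auto
  moreover have "\<exists>q\<in>{q \<in> Q. lt r x q}. (q, y) \<in> r" if "lt r x y" for y
    using that assms(2) linord.lt_le[OF assms(1)] unfolding dense_in_def by blast
  ultimately show ?thesis unfolding right_small_def by (intro exI[of _ "{q \<in> Q. lt r x q}"]) auto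
qed

text \<open>
  Since the range of \<open>f\<close> is convex and \<open>x\<close> has a point \<open>x'\<close> above it, coinitial sets at
  \<open>x\<close> and at \<open>f x\<close> can be carried back and forth. At the top of \<open>r\<close> this would fail, because its
  image need not be the top of \<open>s\<close>.
\<close>

lemma convex_emb_right_small:
  assumes r: "linord r" and s: "linord s" and f: "convex_emb r s f" and x: "lt r x x'"
  shows "right_small m s (f x) \<longleftrightarrow> right_small m r x"
proof -
  interpret R: linord r by (rule r)
  interpret S: linord s by (rule s)
  have inc: "lt s (f u) (f v)" if "lt r u v" for u v using f that unfolding convex_emb_def by blast
  have inc': "lt r u v" if "lt s (f u) (f v)" "u \<in> Field r" "v \<in> Field r" for u v
    using that inc[of v u] R.lt_cases[of u v] S.lt_trans S.lt_irrefl by blast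
  have le: "(f u, f v) \<in> s" if "(u, v) \<in> r" for u v
  proof (cases "u = v")
    case True
    have "f u \<in> Field s" using inc[of x x'] inc[of u x] inc[of x u] x
        R.lt_cases[of u x] R.le_Field[OF that] R.lt_Field[OF x] S.lt_Field by metis
    then show ?thesis using True S.le_refl by simp
  next
    case False
    then show ?thesis using inc[of u v] that by (simp add: lt_def)
  qed
  have xF: "x \<in> Field r" "x' \<in> Field r" using R.lt_Field[OF x] by auto
  have conv: "\<exists>d. d \<in> Field r \<and> f d = z" if "lt s (f x) z" "lt s z (f y)" "y \<in> Field r" for y z
    using f that xF(1) unfolding convex_emb_def by blast
  show ?thesis
  proof
    assume "right_small m s (f x)"
    then obtain A where A: "|A| \<le>o m" "\<And>a. a \<in> A \<Longrightarrow> lt s (f x) a"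
      "\<And>y. lt s (f x) y \<Longrightarrow> \<exists>a\<in>A. (a, y) \<in> s" unfolding right_small_def by blast
    let ?g = "inv_into (Field r) f"
    let ?B = "?g ` (A \<inter> f ` Field r)"
    have B: "?g a \<in> Field r \<and> f (?g a) = a" if "a \<in> f ` Field r" for a
      using that by (simp add: f_inv_into_f inv_into_into)
    have "|?B| \<le>o m" by (rule card_of_image_bound, rule card_of_subset_bound[OF _ A(1)]) blast
    moreover have "lt r x b" if "b \<in> ?B" for b
    proof -
      obtain a where a: "a \<in> A" "a \<in> f ` Field r" "b = ?g a" using \<open>b \<in> ?B\<close> by blast
      then show ?thesis using inc'[of x b] A(2) B[OF a(2)] xF by simp
    qed
    moreover have "\<exists>b\<in>?B. (b, y) \<in> r" if y: "lt r x y" for y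
    proof -
      obtain a where a: "a \<in> A" "(a, f y) \<in> s" using A(3) inc[OF y] by blast
      have yF: "y \<in> Field r" using R.lt_Field[OF y] by blast
      have aF: "a \<in> f ` Field r"
      proof (cases "a = f y")
        case True then show ?thesis using yF by blast
      next
        case False
        then have "lt s a (f y)" using a(2) by (simp add: lt_def)
        then show ?thesis using conv[OF A(2)[OF a(1)] _ yF] by blast
      qed
      have "(?g a, y) \<in> r"
      proof (rule ccontr)
        assume "(?g a, y) \<notin> r"
        then have "lt r y (?g a)" using R.le_lt_cases B[OF aF] yF by blast
        then have "lt s (f y) a" using inc B[OF aF] by force
        then show False using a(2) S.lt_asym by blast
      qed
      then show ?thesis using a(1) aF by blast
    qed
    ultimately show "right_small m r x" unfolding right_small_def by blast
  next
    assume "right_small m r x"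
    then obtain A where A: "|A| \<le>o m" "\<And>a. a \<in> A \<Longrightarrow> lt r x a"
      "\<And>y. lt r x y \<Longrightarrow> \<exists>a\<in>A. (a, y) \<in> r" unfolding right_small_def by blast
    have "|f ` A| \<le>o m" using A(1) by (rule card_of_image_bound)
    moreover have "\<exists>b\<in>f ` A. (b, y) \<in> s" if y: "lt s (f x) y" for y
    proof (cases "lt s y (f x')")
      case True
      then obtain d where d: "d \<in> Field r" "f d = y" using conv[OF y True xF(2)] by blast
      then have "lt r x d" using inc'[of x d] y xF by simp
      then obtain a where "a \<in> A" "(a, d) \<in> r" using A(3) by blast
      then show ?thesis using le d by blast
    next
      case False
      then have y': "(f x', y) \<in> s"
        using S.le_lt_cases[of "f x'" y] S.lt_Field[OF y] S.lt_Field[OF inc[OF x]] by blast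
      obtain a where "a \<in> A" "(a, x') \<in> r" using A(3) x by blast
      then show ?thesis using le y' S.le_trans by blast
    qed
    ultimately show "right_small m s (f x)" unfolding right_small_def using A(2) inc by blast
  qed
qed

section \<open>Well-ordered sums\<close>

text \<open>
  The ordered sum of continua along a well-order, consecutive summands being glued together: every
  summand loses its top, which is replaced by the bottom of the next one, or by the least upper bound
  \<open>None\<close> of everything at the very end.
\<close>

fun sum_less :: "'w rel \<Rightarrow> ('w \<Rightarrow> 'a rel) \<Rightarrow> ('w \<times> 'a) option \<Rightarrow> ('w \<times> 'a) option \<Rightarrow> bool" where
  "sum_less W P (Some (v, s)) (Some (w, t)) \<longleftrightarrow> lt W v w \<or> v = w \<and> lt (P v) s t"
| "sum_less W P (Some p) None \<longleftrightarrow> True"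
| "sum_less W P None y \<longleftrightarrow> False"

definition well_ordered_sum :: "'w rel \<Rightarrow> ('w \<Rightarrow> 'a rel) \<Rightarrow> ('w \<times> 'a) option rel" where
  "well_ordered_sum W P = of_strict (insert None {Some (w, t) | w t. w \<in> Field W \<and> lt (P w) t (otop (P w))}) (sum_less W P)"

locale sum_of_continua =
  fixes W :: "'w rel" and P :: "'w \<Rightarrow> 'a rel"
  assumes wo: "Well_order W" and W_ne: "Field W \<noteq> {}"
    and P: "\<And>w. w \<in> Field W \<Longrightarrow> ordered_continuum (P w)"
begin

sublocale W: linord W by (rule linord_Well_order[OF wo])

abbreviation "S \<equiv> well_ordered_sum W P"

lemma Field_S_Some: "Some (w, t) \<in> Field S \<longleftrightarrow> w \<in> Field W \<and> lt (P w) t (otop (P w))"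
  unfolding well_ordered_sum_def Field_of_strict by auto

lemma Field_S_None: "None \<in> Field S"
  unfolding well_ordered_sum_def Field_of_strict by auto

lemma lt_S: "lt S x y \<longleftrightarrow> x \<in> Field S \<and> y \<in> Field S \<and> sum_less W P x y"
proof -
  have "\<not> sum_less W P x x" for x
    by (cases x) (auto simp: lt_def split: prod.splits)
  then show ?thesis unfolding well_ordered_sum_def Field_of_strict by (subst lt_of_strict) auto
qed

lemma lt_S_Some:
  "lt S (Some (v, s)) (Some (w, t)) \<longleftrightarrow> Some (v, s) \<in> Field S \<and> Some (w, t) \<in> Field S \<and>
     (lt W v w \<or> v = w \<and> lt (P v) s t)"
  by (simp add: lt_S)

lemma lt_S_None: "lt S x None \<longleftrightarrow> x \<in> Field S \<and> x \<noteq> None"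
  by (cases x) (auto simp: lt_S Field_S_None)

lemma not_None_lt: "\<not> lt S None x"
  by (simp add: lt_S)

lemma linord_S: "linord S"
proof -
  have "S = of_strict (Field S) (sum_less W P)"
    unfolding well_ordered_sum_def Field_of_strict by simp
  moreover have "linord (of_strict (Field S) (sum_less W P))"
  proof (rule linord_of_strict)
  fix x y z
  show "\<not> sum_less W P x x" by (cases x) (auto simp: lt_def split: prod.splits)
  { assume F: "x \<in> Field S" "y \<in> Field S" "z \<in> Field S" and l: "sum_less W P x y" "sum_less W P y z"
    obtain v s where x: "x = Some (v, s)" using l by (cases x) auto
    obtain w t where y: "y = Some (w, t)" using l by (cases y) auto
    show "sum_less W P x z"
    proof (cases z)
      case None then show ?thesis using x by simp
    next
      case (Some p)
      then obtain w' t' where z: "z = Some (w', t')" by (cases p) auto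
      interpret Pv: ordered_continuum "P v" using P F(1) x Field_S_Some by blast
      show ?thesis using l x y z W.lt_trans Pv.lt_trans by auto
    qed }
  { assume F: "x \<in> Field S" "y \<in> Field S" and ne: "x \<noteq> y"
    show "sum_less W P x y \<or> sum_less W P y x"
    proof (cases "x = None \<or> y = None")
      case True then show ?thesis using ne by (cases x; cases y) auto
    next
      case False
      then obtain v s w t where xy: "x = Some (v, s)" "y = Some (w, t)" by auto
      interpret Pv: ordered_continuum "P v" using P F(1) xy Field_S_Some by blast
      have v: "v \<in> Field W" "w \<in> Field W" "s \<in> Field (P v)" using F xy Field_S_Some Pv.lt_Field by blast+
      show ?thesis
      proof (cases "v = w")
        case True
        then have "t \<in> Field (P v)" "s \<noteq> t" using F xy Field_S_Some Pv.lt_Field ne by blast+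
        then show ?thesis using Pv.lt_cases[of s t] v xy True by auto
      next
        case False then show ?thesis using W.lt_cases v xy by auto
      qed
    qed }
  qed
  ultimately show ?thesis by simp
qed

sublocale S: linord S by (rule linord_S)

lemma le_None: "x \<in> Field S \<Longrightarrow> (x, None) \<in> S"
  using lt_S_None[of x] S.le_refl[of x] S.lt_le[of x None] by metis

lemma None_le: "(None, y) \<in> S \<Longrightarrow> y = None"
  using not_None_lt[of y] by (auto simp: lt_def)

lemma lt_within: "lt (P w) s t \<Longrightarrow> lt (P w) t (otop (P w)) \<Longrightarrow> w \<in> Field W \<Longrightarrow> lt S (Some (w, s)) (Some (w, t))"
proof -
  assume a: "lt (P w) s t" "lt (P w) t (otop (P w))" "w \<in> Field W"
  interpret Pw: ordered_continuum "P w" using P a(3) .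
  show ?thesis using a Pw.lt_trans by (auto simp: lt_S_Some Field_S_Some)
qed

text \<open>
  Every nonempty interval contains an interval of a single summand starting at the same point, so
  local properties reduce to the summands.
\<close>

lemma within_interval:
  assumes "lt S x y"
  shows "\<exists>w s t. x = Some (w, s) \<and> w \<in> Field W \<and> lt (P w) s t \<and> lt (P w) t (otop (P w)) \<and>
     (Some (w, t), y) \<in> S"
proof -
  obtain w s where x: "x = Some (w, s)" using assms by (cases x) (auto simp: not_None_lt)
  then have w: "w \<in> Field W" "lt (P w) s (otop (P w))" using Field_S_Some S.lt_Field assms by blast+
  interpret Pw: ordered_continuum "P w" using P w(1) .
  show ?thesis
  proof (cases "\<exists>t. y = Some (w, t)")
    case True
    then obtain t where y: "y = Some (w, t)" by blast
    then have "lt (P w) s t" "lt (P w) t (otop (P w))" "(y, y) \<in> S"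
      using assms x W.lt_irrefl S.lt_Field[OF assms] S.le_refl by (auto simp: lt_S_Some Field_S_Some)
    then show ?thesis using x y w by blast
  next
    case False
    obtain t where t: "lt (P w) s t" "lt (P w) t (otop (P w))" using Pw.dense w(2) by blast
    have tS: "Some (w, t) \<in> Field S" using Field_S_Some t(2) w(1) by blast
    have "lt S (Some (w, t)) y"
    proof (cases y)
      case None then show ?thesis using tS by (simp add: lt_S_None)
    next
      case (Some p)
      then obtain w' t' where y: "y = Some (w', t')" by (cases p) auto
      then show ?thesis using False assms x tS by (auto simp: lt_S_Some)
    qed
    then show ?thesis using x w(1) t S.lt_le by blast
  qed
qed

lemma ordered_continuum_S: "ordered_continuum S"
proof
  fix x y assume "lt S x y"
  then obtain w s t where x: "x = Some (w, s)" "w \<in> Field W" "lt (P w) s t" "lt (P w) t (otop (P w))"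
    "(Some (w, t), y) \<in> S" using within_interval by blast
  interpret Pw: ordered_continuum "P w" using P x(2) .
  obtain u where u: "lt (P w) s u" "lt (P w) u t" using Pw.dense x(3) by blast
  have "lt S x (Some (w, u))" using lt_within[OF u(1) _ x(2)] Pw.lt_trans[OF u(2) x(4)] x(1) by blast
  moreover have "lt S (Some (w, u)) (Some (w, t))" using lt_within[OF u(2) x(4,2)] .
  ultimately show "\<exists>z. lt S x z \<and> lt S z y" using S.lt_le_trans x(5) by blast
next
  obtain w where w: "w \<in> Field W" using W_ne by blast
  interpret Pw: ordered_continuum "P w" using P w .
  have "lt S (Some (w, obot (P w))) None"
    using w Pw.obot_lt_otop by (simp add: lt_S_None Field_S_Some)
  then show "\<exists>x y. lt S x y" by blast
next
  fix A assume A: "A \<subseteq> Field S"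
  \<comment> \<open>The least summand containing an upper bound of A also contains the supremum.\<close>
  define V where "V = {w \<in> Field W. \<exists>t. Some (w, t) \<in> Field S \<and> (\<forall>a\<in>A. (a, Some (w, t)) \<in> S)}"
  show "\<exists>s. is_sup S A s"
  proof (cases "V = {}")
    case True
    have "is_sup S A None"
      unfolding is_sup_def
    proof (intro conjI ballI impI)
      show "None \<in> Field S" by (rule Field_S_None)
      show "(a, None) \<in> S" if "a \<in> A" for a
        using that A le_None by blast
      fix u assume u: "u \<in> Field S" "\<forall>a\<in>A. (a, u) \<in> S"
      have "u = None"
      proof (cases u)
        case (Some p)
        then obtain w t where "u = Some (w, t)" by (cases p) auto
        then have "w \<in> V" unfolding V_def using u Field_S_Some by blast
        then show ?thesis using True by blast
      qed
      then show "(None, u) \<in> S" using Field_S_None S.le_refl by blast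
    qed
    then show ?thesis by blast
  next
    case False
    obtain w where w: "w \<in> V" "\<And>w'. w' \<in> V \<Longrightarrow> (w, w') \<in> W"
      using Well_order_least[OF wo _ False] unfolding V_def by blast
    obtain t where t: "Some (w, t) \<in> Field S" "\<And>a. a \<in> A \<Longrightarrow> (a, Some (w, t)) \<in> S"
      using w(1) unfolding V_def by blast
    have wF: "w \<in> Field W" and tt: "lt (P w) t (otop (P w))" using t(1) Field_S_Some by blast+
    interpret Pw: ordered_continuum "P w" using P wF .
    define B where "B = {s. Some (w, s) \<in> A}"
    have BF: "lt (P w) s (otop (P w))" if "s \<in> B" for s
      using that A Field_S_Some unfolding B_def by blast
    obtain s where s: "is_sup (P w) B s" using Pw.complete[of B] BF Pw.lt_Field by blast
    have bt: "(b, t) \<in> P w" if "b \<in> B" for b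
    proof (rule ccontr)
      assume "(b, t) \<notin> P w"
      then have "lt (P w) t b" using Pw.le_lt_cases BF[OF that] tt Pw.lt_Field by blast
      then have "lt S (Some (w, t)) (Some (w, b))" using lt_within BF[OF that] wF by blast
      then show False using t(2) that S.lt_asym unfolding B_def by blast
    qed
    have "(s, t) \<in> P w" using s bt tt Pw.lt_Field unfolding is_sup_def by blast
    then have st: "lt (P w) s (otop (P w))" using tt Pw.le_lt_trans by blast
    have sF: "Some (w, s) \<in> Field S" using st wF Field_S_Some by blast
    have "is_sup S A (Some (w, s))"
      unfolding is_sup_def
    proof (intro conjI ballI impI)
      show "Some (w, s) \<in> Field S" by (rule sF)
      fix a assume a: "a \<in> A"
      then have aF: "a \<in> Field S" using A by blast
      have at: "(a, Some (w, t)) \<in> S" using t(2) a by blast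
      then have "a \<noteq> None" using at None_le option.distinct(1) by metis
      then obtain v b where ab: "a = Some (v, b)" by (cases a) auto
      show "(a, Some (w, s)) \<in> S"
      proof (cases "v = w")
        case True
        then have "b \<in> B" using a ab unfolding B_def by blast
        then have "b = s \<or> lt (P w) b s" using s unfolding is_sup_def lt_def by blast
        then show ?thesis using ab True sF S.le_refl lt_within[OF _ st wF] S.lt_le by blast
      next
        case False
        then have "lt S a (Some (w, t))" using at ab unfolding lt_def by blast
        then have "lt W v w" using ab False lt_S_Some by blast
        then show ?thesis using ab aF sF lt_S_Some S.lt_le by blast
      qed
    next
      fix u assume u: "u \<in> Field S" "\<forall>a\<in>A. (a, u) \<in> S"
      show "(Some (w, s), u) \<in> S"
      proof (cases u)
        case None
        then show ?thesis using le_None[OF sF] by simp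
      next
        case (Some p)
        then obtain v b where ub: "u = Some (v, b)" by (cases p) auto
        then have v: "v \<in> Field W" "lt (P v) b (otop (P v))" "v \<in> V"
          using u Field_S_Some unfolding V_def by blast+
        show ?thesis
        proof (cases "v = w")
          case True
          have "(c, b) \<in> P w" if "c \<in> B" for c
          proof (rule ccontr)
            assume "(c, b) \<notin> P w"
            then have "lt (P w) b c" using Pw.le_lt_cases BF[OF that] v True Pw.lt_Field by blast
            then have "lt S u (Some (w, c))" using lt_within BF[OF that] wF True ub by blast
            then show False using u that S.lt_asym unfolding B_def by blast
          qed
          then have "(s, b) \<in> P w" using s v True Pw.lt_Field unfolding is_sup_def by blast
          then have "s = b \<or> lt (P w) s b" by (auto simp: lt_def)
          then show ?thesis using ub True sF S.le_refl lt_within[OF _ _ wF] v S.lt_le by blast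
        next
          case False
          then have "lt W w v" using w(2)[OF v(3)] by (auto simp: lt_def)
          then show ?thesis using ub u(1) sF lt_S_Some S.lt_le by blast
        qed
      qed
    qed
    then show ?thesis by blast
  qed
qed

sublocale S: ordered_continuum S by (rule ordered_continuum_S)

lemma otop_S: "otop S = None"
  using S.lt_otop_iff[of None] not_None_lt[of "otop S"] Field_S_None by metis

lemma dense_in_S:
  assumes "\<And>w. w \<in> Field W \<Longrightarrow> dense_in (P w) (Q w)"
  shows "dense_in S {Some (w, q) | w q. w \<in> Field W \<and> q \<in> Q w \<and> lt (P w) q (otop (P w))}"
  unfolding dense_in_def
proof (intro conjI allI impI)
  show "{Some (w, q) | w q. w \<in> Field W \<and> q \<in> Q w \<and> lt (P w) q (otop (P w))} \<subseteq> Field S"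
    using Field_S_Some by blast
  fix x y assume "lt S x y"
  then obtain w s t where x: "x = Some (w, s)" "w \<in> Field W" "lt (P w) s t" "lt (P w) t (otop (P w))"
    "(Some (w, t), y) \<in> S" using within_interval by blast
  interpret Pw: ordered_continuum "P w" using P x(2) .
  obtain q where q: "q \<in> Q w" "lt (P w) s q" "lt (P w) q t"
    using assms[OF x(2)] x(3) unfolding dense_in_def by blast
  have qt: "lt (P w) q (otop (P w))" using q(3) x(4) Pw.lt_trans by blast
  then have "lt S x (Some (w, q))" using lt_within[OF q(2) _ x(2)] x(1) by blast
  moreover have "lt S (Some (w, q)) y" using lt_within[OF q(3) x(4,2)] x(5) S.lt_le_trans by blast
  ultimately show "\<exists>q\<in>{Some (w, q) | w q. w \<in> Field W \<and> q \<in> Q w \<and> lt (P w) q (otop (P w))}.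
      lt S x q \<and> lt S q y" using q(1) qt x(2) by blast
qed

text \<open>
  The points just above \<open>(w, t)\<close> belong to the same summand, since \<open>t\<close> is not its top.
\<close>

lemma right_small_Some:
  assumes "Some (w, t) \<in> Field S"
  shows "right_small m S (Some (w, t)) \<longleftrightarrow> right_small m (P w) t"
proof -
  have w: "w \<in> Field W" and tt: "lt (P w) t (otop (P w))" using assms Field_S_Some by blast+
  interpret Pw: ordered_continuum "P w" using P w .
  show ?thesis
  proof
    assume "right_small m (P w) t"
    then obtain A where A: "|A| \<le>o m" "\<And>a. a \<in> A \<Longrightarrow> lt (P w) t a"
      "\<And>y. lt (P w) t y \<Longrightarrow> \<exists>a\<in>A. (a, y) \<in> P w" unfolding right_small_def by blast
    let ?B = "(\<lambda>a. Some (w, a)) ` {a \<in> A. lt (P w) a (otop (P w))}"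
    have "|?B| \<le>o m" by (rule card_of_image_bound, rule card_of_subset_bound[OF _ A(1)]) blast
    moreover have "\<forall>b\<in>?B. lt S (Some (w, t)) b" using A(2) lt_within w by blast
    moreover have "\<exists>b\<in>?B. (b, y) \<in> S" if "lt S (Some (w, t)) y" for y
    proof -
      obtain u where u: "lt (P w) t u" "lt (P w) u (otop (P w))" "(Some (w, u), y) \<in> S"
        using within_interval[OF \<open>lt S (Some (w, t)) y\<close>] by blast
      obtain a where a: "a \<in> A" "(a, u) \<in> P w" using A(3) u(1) by blast
      then have at: "lt (P w) a (otop (P w))" using u(2) Pw.le_lt_trans by blast
      have "a = u \<or> lt (P w) a u" using a(2) by (auto simp: lt_def)
      then have "(Some (w, a), Some (w, u)) \<in> S"
        using lt_within[OF _ u(2) w] S.lt_le S.le_refl S.le_Field[OF u(3)] by blast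
      then show ?thesis using a(1) at u(3) S.le_trans by blast
    qed
    ultimately show "right_small m S (Some (w, t))" unfolding right_small_def by blast
  next
    assume "right_small m S (Some (w, t))"
    then obtain A where A: "|A| \<le>o m" "\<And>a. a \<in> A \<Longrightarrow> lt S (Some (w, t)) a"
      "\<And>y. lt S (Some (w, t)) y \<Longrightarrow> \<exists>a\<in>A. (a, y) \<in> S" unfolding right_small_def by blast
    let ?B = "(\<lambda>a. snd (the a)) ` {a \<in> A. \<exists>s. a = Some (w, s)}"
    have "|?B| \<le>o m" by (rule card_of_image_bound, rule card_of_subset_bound[OF _ A(1)]) blast
    moreover have "lt (P w) t s" if "Some (w, s) \<in> A" for s
      using A(2)[OF that] W.lt_irrefl lt_S_Some by blast
    then have "\<forall>b\<in>?B. lt (P w) t b" by auto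
    moreover have "\<exists>b\<in>?B. (b, y) \<in> P w" if y: "lt (P w) t y" for y
    proof -
      obtain u where u: "lt (P w) t u" "lt (P w) u y" using Pw.dense y by blast
      have ut: "lt (P w) u (otop (P w))" using Pw.lt_le_trans[OF u(2)] Pw.otop Pw.lt_Field[OF u(2)] by blast
      obtain a where a: "a \<in> A" "(a, Some (w, u)) \<in> S" using A(3) lt_within[OF u(1) ut w] by blast
      have a': "lt S (Some (w, t)) a" using A(2) a(1) by blast
      have "a \<noteq> None" using a(2) None_le option.distinct(1) by metis
      then obtain v b where ab: "a = Some (v, b)" by (cases a) auto
      have 1: "v = w \<and> b = u \<or> lt W v w \<or> v = w \<and> lt (P v) b u"
        using a(2) ab lt_S_Some[of v b w u] by (auto simp: lt_def[of S])
      moreover have "lt W w v \<or> w = v \<and> lt (P w) t b"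
        using a' ab lt_S_Some by blast
      ultimately have "v = w" "b = u \<or> lt (P w) b u" using W.lt_trans W.lt_irrefl by blast+
      then have "(b, y) \<in> P w" using u(2) Pw.lt_trans Pw.lt_le by blast
      moreover have "b \<in> ?B" using a(1) ab \<open>v = w\<close> by force
      ultimately show ?thesis by blast
    qed
    ultimately show "right_small m (P w) t" unfolding right_small_def by blast
  qed
qed

text \<open>
  A small cofinal set below \<open>x\<close> is assembled from a small set \<open>A0\<close> and from small cofinal sets
  below the tops of few summands with indices in \<open>C\<close>.
\<close>

lemma left_small_sum:
  assumes m: "Cinfinite m" and x: "x \<in> Field S"
    and A0: "|A0| \<le>o m" "\<And>a. a \<in> A0 \<Longrightarrow> lt S a x"
    and C: "|C| \<le>o m" "C \<subseteq> Field W" "\<And>c a. c \<in> C \<Longrightarrow> lt (P c) a (otop (P c)) \<Longrightarrow> lt S (Some (c, a)) x"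
    and cof: "\<And>v s. lt S (Some (v, s)) x \<Longrightarrow> (\<exists>a\<in>A0. (Some (v, s), a) \<in> S) \<or> (\<exists>c\<in>C. (v, c) \<in> W)"
    and top: "\<And>c. c \<in> C \<Longrightarrow> left_small m (P c) (otop (P c))"
  shows "left_small m S x"
proof -
  from top have "\<forall>c\<in>C. \<exists>A. |A| \<le>o m \<and> (\<forall>a\<in>A. lt (P c) a (otop (P c))) \<and>
      (\<forall>y. lt (P c) y (otop (P c)) \<longrightarrow> (\<exists>a\<in>A. (y, a) \<in> P c))"
    unfolding left_small_def by blast
  then obtain A where A: "\<And>c. c \<in> C \<Longrightarrow> |A c| \<le>o m"
    "\<And>c a. c \<in> C \<Longrightarrow> a \<in> A c \<Longrightarrow> lt (P c) a (otop (P c))"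
    "\<And>c y. c \<in> C \<Longrightarrow> lt (P c) y (otop (P c)) \<Longrightarrow> \<exists>a\<in>A c. (y, a) \<in> P c"
    by metis
  let ?U = "\<Union>c\<in>C. (\<lambda>a. Some (c, a)) ` A c"
  have "|?U| \<le>o m" using A(1) by (intro UNION_Cinfinite_bound C(1) m ballI card_of_image_bound) auto
  then have "|A0 \<union> ?U| \<le>o m" by (intro Un_Cinfinite_bound A0(1) m)
  moreover have "\<forall>a\<in>A0 \<union> ?U. lt S a x" using A0(2) C(3) A(2) by blast
  moreover have "\<exists>a\<in>A0 \<union> ?U. (y, a) \<in> S" if y: "lt S y x" for y
  proof -
    obtain v s where ys: "y = Some (v, s)" using y not_None_lt by (cases y) auto
    have yF: "v \<in> Field W" "lt (P v) s (otop (P v))" using y ys S.lt_Field Field_S_Some by blast+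
    from cof[OF y[unfolded ys]] show ?thesis
    proof
      assume "\<exists>a\<in>A0. (Some (v, s), a) \<in> S"
      then show ?thesis using ys by blast
    next
      assume "\<exists>c\<in>C. (v, c) \<in> W"
      then obtain c where c: "c \<in> C" "(v, c) \<in> W" by blast
      then have cF: "c \<in> Field W" using C(2) by blast
      interpret Pc: ordered_continuum "P c" using P cF .
      show ?thesis
      proof (cases "v = c")
        case True
        then obtain a where a: "a \<in> A c" "(s, a) \<in> P c" using A(3)[OF c(1)] yF by blast
        have at: "lt (P c) a (otop (P c))" using A(2)[OF c(1) a(1)] .
        have "s = a \<or> lt (P c) s a" using a(2) by (auto simp: lt_def)
        then have "(y, Some (c, a)) \<in> S"
          using lt_within[OF _ at cF] ys True S.lt_le S.le_refl S.lt_Field[OF y] by blast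
        then show ?thesis using a(1) c(1) by blast
      next
        case False
        then have vc: "lt W v c" using c(2) by (simp add: lt_def)
        obtain a where a: "a \<in> A c" using A(3)[OF c(1) Pc.obot_lt_otop] by blast
        then have "Some (c, a) \<in> Field S" using A(2)[OF c(1)] cF Field_S_Some by blast
        then have "(y, Some (c, a)) \<in> S" using vc ys lt_S_Some S.lt_Field[OF y] S.lt_le by blast
        then show ?thesis using a(1) c(1) by blast
      qed
    qed
  qed
  ultimately show ?thesis unfolding left_small_def by blast
qed

text \<open>
  Below \<open>(w, t)\<close> there are points of the summand of \<open>w\<close>, cofinal unless \<open>t\<close> is its bottom, and
  points of earlier summands, which matter if \<open>t\<close> is the bottom. Small cofinal sets for both are
  united, so the two cases need not be distinguished.
\<close>

lemma left_small_Some: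
  assumes m: "Cinfinite m" and x: "Some (w, t) \<in> Field S" and t: "left_small m (P w) t"
    and C: "|C| \<le>o m" "\<And>c. c \<in> C \<Longrightarrow> lt W c w" "\<And>v. lt W v w \<Longrightarrow> \<exists>c\<in>C. (v, c) \<in> W"
    and top: "\<And>c. c \<in> C \<Longrightarrow> left_small m (P c) (otop (P c))"
  shows "left_small m S (Some (w, t))"
proof -
  have w: "w \<in> Field W" and tt: "lt (P w) t (otop (P w))" using x Field_S_Some by blast+
  interpret Pw: ordered_continuum "P w" using P w .
  obtain A where A: "|A| \<le>o m" "\<And>a. a \<in> A \<Longrightarrow> lt (P w) a t"
    "\<And>y. lt (P w) y t \<Longrightarrow> \<exists>a\<in>A. (y, a) \<in> P w" using t unfolding left_small_def by blast
  show ?thesis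
  proof (rule left_small_sum[OF m x card_of_image_bound[OF A(1), of "\<lambda>a. Some (w, a)"] _ C(1)])
    show "lt S a (Some (w, t))" if "a \<in> (\<lambda>a. Some (w, a)) ` A" for a
      using that A(2) lt_within[OF _ tt w] by blast
    show "C \<subseteq> Field W" using C(2) W.lt_Field by blast
    show "lt S (Some (c, a)) (Some (w, t))" if "c \<in> C" "lt (P c) a (otop (P c))" for c a
      using C(2)[OF that(1)] that(2) x W.lt_Field Field_S_Some lt_S_Some by blast
    show "left_small m (P c) (otop (P c))" if "c \<in> C" for c using top that .
    fix v s assume vs: "lt S (Some (v, s)) (Some (w, t))"
    then have "lt W v w \<or> v = w \<and> lt (P v) s t" using lt_S_Some by blast
    then show "(\<exists>a\<in>(\<lambda>a. Some (w, a)) ` A. (Some (v, s), a) \<in> S) \<or> (\<exists>c\<in>C. (v, c) \<in> W)"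
    proof
      assume "lt W v w"
      then show ?thesis using C(3) by blast
    next
      assume v: "v = w \<and> lt (P v) s t"
      then obtain a where a: "a \<in> A" "(s, a) \<in> P w" using A(3) by blast
      have at: "lt (P w) a (otop (P w))" using A(2)[OF a(1)] tt Pw.lt_trans by blast
      have "s = a \<or> lt (P w) s a" using a(2) by (auto simp: lt_def)
      then have "(Some (v, s), Some (w, a)) \<in> S"
        using lt_within[OF _ at w] v S.lt_le S.le_refl S.lt_Field[OF vs] by blast
      then show ?thesis using a(1) by blast
    qed
  qed
qed

lemma left_small_None:
  assumes m: "Cinfinite m" and W: "|Field W| \<le>o m"
    and top: "\<And>c. c \<in> Field W \<Longrightarrow> left_small m (P c) (otop (P c))"
  shows "left_small m S None"
proof (rule left_small_sum[where ?A0.0 = "{}", OF m Field_S_None _ _ W subset_refl])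
  show "|{}| \<le>o m" using card_of_empty1 m by blast
  show "lt S (Some (c, a)) None" if "c \<in> Field W" "lt (P c) a (otop (P c))" for c a
    using that lt_S_None Field_S_Some by blast
  show "left_small m (P c) (otop (P c))" if "c \<in> Field W" for c using top that .
  fix v s assume vs: "lt S (Some (v, s)) None"
  have "v \<in> Field W" using S.lt_Field[OF vs] Field_S_Some by blast
  then show "(\<exists>a\<in>{}. (Some (v, s), a) \<in> S) \<or> (\<exists>c\<in>Field W. (v, c) \<in> W)"
    using W.le_refl by blast
qed simp

text \<open>
  The indices of the summands below \<open>x\<close> have \<open>V\<close> as a cofinal subset. If no set of at most
  \<open>m\<close> indices is cofinal among them, then no set of at most \<open>m\<close> points is cofinal below \<open>x\<close>.
\<close>

lemma not_left_small:
  assumes below: "\<And>v. v \<in> V \<Longrightarrow> lt S (Some (v, obot (P v))) x" "\<And>v s. lt S (Some (v, s)) x \<Longrightarrow> \<exists>u\<in>V. (v, u) \<in> W"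
    and V: "\<And>D. D \<subseteq> Field W \<Longrightarrow> |D| \<le>o m \<Longrightarrow> \<forall>d\<in>D. \<exists>u\<in>V. (d, u) \<in> W \<Longrightarrow> \<exists>u\<in>V. \<forall>d\<in>D. lt W d u"
  shows "\<not> left_small m S x"
proof
  assume "left_small m S x"
  then obtain A where A: "|A| \<le>o m" "\<And>a. a \<in> A \<Longrightarrow> lt S a x"
    "\<And>y. lt S y x \<Longrightarrow> \<exists>a\<in>A. (y, a) \<in> S" unfolding left_small_def by blast
  let ?D = "(\<lambda>a. fst (the a)) ` A"
  have D: "\<exists>v s. a = Some (v, s) \<and> v \<in> Field W \<and> (\<exists>u\<in>V. (v, u) \<in> W)" if "a \<in> A" for a
  proof -
    have ax: "lt S a x" using A(2) that .
    then obtain v s where "a = Some (v, s)" using not_None_lt by (cases a) auto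
    then show ?thesis using ax below(2) S.lt_Field[OF ax] Field_S_Some by blast
  qed
  have "|?D| \<le>o m" by (rule card_of_image_bound[OF A(1)])
  moreover have "?D \<subseteq> Field W" "\<forall>d\<in>?D. \<exists>u\<in>V. (d, u) \<in> W" using D by force+
  ultimately obtain u where u: "u \<in> V" "\<forall>d\<in>?D. lt W d u" using V by blast
  have ux: "lt S (Some (u, obot (P u))) x" using below(1) u(1) .
  then obtain a where a: "a \<in> A" "(Some (u, obot (P u)), a) \<in> S" using A(3) by blast
  obtain v s where vs: "a = Some (v, s)" using D a(1) by blast
  then have "lt W v u" using u(2) a(1) by force
  then have "lt S a (Some (u, obot (P u)))"
    using vs S.lt_Field[OF ux] S.le_Field[OF a(2)] lt_S_Some by blast
  then show False using a(2) S.lt_asym by blast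
qed

end

section \<open>Lexicographic powers with frozen tails\<close>

definition lex_less :: "'i rel \<Rightarrow> 'a rel \<Rightarrow> ('i \<Rightarrow> 'a) \<Rightarrow> ('i \<Rightarrow> 'a) \<Rightarrow> bool" where
  "lex_less W r x y \<longleftrightarrow> (\<exists>i\<in>Field W. (\<forall>j. lt W j i \<longrightarrow> x j = y j) \<and> lt r (x i) (y i))"

text \<open>
  Sequences indexed by \<open>W\<close>, ordered by first difference, that become constantly bottom as soon as a
  term lies outside \<open>E\<close>. Freezing keeps the density at the number of short sequences in \<open>E\<close>,
  whereas the unrestricted power would branch at every point of \<open>r\<close>. Outside of \<open>Field W\<close> the
  sequences take the bottom as default value, so frozen tails and unused arguments look alike.
\<close>

definition lex_power_order :: "'i rel \<Rightarrow> 'a rel \<Rightarrow> 'a set \<Rightarrow> ('i \<Rightarrow> 'a) rel" where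
  "lex_power_order W r E = of_strict {x. (\<forall>i. x i \<in> Field r) \<and> (\<forall>i. i \<notin> Field W \<longrightarrow> x i = obot r) \<and>
     (\<forall>i j. lt W i j \<and> x i \<notin> E \<longrightarrow> x j = obot r)} (lex_less W r)"

definition prefix_then :: "'i rel \<Rightarrow> 'a rel \<Rightarrow> ('i \<Rightarrow> 'a) \<Rightarrow> 'i \<Rightarrow> 'a \<Rightarrow> 'i \<Rightarrow> 'a" where
  "prefix_then W r x i e = (\<lambda>j. if lt W j i then x j else if j = i then e else obot r)"

locale lex_power = R: ordered_continuum r for r :: "'a rel" +
  fixes W :: "'i rel" and E :: "'a set"
  assumes wo: "Well_order W" and W_ne: "Field W \<noteq> {}" and E: "dense_in r E"
begin

sublocale W: linord W by (rule linord_Well_order[OF wo])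

abbreviation "L \<equiv> lex_power_order W r E"
abbreviation "graft \<equiv> prefix_then W r"

lemma Field_L: "x \<in> Field L \<longleftrightarrow> (\<forall>i. x i \<in> Field r) \<and> (\<forall>i. i \<notin> Field W \<longrightarrow> x i = obot r) \<and>
     (\<forall>i j. lt W i j \<and> x i \<notin> E \<longrightarrow> x j = obot r)"
  unfolding lex_power_order_def Field_of_strict by simp

lemma frozen: "x \<in> Field L \<Longrightarrow> lt W i j \<Longrightarrow> x i \<notin> E \<Longrightarrow> x j = obot r"
  unfolding Field_L by blast

lemma lt_L: "lt L x y \<longleftrightarrow> x \<in> Field L \<and> y \<in> Field L \<and>
    (\<exists>i\<in>Field W. (\<forall>j. lt W j i \<longrightarrow> x j = y j) \<and> lt r (x i) (y i))"
proof -
  have "\<not> lex_less W r x x" for x by (auto simp: lex_less_def lt_def)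
  then show ?thesis unfolding lex_power_order_def Field_of_strict by (subst lt_of_strict) (auto simp: lex_less_def)
qed

lemma first_difference:
  assumes "x \<in> Field L" "y \<in> Field L" "x \<noteq> y"
  shows "\<exists>i\<in>Field W. (\<forall>j. lt W j i \<longrightarrow> x j = y j) \<and> x i \<noteq> y i"
proof -
  let ?D = "{i \<in> Field W. x i \<noteq> y i}"
  have "?D \<noteq> {}"
  proof
    assume "?D = {}"
    then have "x i = y i" for i using assms(1,2) unfolding Field_L by (cases "i \<in> Field W") auto
    then show False using assms(3) by blast
  qed
  then obtain m where m: "m \<in> ?D" "\<And>s. s \<in> ?D \<Longrightarrow> (m, s) \<in> W"
    using Well_order_least[OF wo, of ?D] by blast
  have "x j = y j" if "lt W j m" for j
    using m(2)[of j] W.lt_Field[OF that] W.lt_asym[OF that] by blast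
  then show ?thesis using m(1) by blast
qed

text \<open>
  If a term before the first difference were outside \<open>E\<close>, both sequences would be frozen from there
  on and could not differ.
\<close>

lemma prefix_in_E:
  assumes "x \<in> Field L" "y \<in> Field L" "\<forall>j. lt W j i \<longrightarrow> x j = y j" "x i \<noteq> y i" "lt W j i"
  shows "x j \<in> E"
  using frozen[OF assms(1,5)] frozen[OF assms(2,5)] assms(3-5) by metis

lemma graft_Field:
  assumes "\<forall>j. lt W j i \<longrightarrow> x j \<in> E" "i \<in> Field W" "e \<in> Field r"
  shows "graft x i e \<in> Field L"
  unfolding Field_L
proof (intro conjI allI impI)
  have EF: "E \<subseteq> Field r" using E unfolding dense_in_def by blast
  show "graft x i e j \<in> Field r" for j
    unfolding prefix_then_def using assms EF R.obot(1) by auto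
  show "graft x i e j = obot r" if "j \<notin> Field W" for j
    unfolding prefix_then_def using that W.lt_Field assms(2) by auto
  fix a b assume ab: "lt W a b \<and> graft x i e a \<notin> E"
  then have "\<not> lt W a i" using assms(1) unfolding prefix_then_def by auto
  then have "\<not> lt W b i" "b \<noteq> i" using ab W.lt_trans by blast+
  then show "graft x i e b = obot r" unfolding prefix_then_def by simp
qed

lemma graft_simps [simp]:
  "lt W j i \<Longrightarrow> graft x i e j = x j" "graft x i e i = e"
  unfolding prefix_then_def by (auto simp: lt_def)

lemma linord_L: "linord L"
proof -
  have L: "L = of_strict (Field L) (lex_less W r)"
    unfolding lex_power_order_def Field_of_strict by simp
  have "linord (of_strict (Field L) (lex_less W r))"
  proof (rule linord_of_strict)
    show "\<not> lex_less W r x x" for x by (auto simp: lex_less_def lt_def)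
    fix x y z assume F: "x \<in> Field L" "y \<in> Field L" "z \<in> Field L"
    { assume "lex_less W r x y" "lex_less W r y z"
      then obtain i k where i: "i \<in> Field W" "\<And>j. lt W j i \<Longrightarrow> x j = y j" "lt r (x i) (y i)"
        and k: "k \<in> Field W" "\<And>j. lt W j k \<Longrightarrow> y j = z j" "lt r (y k) (z k)"
        unfolding lex_less_def by blast
      consider "lt W i k" | "i = k" | "lt W k i" using W.lt_cases i k by blast
      then show "lex_less W r x z"
      proof cases
        case 1
        then have "\<forall>j. lt W j i \<longrightarrow> x j = z j" using i(2) k(2) W.lt_trans by metis
        moreover have "lt r (x i) (z i)" using i(3) k(2)[OF 1] by simp
        ultimately show ?thesis unfolding lex_less_def using i(1) by blast
      next
        case 2
        then have "\<forall>j. lt W j i \<longrightarrow> x j = z j" using i(2) k(2) by metis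
        moreover have "lt r (x i) (z i)" using i(3) k(3) 2 R.lt_trans by blast
        ultimately show ?thesis unfolding lex_less_def using i(1) by blast
      next
        case 3
        then have "\<forall>j. lt W j k \<longrightarrow> x j = z j" using i(2) k(2) W.lt_trans by metis
        moreover have "lt r (x k) (z k)" using k(3) i(2)[OF 3] by simp
        ultimately show ?thesis unfolding lex_less_def using k(1) by blast
      qed }
    { assume "x \<noteq> y"
      then obtain i where i: "i \<in> Field W" "\<forall>j. lt W j i \<longrightarrow> x j = y j" "x i \<noteq> y i"
        using first_difference F by blast
      have "x i \<in> Field r" "y i \<in> Field r" using F unfolding Field_L by auto
      then have "lt r (x i) (y i) \<or> lt r (y i) (x i)" using R.lt_cases i(3) by blast
      then show "lex_less W r x y \<or> lex_less W r y x"
        unfolding lex_less_def using i by metis }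
  qed
  then show ?thesis using L by simp
qed

sublocale L: linord L by (rule linord_L)

lemma lt_LI: "x \<in> Field L \<Longrightarrow> y \<in> Field L \<Longrightarrow> i \<in> Field W \<Longrightarrow> (\<And>j. lt W j i \<Longrightarrow> x j = y j) \<Longrightarrow>
    lt r (x i) (y i) \<Longrightarrow> lt L x y"
  unfolding lt_L by blast

lemma lt_LE:
  assumes "lt L x y"
  obtains i where "i \<in> Field W" "\<And>j. lt W j i \<Longrightarrow> x j = y j" "lt r (x i) (y i)"
    "\<And>j. lt W j i \<Longrightarrow> x j \<in> E"
proof -
  obtain i where i: "i \<in> Field W" "\<forall>j. lt W j i \<longrightarrow> x j = y j" "lt r (x i) (y i)"
    and F: "x \<in> Field L" "y \<in> Field L"
    using assms unfolding lt_L by blast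
  have "x i \<noteq> y i" using i(3) by (simp add: lt_def)
  then show ?thesis using that[OF i(1) _ i(3)] i(2) prefix_in_E[OF F i(2)] by blast
qed

text \<open>
  The supremum is computed term by term by well-founded recursion: its \<open>i\<close>-th term is the supremum
  of the \<open>i\<close>-th terms of those members that agree with it before \<open>i\<close>. When no member is left, or
  when the remaining ones are frozen, this supremum is the bottom, so the result is frozen too.
\<close>

lemma sup_exists:
  assumes A: "A \<subseteq> Field L"
  shows "\<exists>s. is_sup L A s"
proof -
  define sp where "sp B = (SOME s. is_sup r B s)" for B
  have sp: "is_sup r B (sp B)" if "B \<subseteq> Field r" for B
    unfolding sp_def using someI_ex[OF R.complete[OF that]] .
  have sp_bot: "sp B = obot r" if "B \<subseteq> {obot r}" for B
  proof -
    have B: "is_sup r B (sp B)" using sp that R.obot(1) by blast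
    have "(b, obot r) \<in> r" if "b \<in> B" for b
    proof -
      have "b = obot r" using that \<open>B \<subseteq> {obot r}\<close> by blast
      then show ?thesis using R.obot(1) R.le_refl by simp
    qed
    then have "(sp B, obot r) \<in> r" using B R.obot(1) unfolding is_sup_def by blast
    moreover have "(obot r, sp B) \<in> r" using B R.obot(2) unfolding is_sup_def by blast
    ultimately show ?thesis using R.le_antisym by blast
  qed
  define H where "H = (\<lambda>f i. if i \<in> Field W then sp {a i |a. a \<in> A \<and> (\<forall>j. (j, i) \<in> W - Id \<longrightarrow> a j = f j)} else obot r)"
  define s where "s = wfrec (W - Id) H"
  have wf: "wf (W - Id)" using wo by (simp add: well_order_on_def)
  define B where "B i = {a i |a. a \<in> A \<and> (\<forall>j. lt W j i \<longrightarrow> a j = s j)}" for i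
  have ltW: "(j, i) \<in> W - Id \<longleftrightarrow> lt W j i" for i j by (auto simp: lt_def)
  have s_eq: "s i = (if i \<in> Field W then sp (B i) else obot r)" for i
  proof -
    have "s i = H (Wfrec.cut s (W - Id) i) i" unfolding s_def by (rule wfrec[OF wf])
    also have "\<dots> = H s i"
    proof -
      have "{a i |a. a \<in> A \<and> (\<forall>j. (j, i) \<in> W - Id \<longrightarrow> a j = Wfrec.cut s (W - Id) i j)} =
        {a i |a. a \<in> A \<and> (\<forall>j. (j, i) \<in> W - Id \<longrightarrow> a j = s j)}"
        by (intro Collect_cong ex_cong1 conj_cong all_cong1 refl) (auto simp: cut_apply)
      then show ?thesis unfolding H_def by simp
    qed
    finally show ?thesis unfolding H_def ltW B_def .
  qed
  have BF: "B i \<subseteq> Field r" for i using A unfolding B_def Field_L by (auto dest!: subsetD simp: Field_L)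
  have s_sup: "is_sup r (B i) (s i)" if "i \<in> Field W" for i using s_eq[of i] sp[OF BF] that by simp
  have sF: "s \<in> Field L"
    unfolding Field_L
  proof (intro conjI allI impI)
    show "s i \<in> Field r" for i
      using s_sup[of i] s_eq[of i] R.obot(1) unfolding is_sup_def by (cases "i \<in> Field W") auto
    show "s i = obot r" if "i \<notin> Field W" for i using s_eq that by simp
    fix i j assume ij: "lt W i j \<and> s i \<notin> E"
    have "B j \<subseteq> {obot r}"
    proof
      fix b assume "b \<in> B j"
      then obtain a where a: "a \<in> A" "\<forall>k. lt W k j \<longrightarrow> a k = s k" "b = a j" unfolding B_def by blast
      then have "a i \<notin> E" using ij by simp
      then show "b \<in> {obot r}" using frozen[of a i j] a A ij by blast
    qed
    then show "s j = obot r" using s_eq[of j] sp_bot by auto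
  qed
  have upper: "(a, s) \<in> L" if a: "a \<in> A" for a
  proof (cases "a = s")
    case True then show ?thesis using sF L.le_refl by blast
  next
    case False
    have aF: "a \<in> Field L" using A a by blast
    obtain i where i: "i \<in> Field W" "\<forall>j. lt W j i \<longrightarrow> a j = s j" "a i \<noteq> s i"
      using first_difference[OF aF sF False] by blast
    have "a i \<in> B i" unfolding B_def using a i(2) by blast
    then have "(a i, s i) \<in> r" using s_sup[OF i(1)] unfolding is_sup_def by blast
    then have "lt r (a i) (s i)" using i(3) by (simp add: lt_def)
    then show ?thesis using lt_LI[OF aF sF i(1)] i(2) L.lt_le by blast
  qed
  have least: "(s, u) \<in> L" if u: "u \<in> Field L" "\<forall>a\<in>A. (a, u) \<in> L" for u
  proof (rule ccontr)
    assume "(s, u) \<notin> L"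
    then have "lt L u s" using L.le_lt_cases sF u(1) by blast
    then obtain i where i: "i \<in> Field W" "\<And>j. lt W j i \<Longrightarrow> u j = s j" "lt r (u i) (s i)"
      by (rule lt_LE) blast
    have "\<exists>b\<in>B i. (b, u i) \<notin> r"
      using s_sup[OF i(1)] R.lt_Field[OF i(3)] R.lt_asym[OF i(3)] unfolding is_sup_def by blast
    then obtain a where a: "a \<in> A" "\<forall>j. lt W j i \<longrightarrow> a j = s j" "(a i, u i) \<notin> r"
      unfolding B_def by blast
    have aF: "a \<in> Field L" using A a(1) by blast
    have "lt r (u i) (a i)" using R.le_lt_cases[of "a i" "u i"] a(3) aF u(1) unfolding Field_L by blast
    then have "lt L u a" using lt_LI[OF u(1) aF i(1)] i(2) a(2) by simp
    then show False using u(2) a(1) L.lt_asym by blast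
  qed
  show ?thesis unfolding is_sup_def using sF upper least by blast
qed

text \<open>
  Cutting the smaller sequence at the first difference and appending an element of \<open>E\<close> between the
  two differing terms separates the sequences.
\<close>

lemma dense_in_L:
  "dense_in L (\<Union>i\<in>Field W. {z. (\<forall>j. (j, i) \<in> W \<longrightarrow> z j \<in> E) \<and> (\<forall>j. (j, i) \<notin> W \<longrightarrow> z j = obot r)})"
    (is "dense_in L ?Z")
  unfolding dense_in_def
proof (intro conjI allI impI)
  have EF: "E \<subseteq> Field r" using E unfolding dense_in_def by blast
  show "?Z \<subseteq> Field L"
  proof
    fix z assume "z \<in> ?Z"
    then obtain i where i: "i \<in> Field W" "\<And>j. (j, i) \<in> W \<Longrightarrow> z j \<in> E" "\<And>j. (j, i) \<notin> W \<Longrightarrow> z j = obot r"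
      by blast
    have "z = graft z i (z i)"
      unfolding prefix_then_def using i(3) W.le_refl[OF i(1)] by (auto simp: lt_def)
    moreover have "graft z i (z i) \<in> Field L"
      using graft_Field[OF _ i(1)] i(2)[OF W.lt_le] i(2)[OF W.le_refl[OF i(1)]] EF by blast
    ultimately show "z \<in> Field L" by simp
  qed
  fix x y assume xy: "lt L x y"
  then obtain i where i: "i \<in> Field W" "\<And>j. lt W j i \<Longrightarrow> x j = y j" "lt r (x i) (y i)"
    "\<And>j. lt W j i \<Longrightarrow> x j \<in> E" by (rule lt_LE) blast
  obtain e where e: "e \<in> E" "lt r (x i) e" "lt r e (y i)" using E i(3) unfolding dense_in_def by blast
  let ?z = "graft x i e"
  have zF: "?z \<in> Field L" using graft_Field[OF _ i(1)] i(4) R.lt_Field[OF e(2)] by blast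
  have "?z \<in> ?Z"
    using i(1,4) e(1) W.le_refl[OF i(1)] by (intro UN_I[OF i(1)]) (auto simp: prefix_then_def lt_def)
  moreover have "lt L x ?z"
    using L.lt_Field[OF xy] zF i(1) e(2) by (intro lt_LI[of _ _ i]) auto
  moreover have "lt L ?z y"
    using L.lt_Field[OF xy] zF i(1,2) e(3) by (intro lt_LI[of _ _ i]) auto
  ultimately show "\<exists>q\<in>?Z. lt L x q \<and> lt L q y" by blast
qed

lemma ordered_continuum_L: "ordered_continuum L"
proof
  show "\<exists>s. is_sup L A s" if "A \<subseteq> Field L" for A using sup_exists[OF that] .
  show "\<exists>z. lt L x z \<and> lt L z y" if "lt L x y" for x y
    using that dense_in_L unfolding dense_in_def by blast
  obtain i where i: "i \<in> Field W" "\<And>j. j \<in> Field W \<Longrightarrow> (i, j) \<in> W"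
    using Well_order_least[OF wo subset_refl W_ne] by blast
  have no: "\<not> lt W j i" for j using i(2) W.lt_Field W.lt_asym by blast
  have "graft x i e \<in> Field L" if "e \<in> Field r" for x e
    using graft_Field[OF _ i(1) that] no by blast
  then have "lt L (graft undefined i (obot r)) (graft undefined i (otop r))"
    using R.obot_lt_otop R.obot(1) R.otop(1) no i(1) by (intro lt_LI[of _ _ i]) auto
  then show "\<exists>x y. lt L x y" by blast
qed

sublocale L: ordered_continuum L by (rule ordered_continuum_L)

text \<open>
  Anything above \<open>x\<close> leaves it at some position \<open>i\<close> with an unfrozen initial segment, so the
  sequences that follow \<open>x\<close> up to such an \<open>i\<close>, continue with a member of a small coinitial set
  above \<open>x i\<close> and end in bottoms are coinitial above \<open>x\<close>.
\<close>

lemma right_small_L: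
  assumes m: "Cinfinite m" and W: "|Field W| \<le>o m" and r: "\<And>x. right_small m r x"
    and x: "x \<in> Field L"
  shows "right_small m L x"
proof -
  have "\<forall>t. \<exists>A. |A| \<le>o m \<and> (\<forall>a\<in>A. lt r t a) \<and> (\<forall>y. lt r t y \<longrightarrow> (\<exists>a\<in>A. (a, y) \<in> r))"
    using r unfolding right_small_def by (rule allI)
  from choice[OF this] obtain A where
    A0: "\<forall>t. |A t| \<le>o m \<and> (\<forall>a\<in>A t. lt r t a) \<and> (\<forall>y. lt r t y \<longrightarrow> (\<exists>a\<in>A t. (a, y) \<in> r))" ..
  have A: "\<And>t. |A t| \<le>o m" "\<And>t a. a \<in> A t \<Longrightarrow> lt r t a"
    "\<And>t y. lt r t y \<Longrightarrow> \<exists>a\<in>A t. (a, y) \<in> r"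
    using A0 by simp_all
  let ?I = "{i \<in> Field W. \<forall>j. lt W j i \<longrightarrow> x j \<in> E}"
  let ?B = "\<Union>i\<in>?I. graft x i ` A (x i)"
  have "|?I| \<le>o m" by (rule card_of_subset_bound[OF _ W]) blast
  then have "|?B| \<le>o m" using A(1) by (intro UNION_Cinfinite_bound m ballI card_of_image_bound) auto
  moreover have "lt L x b" if "b \<in> ?B" for b
  proof -
    obtain i a where i: "i \<in> Field W" "\<And>j. lt W j i \<Longrightarrow> x j \<in> E" "a \<in> A (x i)" "b = graft x i a"
      using \<open>b \<in> ?B\<close> by blast
    have a: "lt r (x i) a" using A(2) i(3) .
    have "b \<in> Field L" using graft_Field[OF _ i(1)] i(2) R.lt_Field[OF a] i(4) by blast
    then show ?thesis using x i a by (intro lt_LI[of _ _ i]) auto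
  qed
  moreover have "\<exists>b\<in>?B. (b, y) \<in> L" if y: "lt L x y" for y
  proof -
    obtain i where i: "i \<in> Field W" "\<And>j. lt W j i \<Longrightarrow> x j = y j" "lt r (x i) (y i)"
      "\<And>j. lt W j i \<Longrightarrow> x j \<in> E" using y by (rule lt_LE) blast
    obtain a where a: "a \<in> A (x i)" "(a, y i) \<in> r" using A(3) i(3) by blast
    let ?b = "graft x i a"
    have bF: "?b \<in> Field L" using graft_Field[OF _ i(1)] i(4) R.le_Field[OF a(2)] by blast
    have yF: "y \<in> Field L" using L.lt_Field[OF y] by blast
    have "(?b, y) \<in> L"
    proof (rule ccontr)
      assume "(?b, y) \<notin> L"
      then have "lt L y ?b" using L.le_lt_cases bF yF by blast
      then obtain k where k: "k \<in> Field W" "\<And>j. lt W j k \<Longrightarrow> y j = ?b j" "lt r (y k) (?b k)"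
        by (rule lt_LE) blast
      have "?b k = x k \<or> ?b k = a \<and> k = i \<or> ?b k = obot r" unfolding prefix_then_def by auto
      then consider "lt W k i" | "k = i" | "?b k = obot r" unfolding prefix_then_def by metis
      then show False
      proof cases
        case 1
        then show ?thesis using i(2) k(3) R.lt_irrefl by simp
      next
        case 2
        then show ?thesis using k(3) a(2) R.lt_asym by simp
      next
        case 3
        then show ?thesis using k(3) R.not_lt_obot by simp
      qed
    qed
    then show ?thesis using a(1) i(1,4) by blast
  qed
  ultimately show ?thesis unfolding right_small_def by blast
qed

text \<open>
  If the top of \<open>r\<close> belongs to \<open>E\<close>, then the top of the power is the constant sequence, and it is
  approached by its initial segments followed by bottoms.
\<close>

lemma left_small_otop_L:
  assumes W: "|Field W| \<le>o m" and limit: "\<And>i. i \<in> Field W \<Longrightarrow> \<exists>k. lt W i k" and top: "otop r \<in> E"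
  shows "left_small m L (otop L)"
proof -
  define T where "T i = (if i \<in> Field W then otop r else obot r)" for i
  have TF: "T \<in> Field L"
    unfolding Field_L T_def using R.otop(1) R.obot(1) W.lt_Field top by auto
  have T_top: "(x, T) \<in> L" if x: "x \<in> Field L" for x
  proof (rule ccontr)
    assume "(x, T) \<notin> L"
    then have "lt L T x" using L.le_lt_cases TF x by blast
    then obtain i where "i \<in> Field W" "lt r (T i) (x i)" by (rule lt_LE)
    then show False using R.not_otop_lt unfolding T_def by simp
  qed
  have T: "otop L = T"
    using L.le_antisym[OF T_top[OF L.otop(1)] L.otop(2)[OF TF]] by simp
  let ?B = "(\<lambda>i. graft T i (otop r)) ` Field W"
  have cF: "graft T i (otop r) \<in> Field L" if "i \<in> Field W" for i
    using graft_Field[OF _ that R.otop(1), of T] top W.lt_Field unfolding T_def by auto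
  have "|?B| \<le>o m" using W by (rule card_of_image_bound)
  moreover have "lt L b T" if b: "b \<in> ?B" for b
  proof -
    obtain i where i: "i \<in> Field W" "b = graft T i (otop r)" using b by blast
    obtain k where k: "lt W i k" using limit i(1) by blast
    have "\<not> lt W k i" "k \<noteq> i" using k W.lt_asym[OF k] W.lt_le W.lt_irrefl by blast+
    then have "b k = obot r" "T k = otop r"
      unfolding i(2) prefix_then_def T_def using W.lt_Field[OF k] by auto
    then have "b \<noteq> T" using R.obot_lt_otop by (auto simp: lt_def)
    then show ?thesis using T_top[of b] cF[OF i(1)] i(2) by (simp add: lt_def)
  qed
  moreover have "\<exists>b\<in>?B. (y, b) \<in> L" if y: "lt L y T" for y
  proof -
    obtain i where i: "i \<in> Field W" "\<And>j. lt W j i \<Longrightarrow> y j = T j" "lt r (y i) (T i)"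
      using y by (rule lt_LE) blast
    have "lt L y (graft T i (otop r))"
      using L.lt_Field[OF y] cF[OF i(1)] i by (intro lt_LI[of _ _ i]) (auto simp: T_def)
    then show ?thesis using i(1) L.lt_le by blast
  qed
  ultimately show ?thesis unfolding T left_small_def by blast
qed

end

section \<open>Richness of the countable power\<close>

lemma lt_natLeq [simp]: "lt natLeq i j \<longleftrightarrow> i < j"
  by (auto simp: lt_def natLeq_def)

text \<open>
  Let \<open>x < y\<close> first differ at \<open>i\<close> and choose \<open>e \<in> E\<close> between the two terms. The sequences that
  agree with \<open>x\<close> before \<open>i\<close> and have \<open>e\<close> at \<open>i\<close> lie between \<open>x\<close> and \<open>y\<close>. Their next
  term is arbitrary, which gives many points; fixing it to be an element \<open>b\<close> of \<open>E\<close> and letting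
  the term after it run from bottom to top gives an interval for every \<open>b\<close>.
\<close>

lemma rich_lex_power_order_natLeq:
  assumes r: "ordered_continuum r" and E: "dense_in r E" and k: "Card_order k" "k \<le>o |E|" and c: "c \<le>o |Field r|"
  shows "rich k c (lex_power_order natLeq r E)"
proof -
  interpret lex_power r natLeq E
    using r E natLeq_Well_order
    by (simp add: lex_power_def lex_power_axioms_def Field_natLeq)
  have FW: "i \<in> Field natLeq" for i by (simp add: Field_natLeq)
  have EF: "E \<subseteq> Field r" using E unfolding dense_in_def by blast
  have "|Field k| \<le>o |E|" using ordIso_ordLeq_trans[OF card_of_Field_ordIso[OF k(1)] k(2)] .
  then obtain g where g: "inj_on g (Field k)" "g ` Field k \<subseteq> E" using card_of_ordLeq by metis
  show ?thesis
    unfolding rich_def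
  proof (intro allI impI)
    fix x y assume xy: "lt L x y"
    obtain i where i0: "\<And>j. lt natLeq j i \<Longrightarrow> x j = y j" "lt r (x i) (y i)"
        "\<And>j. lt natLeq j i \<Longrightarrow> x j \<in> E"
      using xy by (rule lt_LE) blast
    have i: "\<And>j. j < i \<Longrightarrow> x j = y j" "lt r (x i) (y i)" "\<And>j. j < i \<Longrightarrow> x j \<in> E"
      using i0 by simp_all
    obtain e where e: "e \<in> E" "lt r (x i) e" "lt r e (y i)" using E i(2) unfolding dense_in_def by blast
    have F: "x \<in> Field L" "y \<in> Field L" using L.lt_Field[OF xy] by auto
    have below: "lt L x z \<and> lt L z y" if z: "z \<in> Field L" "\<And>j. j < i \<Longrightarrow> z j = x j" "z i = e" for z
      using lt_LI[OF F(1) z(1) FW[of i]] lt_LI[OF z(1) F(2) FW[of i]] z i(1) e by simp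
    \<comment> \<open>p b continues with b after e, and q b d continues with b and then d.\<close>
    define p where "p b = graft (x(i := e)) (Suc i) b" for b
    have p: "p b \<in> Field L" "\<And>j. j < i \<Longrightarrow> p b j = x j" "p b i = e" "p b (Suc i) = b" if "b \<in> Field r" for b
    proof -
      show "p b \<in> Field L"
        unfolding p_def by (rule graft_Field) (use that e(1) i(3) in \<open>auto simp: FW less_Suc_eq\<close>)
    qed (auto simp: p_def prefix_then_def)
    have inj: "inj_on p (Field r)"
    proof (rule inj_onI)
      fix b d assume bd: "b \<in> Field r" "d \<in> Field r" "p b = p d"
      have "b = p b (Suc i)" by (rule p(4)[OF bd(1), symmetric])
      also have "\<dots> = p d (Suc i)" by (rule fun_cong[OF bd(3)])
      also have "\<dots> = d" by (rule p(4)[OF bd(2)])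
      finally show "b = d" .
    qed
    have "p b \<in> {z. lt L x z \<and> lt L z y}" if "b \<in> Field r" for b
      unfolding mem_Collect_eq by (rule below) (use p[OF that] in auto)
    then have "|Field r| \<le>o |{z. lt L x z \<and> lt L z y}|" by (rule card_of_ordLeqI[OF inj])
    with c have 1: "c \<le>o |{z. lt L x z \<and> lt L z y}|" by (rule ordLeq_transitive)
    define q where "q b d = graft (x(i := e, Suc i := b)) (Suc (Suc i)) d" for b d
    have q: "q b d \<in> Field L" "\<And>j. j < i \<Longrightarrow> q b d j = x j" "q b d i = e" "q b d (Suc i) = b"
        "q b d (Suc (Suc i)) = d"
      if "b \<in> E" "d \<in> Field r" for b d
    proof -
      show "q b d \<in> Field L"
        unfolding q_def by (rule graft_Field) (use that e(1) i(3) in \<open>auto simp: FW less_Suc_eq\<close>)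
    qed (auto simp: q_def prefix_then_def)
    let ?u = "\<lambda>j. q (g j) (obot r)" and ?v = "\<lambda>j. q (g j) (otop r)"
    have gE: "g j \<in> E" if "j \<in> Field k" for j using g(2) that by blast
    note bt = R.obot(1) R.otop(1)
    have uv: "lt L (?u j) (?v j)" if "j \<in> Field k" for j
      by (rule lt_LI[OF q(1)[OF gE[OF that] bt(1)] q(1)[OF gE[OF that] bt(2)] FW[of "Suc (Suc i)"]])
        (use q[OF gE[OF that] bt(1)] q[OF gE[OF that] bt(2)] R.obot_lt_otop less_Suc_eq in \<open>auto simp: q_def\<close>)
    have sep: "lt L (?v j) (?u l)" if "j \<in> Field k" "l \<in> Field k" "lt r (g j) (g l)" for j l
      by (rule lt_LI[OF q(1)[OF gE[OF that(1)] bt(2)] q(1)[OF gE[OF that(2)] bt(1)] FW[of "Suc i"]])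
        (use q[OF gE[OF that(1)] bt(2)] q[OF gE[OF that(2)] bt(1)] that(3) less_Suc_eq in auto)
    have "(?v j, ?u l) \<in> L \<or> (?v l, ?u j) \<in> L" if "j \<in> Field k" "l \<in> Field k" "j \<noteq> l" for j l
    proof -
      have "g j \<noteq> g l" using g(1) that unfolding inj_on_def by blast
      then have "lt r (g j) (g l) \<or> lt r (g l) (g j)" using R.lt_cases gE that EF by blast
      then show ?thesis using sep that L.lt_le by blast
    qed
    moreover have ins: "lt L x (q (g j) d) \<and> lt L (q (g j) d) y" if "j \<in> Field k" "d \<in> Field r" for j d
      by (rule below) (use q[OF gE[OF that(1)] that(2)] in auto)
    ultimately have "disjoint_intervals k L x y ?u ?v"
      unfolding disjoint_intervals_def using uv bt by (intro ballI conjI impI) auto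
    then have "\<exists>u v. disjoint_intervals k L x y u v" by blast
    with 1 show "c \<le>o |{z. lt L x z \<and> lt L z y}| \<and> (\<exists>u v. disjoint_intervals k L x y u v)"
      by (rule conjI)
  qed
qed

section \<open>The basic continuum\<close>

lemma right_small_if_maximal: "(\<And>y. \<not> lt r x y) \<Longrightarrow> Cinfinite m \<Longrightarrow> right_small m r x"
  unfolding right_small_def using card_of_empty1 by (intro exI[of _ "{}"]) auto

definition unit_interval :: "real rel" where
  "unit_interval = of_strict {0..1} (<)"

lemma Field_unit_interval: "Field unit_interval = {0..1}"
  unfolding unit_interval_def by (rule Field_of_strict)

lemma lt_unit_interval: "lt unit_interval x y \<longleftrightarrow> 0 \<le> x \<and> x < y \<and> y \<le> 1"
  unfolding unit_interval_def by (subst lt_of_strict) auto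

lemma le_unit_interval: "(x, y) \<in> unit_interval \<longleftrightarrow> 0 \<le> x \<and> x \<le> y \<and> y \<le> 1"
  unfolding unit_interval_def of_strict_def by auto

lemma ordered_continuum_unit_interval: "ordered_continuum unit_interval"
proof -
  interpret linord unit_interval
    unfolding unit_interval_def by (rule linord_of_strict) auto
  show ?thesis
  proof
    show "\<exists>z. lt unit_interval x z \<and> lt unit_interval z y" if "lt unit_interval x y" for x y
      using that dense[of x y] by (fastforce simp: lt_unit_interval)
    have "lt unit_interval 0 1" by (simp add: lt_unit_interval)
    then show "\<exists>x y. lt unit_interval x y" by blast
    show "\<exists>s. is_sup unit_interval A s" if A: "A \<subseteq> Field unit_interval" for A
    proof (cases "A = {}")
      case True
      then show ?thesis
        by (intro exI[of _ 0]) (auto simp: is_sup_def Field_unit_interval le_unit_interval)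
    next
      case False
      have bdd: "bdd_above A" using A unfolding Field_unit_interval by (meson bdd_above_Icc bdd_above_mono)
      obtain a where a: "a \<in> A" using False by blast
      then have "0 \<le> a" using A Field_unit_interval by auto
      then have 0: "0 \<le> Sup A" using cSup_upper[OF a bdd] by linarith
      have 1: "Sup A \<le> 1" using A False unfolding Field_unit_interval by (intro cSup_least) auto
      show ?thesis
        unfolding is_sup_def Field_unit_interval le_unit_interval
        using 0 1 A cSup_upper[OF _ bdd] cSup_least[OF False]
        by (intro exI[of _ "Sup A"]) (auto simp: Field_unit_interval)
    qed
  qed
qed

lemma otop_unit_interval: "otop unit_interval = 1"
proof -
  interpret ordered_continuum unit_interval by (rule ordered_continuum_unit_interval)
  have "otop unit_interval \<le> 1" "1 \<le> otop unit_interval"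
    using otop(1) otop(2)[of 1] by (simp_all add: Field_unit_interval le_unit_interval)
  then show ?thesis by simp
qed

lemma dense_in_unit_interval: "dense_in unit_interval (\<rat> \<inter> {0..1})"
  unfolding dense_in_def Field_unit_interval lt_unit_interval
proof (intro conjI allI impI)
  fix x y :: real assume xy: "0 \<le> x \<and> x < y \<and> y \<le> 1"
  then obtain q where "q \<in> \<rat>" "x < q" "q < y" using Rats_dense_in_real by blast
  then show "\<exists>q\<in>\<rat> \<inter> {0..1}. (0 \<le> x \<and> x < q \<and> q \<le> 1) \<and> 0 \<le> q \<and> q < y \<and> y \<le> 1"
    using xy by (intro bexI[of _ q]) auto
qed blast

lemma card_of_countable_bound:
  assumes "countable A" "Cinfinite m"
  shows "|A| \<le>o m"
proof -
  obtain f :: "_ \<Rightarrow> nat" where "inj_on f A" using assms(1) unfolding countable_def by blast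
  then have "|A| \<le>o |UNIV :: nat set|" by (rule card_of_ordLeqI) simp
  then have "|A| \<le>o natLeq" using card_of_nat ordLeq_ordIso_trans by blast
  then show ?thesis using natLeq_ordLeq_cinfinite[OF assms(2)] ordLeq_transitive by blast
qed

text \<open>
  A real number is determined by the set of rational numbers below it.
\<close>

lemma card_of_real_bound:
  assumes l: "Cinfinite l" and m: "Cinfinite m"
  shows "|UNIV :: real set| \<le>o l ^c m"
proof -
  let ?f = "\<lambda>x :: real. {q \<in> \<rat>. q < x}"
  have "inj ?f"
  proof (rule linorder_injI)
    fix x y :: real assume "x < y"
    then obtain q where "q \<in> \<rat>" "x < q" "q < y" using Rats_dense_in_real by blast
    then have "q \<in> ?f y" "q \<notin> ?f x" by auto
    then show "?f x \<noteq> ?f y" by blast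
  qed
  then have "|UNIV :: real set| \<le>o |Pow (\<rat> :: real set)|" by (rule card_of_ordLeqI) auto
  also have "|Pow (\<rat> :: real set)| =o |Func (\<rat> :: real set) (UNIV :: bool set)|" by (rule card_of_Pow_Func)
  also have "|Func (\<rat> :: real set) (UNIV :: bool set)| = ctwo ^c |\<rat> :: real set|"
    unfolding cexp_def ctwo_def Field_card_of ..
  also have "ctwo ^c |\<rat> :: real set| \<le>o l ^c m"
  proof (rule cexp_mono'[OF ctwo_ordLeq_Cinfinite[OF l] card_of_countable_bound[OF countable_rat m]])
    show "Field |\<rat> :: real set| = {} \<Longrightarrow> Field m = {}" using Rats_0 unfolding Field_card_of by blast
  qed
  finally show ?thesis .
qed

lemma card_of_lex_power_order_bound:
  assumes l: "Card_order l" and m: "Cinfinite m" and W: "|Field W| \<le>o m" "Field W \<noteq> {}"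
    and r: "|Field r| \<le>o l ^c m"
  shows "|Field (lex_power_order W r E)| \<le>o l ^c m"
proof -
  let ?f = "\<lambda>x i. if i \<in> Field W then x i else undefined"
  have F: "x i \<in> Field r" "i \<notin> Field W \<Longrightarrow> x i = obot r" if "x \<in> Field (lex_power_order W r E)" for x i
    using that unfolding lex_power_order_def Field_of_strict by auto
  have "inj_on ?f (Field (lex_power_order W r E))"
  proof (rule inj_onI, rule ext)
    fix x y i assume xy: "x \<in> Field (lex_power_order W r E)" "y \<in> Field (lex_power_order W r E)" "?f x = ?f y"
    show "x i = y i"
    proof (cases "i \<in> Field W")
      case True then show ?thesis using fun_cong[OF xy(3), of i] by simp
    next
      case False then show ?thesis using F(2)[OF xy(1)] F(2)[OF xy(2)] by simp
    qed
  qed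
  then have "|Field (lex_power_order W r E)| \<le>o |Func (Field W) (Field r)|"
    by (rule card_of_ordLeqI) (use F in \<open>auto simp: Func_def\<close>)
  also have "|Func (Field W) (Field r)| = |Field r| ^c |Field W|"
    unfolding cexp_def Field_card_of ..
  also have "|Field r| ^c |Field W| \<le>o (l ^c m) ^c m"
    by (rule cexp_mono'[OF r W(1)]) (use W(2) in \<open>simp add: Field_card_of\<close>)
  also have "(l ^c m) ^c m =o l ^c m"
    using cexp_cprod_ordLeq[OF l m Cinfinite_Cnotzero[OF m]] ordLeq_refl m by blast
  finally show ?thesis .
qed

lemma card_of_finite_sequences:
  assumes k: "Cinfinite k" and E: "|E| \<le>o k"
  shows "|{z :: nat \<Rightarrow> 'a. (\<forall>j<n. z j \<in> E) \<and> (\<forall>j\<ge>n. z j = b)}| \<le>o k"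
proof (induction n)
  case 0
  have "{z :: nat \<Rightarrow> 'a. (\<forall>j<0. z j \<in> E) \<and> (\<forall>j\<ge>0. z j = b)} = {\<lambda>_. b}" by auto
  then show ?case using card_of_countable_bound[OF _ k, of "{\<lambda>_. b}"] by simp
next
  case (Suc n)
  let ?Z = "\<lambda>n. {z :: nat \<Rightarrow> 'a. (\<forall>j<n. z j \<in> E) \<and> (\<forall>j\<ge>n. z j = b)}"
  have "?Z (Suc n) \<subseteq> (\<lambda>(z, e). z(n := e)) ` (?Z n \<times> E)"
  proof
    fix z assume z: "z \<in> ?Z (Suc n)"
    then have "z(n := b) \<in> ?Z n" "z n \<in> E" by auto
    moreover have "z = (\<lambda>(z, e). z(n := e)) (z(n := b), z n)" by simp
    ultimately show "z \<in> (\<lambda>(z, e). z(n := e)) ` (?Z n \<times> E)" by (intro image_eqI[of z _ "(z(n := b), z n)"]) simp_all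
  qed
  moreover have "|(\<lambda>(z, e). z(n := e)) ` (?Z n \<times> E)| \<le>o k"
    by (intro card_of_image_bound card_of_Times_bound Suc E k)
  ultimately show ?case by (rule card_of_subset_bound)
qed

lemma dense_in_mono: "dense_in r Q \<Longrightarrow> Q \<subseteq> Q' \<Longrightarrow> Q' \<subseteq> Field r \<Longrightarrow> dense_in r Q'"
  unfolding dense_in_def by blast

lemma card_of_under_ordLess:
  assumes m: "Cinfinite m" and i: "i \<in> Field m"
  shows "|{j. (j, i) \<in> m}| <o m"
proof -
  have wo: "Well_order m" using m by (simp add: card_order_on_def)
  interpret linord m by (rule linord_Well_order[OF wo])
  obtain k where k: "k \<in> Field m" "i \<noteq> k" "(i, k) \<in> m"
    using infinite_Card_order_limit[of m i] m i unfolding cinfinite_def by blast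
  have "(j, k) \<in> m \<and> j \<noteq> k" if "(j, i) \<in> m" for j
    using le_lt_trans[OF that, of k] k by (simp add: lt_def)
  then have "{j. (j, i) \<in> m} \<subseteq> underS m k" unfolding underS_def by blast
  then have "|{j. (j, i) \<in> m}| \<le>o |underS m k|" by (rule card_of_mono1)
  then show ?thesis using card_of_underS[OF _ k(1)] m ordLeq_ordLess_trans by blast
qed

text \<open>
  The two powers described at the beginning: \<open>D\<close> is the long line with \<open>l\<close> unit intervals and
  \<open>K\<close> its power with exponent \<open>m\<close>. The hypothesis on \<open>l\<^sup><\<^sup>m\<close> counts the short sequences that
  are dense in \<open>K\<close>. The dense set \<open>EK\<close> for the second power is enlarged to size \<open>k\<close> in order to
  raise the weight, and it receives the top of \<open>K\<close> in order to make the top of \<open>L\<close> left-small.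
\<close>

lemma base_continuum:
  fixes k :: "'k rel" and l :: "'l rel" and m :: "'m rel"
  assumes k: "Cinfinite k" and l: "Cinfinite l" and m: "Cinfinite m"
    and mk: "m \<le>o k" and lk: "cexp_less l m \<le>o k" and kc: "k \<le>o l ^c m"
  shows "\<exists>L :: (nat \<Rightarrow> 'm \<Rightarrow> ('l \<times> real) option) rel.
    balanced_order k (l ^c m) L \<and> (\<forall>x\<in>Field L. right_small m L x) \<and> left_small m L (otop L)"
proof -
  have ctwo_l: "ctwo \<le>o l" by (rule ctwo_ordLeq_Cinfinite[OF l])
  have c: "Cinfinite (l ^c m)" using Cinfinite_cexp[OF ctwo_l m] .
  have lc: "l \<le>o l ^c m" using ordLeq_cexp1[of m l] l m Cinfinite_Cnotzero by blast
  have wl: "Well_order l" and wm: "Well_order m" using l m by (simp_all add: card_order_on_def)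
  have lne: "Field l \<noteq> {}" and mne: "Field m \<noteq> {}" using l m unfolding cinfinite_def by auto
  have Fl: "|Field l| \<le>o l" and Fm: "|Field m| \<le>o m" and lF: "l \<le>o |Field l|"
    using card_of_Field_ordIso l m ordIso_iff_ordLeq by blast+
  have nm: "|Field natLeq| \<le>o m"
    using card_of_Field_ordIso[OF natLeq_Card_order] natLeq_ordLeq_cinfinite[OF m] ordIso_ordLeq_trans by blast
  have mk': "|Field m| \<le>o k" using Fm mk by (rule ordLeq_transitive)
  have nk: "|Field natLeq| \<le>o k" using nm mk by (rule ordLeq_transitive)

  define D where "D = well_ordered_sum l (\<lambda>_. unit_interval)"
  interpret D: sum_of_continua l "\<lambda>_. unit_interval"
    by (rule sum_of_continua.intro[OF wl lne ordered_continuum_unit_interval])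
  have D: "ordered_continuum D" unfolding D_def by (rule D.ordered_continuum_S)
  interpret DC: ordered_continuum D by (rule D)
  define ED where "ED = {Some (w, q) | w q. w \<in> Field l \<and> q \<in> \<rat> \<inter> {0..1} \<and> lt unit_interval q (otop unit_interval)}"
  have ED: "dense_in D ED" unfolding D_def ED_def
    by (rule D.dense_in_S) (rule dense_in_unit_interval)
  have ED_card: "|ED| \<le>o l"
  proof -
    have "ED \<subseteq> Some ` (Field l \<times> (\<rat> \<inter> {0..1}))" unfolding ED_def by blast
    moreover have "|\<rat> \<inter> {0..1} :: real set| \<le>o l"
      by (rule card_of_countable_bound[OF _ l]) (simp add: countable_rat)
    then have "|Some ` (Field l \<times> (\<rat> \<inter> {0..1 :: real}))| \<le>o l"
      by (intro card_of_image_bound card_of_Times_bound Fl l)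
    ultimately show ?thesis by (rule card_of_subset_bound)
  qed
  have D_card: "|Field D| \<le>o l ^c m"
  proof -
    have "Field D \<subseteq> insert None (Some ` (Field l \<times> (UNIV :: real set)))"
      unfolding D_def well_ordered_sum_def Field_of_strict by blast
    moreover have "|Field l| \<le>o l ^c m" using Fl lc by (rule ordLeq_transitive)
    then have "|insert None (Some ` (Field l \<times> (UNIV :: real set)))| \<le>o l ^c m"
      by (intro card_of_insert_bound card_of_image_bound card_of_Times_bound c card_of_real_bound l m)
    ultimately show ?thesis by (rule card_of_subset_bound)
  qed
  have D_small: "right_small m D x" for x
  proof (cases "x \<in> Field D \<and> x \<noteq> None")
    case True
    then obtain w t where x: "x = Some (w, t)" by (cases x) auto
    have "right_small m unit_interval t"
      by (rule right_small_if_dense[OF ordered_continuum.axioms(1)[OF ordered_continuum_unit_interval] dense_in_unit_interval])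
        (rule card_of_countable_bound[OF _ m], simp add: countable_rat)
    then show ?thesis using D.right_small_Some True x unfolding D_def by blast
  next
    case False
    then have "\<not> lt D x y" for y
      using DC.lt_Field[of x y] D.not_None_lt[of y] unfolding D_def by metis
    then show ?thesis by (rule right_small_if_maximal) (rule m)
  qed

  define K where "K = lex_power_order m D ED"
  interpret K: lex_power D m ED
    using D ED wm mne by (simp add: lex_power_def lex_power_axioms_def)
  have K: "ordered_continuum K" unfolding K_def by (rule K.ordered_continuum_L)
  interpret KC: ordered_continuum K by (rule K)
  have K_card: "|Field K| \<le>o l ^c m"
    unfolding K_def using card_of_lex_power_order_bound[OF _ m Fm mne D_card] l by blast
  have K_card': "l ^c m \<le>o |Field K|"
  proof -
    \<comment> \<open>Sequences of left end points of the unit intervals stay inside ED, hence are never frozen.\<close>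
    let ?f = "\<lambda>\<phi> i. if i \<in> Field m then Some (\<phi> i, 0 :: real) else obot D"
    have "inj_on ?f (Func (Field m) (Field l))"
    proof (rule inj_onI, rule ext)
      fix \<phi> \<psi> i assume a: "\<phi> \<in> Func (Field m) (Field l)" "\<psi> \<in> Func (Field m) (Field l)" "?f \<phi> = ?f \<psi>"
      show "\<phi> i = \<psi> i"
        using fun_cong[OF a(3), of i] a(1,2) by (cases "i \<in> Field m") (auto simp: Func_def)
    qed
    moreover have "?f \<phi> \<in> Field K" if \<phi>: "\<phi> \<in> Func (Field m) (Field l)" for \<phi>
    proof -
      have E: "?f \<phi> i \<in> ED" if "i \<in> Field m" for i
        using that \<phi> by (auto simp: Func_def ED_def otop_unit_interval lt_unit_interval)
      have "?f \<phi> i \<in> Field D" for i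
        using E[of i] ED DC.obot(1) unfolding dense_in_def by (cases "i \<in> Field m") auto
      then show ?thesis
        unfolding K_def K.Field_L using E K.W.lt_Field by auto
    qed
    ultimately have "|Func (Field m) (Field l)| \<le>o |Field K|" by (rule card_of_ordLeqI)
    then show ?thesis unfolding cexp_def .
  qed
  have K_small: "right_small m K x" for x
  proof (cases "x \<in> Field K")
    case True
    then show ?thesis unfolding K_def using K.right_small_L[OF m Fm D_small] by blast
  next
    case False
    then have "\<not> lt K x y" for y using KC.lt_Field by blast
    then show ?thesis by (rule right_small_if_maximal) (rule m)
  qed
  \<comment> \<open>Z i consists of the sequences in ED that are frozen immediately after position i.\<close>
  define Z where "Z i = {z. (\<forall>j. (j, i) \<in> m \<longrightarrow> z j \<in> ED) \<and> (\<forall>j. (j, i) \<notin> m \<longrightarrow> z j = obot D)}" for i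
  have Z: "dense_in K (\<Union>i\<in>Field m. Z i)" unfolding K_def Z_def by (rule K.dense_in_L)
  have Z_card: "|Z i| \<le>o k" if i: "i \<in> Field m" for i
  proof -
    let ?U = "{j. (j, i) \<in> m}"
    let ?f = "\<lambda>z j. if j \<in> ?U then z j else undefined"
    have "inj_on ?f (Z i)"
    proof (rule inj_onI, rule ext)
      fix x y j assume xy: "x \<in> Z i" "y \<in> Z i" "?f x = ?f y"
      show "x j = y j"
        using fun_cong[OF xy(3), of j] xy(1,2) by (cases "j \<in> ?U") (auto simp: Z_def)
    qed
    then have "|Z i| \<le>o |Func ?U ED|"
      by (rule card_of_ordLeqI) (auto simp: Func_def Z_def)
    also have "|Func ?U ED| = |ED| ^c |?U|" unfolding cexp_def Field_card_of ..
    also have "|ED| ^c |?U| \<le>o l ^c |?U|" by (rule cexp_mono1[OF ED_card card_of_Card_order])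
    also have "l ^c |?U| \<le>o k"
      using lk[unfolded cexp_less_ordLeq_iff[OF l m conjunct2[OF k]]] card_of_under_ordLess[OF m i]
        card_of_Card_order by blast
    finally show ?thesis .
  qed
  have Z_union: "|\<Union>i\<in>Field m. Z i| \<le>o k" using Z_card by (intro UNION_Cinfinite_bound mk' k) auto
  have "|Field k| \<le>o |Field K|"
    using ordIso_ordLeq_trans[OF card_of_Field_ordIso ordLeq_transitive[OF kc K_card']] k by blast
  then obtain g where g: "inj_on g (Field k)" "g ` Field k \<subseteq> Field K" using card_of_ordLeq by metis
  define EK where "EK = insert (otop K) ((\<Union>i\<in>Field m. Z i) \<union> g ` Field k)"
  have kF: "|Field k| \<le>o k" using card_of_Field_ordIso k ordIso_iff_ordLeq by blast
  have EK_card: "|EK| \<le>o k"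
    unfolding EK_def by (intro card_of_insert_bound Un_Cinfinite_bound Z_union card_of_image_bound kF k)
  have EK_card': "k \<le>o |EK|"
  proof -
    have "|Field k| \<le>o |EK|" by (rule card_of_ordLeqI[OF g(1)]) (simp add: EK_def)
    then show ?thesis
      using ordIso_ordLeq_trans[OF ordIso_symmetric[OF card_of_Field_ordIso]] k by blast
  qed
  have EK: "dense_in K EK"
    by (rule dense_in_mono[OF Z]) (use Z g(2) KC.otop(1) in \<open>auto simp: EK_def dense_in_def\<close>)

  define L where "L = lex_power_order natLeq K EK"
  interpret L: lex_power K natLeq EK
    using K EK natLeq_Well_order by (simp add: lex_power_def lex_power_axioms_def Field_natLeq)
  have L: "ordered_continuum L" unfolding L_def by (rule L.ordered_continuum_L)
  have "rich k (l ^c m) L"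
    unfolding L_def by (rule rich_lex_power_order_natLeq[OF K EK _ EK_card' K_card']) (use k in blast)
  moreover have "|Field L| \<le>o l ^c m"
    unfolding L_def by (rule card_of_lex_power_order_bound[OF _ m nm _ K_card]) (use l in \<open>auto simp: Field_natLeq\<close>)
  moreover have "\<exists>Q. dense_in L Q \<and> |Q| \<le>o k"
  proof (intro exI conjI)
    let ?Z = "\<lambda>i. {z. (\<forall>j. (j, i) \<in> natLeq \<longrightarrow> z j \<in> EK) \<and> (\<forall>j. (j, i) \<notin> natLeq \<longrightarrow> z j = obot K)}"
    show "dense_in L (\<Union>i\<in>Field natLeq. ?Z i)" unfolding L_def by (rule L.dense_in_L)
    have "?Z i = {z. (\<forall>j<Suc i. z j \<in> EK) \<and> (\<forall>j\<ge>Suc i. z j = obot K)}" for i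
      unfolding natLeq_def by (auto simp: less_Suc_eq_le not_le Suc_le_eq)
    then have "|?Z i| \<le>o k" for i using card_of_finite_sequences[OF k EK_card] by simp
    then show "|\<Union>i\<in>Field natLeq. ?Z i| \<le>o k" by (intro UNION_Cinfinite_bound nk k) auto
  qed
  ultimately have "balanced_order k (l ^c m) L" using L unfolding balanced_order_def by blast
  moreover have "\<forall>x\<in>Field L. right_small m L x"
    unfolding L_def using L.right_small_L[OF m nm K_small] by blast
  moreover have "left_small m L (otop L)"
    unfolding L_def by (rule L.left_small_otop_L[OF nm]) (auto simp: EK_def)
  ultimately show ?thesis by blast
qed

section \<open>Sums and transported copies of balanced orders\<close>

text \<open>
  Richness is inherited from the summands through \<open>within_interval\<close>; the bound on the number of
  summands is what keeps a dense set of size \<open>k\<close>.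
\<close>

lemma (in sum_of_continua) balanced_order_S:
  assumes k: "Cinfinite k" and c: "Cinfinite c" and kc: "k \<le>o c" and W: "|Field W| \<le>o k"
    and balanced: "\<And>w. w \<in> Field W \<Longrightarrow> balanced_order k c (P w)"
  shows "balanced_order k c S"
  unfolding balanced_order_def
proof (intro conjI)
  show "ordered_continuum S" by (rule ordered_continuum_S)
  have kinf: "\<not> finite (Field k)" "Card_order k" and cinf: "\<not> finite (Field c)" "Card_order c"
    using k c unfolding cinfinite_def by auto
  show "rich k c S"
  proof (rule rich_if_intervals_contain_copies[OF linord_S])
    fix x y assume "lt S x y"
    then obtain w s t where x: "x = Some (w, s)" "w \<in> Field W" "lt (P w) s t" "lt (P w) t (otop (P w))"
      "(Some (w, t), y) \<in> S" using within_interval by blast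
    interpret Pw: ordered_continuum "P w" using P x(2) .
    have emb: "lt S (Some (w, p)) (Some (w, q))" if "lt (P w) p q" "lt (P w) q t" for p q
      using lt_within[OF that(1) _ x(2)] Pw.lt_trans[OF that(2) x(4)] by blast
    have "lt S (Some (w, p)) y" if "lt (P w) p t" for p
      using lt_within[OF that x(4,2)] x(5) S.lt_le_trans by blast
    then show "\<exists>(r :: 'a rel) a b h. linord r \<and> rich k c r \<and> lt r a b \<and>
       (\<forall>p q. lt r a p \<and> lt r p q \<and> lt r q b \<longrightarrow> lt S (h p) (h q)) \<and>
       (\<forall>p. lt r a p \<and> lt r p b \<longrightarrow> lt S x (h p) \<and> lt S (h p) y)"
      using balanced[OF x(2)] x(1,3) emb Pw.linord_axioms unfolding balanced_order_def
      by (intro exI[of _ "P w"] exI[of _ s] exI[of _ t] exI[of _ "\<lambda>p. Some (w, p)"]) blast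
  qed
  have "Field S \<subseteq> insert None (Some ` (SIGMA w : Field W. Field (P w)))"
    unfolding well_ordered_sum_def Field_of_strict by (auto simp: lt_def Field_def)
  moreover have "|SIGMA w : Field W. Field (P w)| \<le>o c"
    by (rule card_of_Sigma_ordLeq_infinite_Field[OF cinf ordLeq_transitive[OF W kc]])
      (use balanced in \<open>auto simp: balanced_order_def\<close>)
  then have "|insert None (Some ` (SIGMA w : Field W. Field (P w)))| \<le>o c"
    by (intro card_of_insert_bound card_of_image_bound c)
  ultimately show "|Field S| \<le>o c" by (rule card_of_subset_bound)
  have "\<forall>w. \<exists>Q. w \<in> Field W \<longrightarrow> dense_in (P w) Q \<and> |Q| \<le>o k" using balanced unfolding balanced_order_def by blast
  from choice[OF this] obtain Q where Q: "\<forall>w. w \<in> Field W \<longrightarrow> dense_in (P w) (Q w) \<and> |Q w| \<le>o k" ..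
  let ?Q = "{Some (w, q) | w q. w \<in> Field W \<and> q \<in> Q w \<and> lt (P w) q (otop (P w))}"
  have "dense_in S ?Q" by (rule dense_in_S) (use Q in blast)
  moreover have "|Some ` (SIGMA w : Field W. Q w)| \<le>o k"
    by (intro card_of_image_bound card_of_Sigma_ordLeq_infinite_Field[OF kinf W]) (use Q in blast)
  then have "|?Q| \<le>o k" by (rule card_of_subset_bound[rotated]) blast
  ultimately show "\<exists>Q. dense_in S Q \<and> |Q| \<le>o k" by blast
qed

lemma (in sum_of_continua) obot_S: "\<exists>w\<in>Field W. obot S = Some (w, obot (P w))"
proof -
  have "obot S \<noteq> None" using S.obot_lt_otop not_None_lt by metis
  then obtain w t where wt: "obot S = Some (w, t)" by (cases "obot S") auto
  then have w: "w \<in> Field W" "lt (P w) t (otop (P w))" using S.obot(1) Field_S_Some by metis+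
  interpret Pw: ordered_continuum "P w" using P w(1) .
  have "t = obot (P w)"
  proof (rule ccontr)
    assume "t \<noteq> obot (P w)"
    then have "lt (P w) (obot (P w)) t" using Pw.lt_obot_iff Pw.lt_Field[OF w(2)] by blast
    then have "lt S (Some (w, obot (P w))) (obot S)" using lt_within[OF _ w(2,1)] wt by simp
    then show False using S.not_lt_obot by blast
  qed
  then show ?thesis using wt w(1) by blast
qed

lemma lt_dir_image:
  assumes "inj_on h (Field r)"
  shows "lt (dir_image r h) u v \<longleftrightarrow> (\<exists>x y. u = h x \<and> v = h y \<and> lt r x y)"
  using assms unfolding lt_def dir_image_def inj_on_def Field_def by blast

lemma dir_image_le_iff:
  assumes "inj_on h (Field r)" "x \<in> Field r" "y \<in> Field r"
  shows "(h x, h y) \<in> dir_image r h \<longleftrightarrow> (x, y) \<in> r"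
proof
  assume "(h x, h y) \<in> dir_image r h"
  then obtain a b where ab: "h x = h a" "h y = h b" "(a, b) \<in> r" unfolding dir_image_def by blast
  then have "a \<in> Field r" "b \<in> Field r" by (auto simp: Field_def)
  then have "x = a" "y = b" using ab assms unfolding inj_on_def by blast+
  then show "(x, y) \<in> r" using ab by blast
qed (auto simp: dir_image_def)

lemma dir_image_lt_iff:
  assumes "inj_on h (Field r)" "x \<in> Field r" "y \<in> Field r"
  shows "lt (dir_image r h) (h x) (h y) \<longleftrightarrow> lt r x y"
  using dir_image_le_iff[OF assms] assms unfolding lt_def inj_on_def by blast

lemma dir_image_converse: "dir_image (r\<inverse>) h = (dir_image r h)\<inverse>"
  unfolding dir_image_def by blast

lemma balanced_order_dir_image:
  fixes r :: "'a rel" and h :: "'a \<Rightarrow> 'b"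
  assumes g: "balanced_order k c r" and h: "inj_on h (Field r)"
  shows "balanced_order k c (dir_image r h)" (is "balanced_order k c ?s")
proof -
  interpret ordered_continuum r using g unfolding balanced_order_def by blast
  have F: "Field ?s = h ` Field r" by (rule dir_image_Field)
  note le = dir_image_le_iff[OF h]
  have lcs: "ordered_continuum ?s"
  proof
    show "Linear_order ?s" by (rule Linear_order_dir_image[OF lin h])
  next
    fix A assume "A \<subseteq> Field ?s"
    then obtain B where B: "B \<subseteq> Field r" "A = h ` B" unfolding F by (meson subset_imageE)
    obtain s where s: "is_sup r B s" using complete[OF B(1)] by blast
    then have sF: "s \<in> Field r" unfolding is_sup_def by blast
    have "is_sup ?s A (h s)"
      unfolding is_sup_def F
    proof (intro conjI ballI impI)
      show "h s \<in> h ` Field r" using sF by blast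
      show "(a, h s) \<in> ?s" if "a \<in> A" for a using that B s sF le unfolding is_sup_def by blast
      fix u assume u: "u \<in> h ` Field r" "\<forall>a\<in>A. (a, u) \<in> ?s"
      then obtain y where y: "y \<in> Field r" "u = h y" by blast
      have "\<forall>b\<in>B. (b, y) \<in> r" using u(2) B y le by blast
      then show "(h s, u) \<in> ?s" using s y sF le unfolding is_sup_def by blast
    qed
    then show "\<exists>s. is_sup ?s A s" by blast
  next
    fix u v assume "lt ?s u v"
    then obtain x y where xy: "u = h x" "v = h y" "lt r x y" using lt_dir_image[OF h] by blast
    then obtain z where z: "lt r x z" "lt r z y" using dense by blast
    then show "\<exists>w. lt ?s u w \<and> lt ?s w v" unfolding lt_dir_image[OF h] using xy by blast
  next
    obtain x y where "lt r x y" using nontrivial by blast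
    then show "\<exists>x y. lt ?s x y" unfolding lt_dir_image[OF h] by blast
  qed
  have "rich k c ?s"
  proof (rule rich_if_intervals_contain_copies[OF ordered_continuum.axioms(1)[OF lcs]])
    fix a b assume "lt ?s a b"
    then obtain x y where "a = h x" "b = h y" "lt r x y" using lt_dir_image[OF h] by blast
    then show "\<exists>(r :: 'a rel) x y h. linord r \<and> rich k c r \<and> lt r x y \<and>
       (\<forall>p q. lt r x p \<and> lt r p q \<and> lt r q y \<longrightarrow> lt ?s (h p) (h q)) \<and>
       (\<forall>p. lt r x p \<and> lt r p y \<longrightarrow> lt ?s a (h p) \<and> lt ?s (h p) b)"
      using g linord_axioms lt_dir_image[OF h] unfolding balanced_order_def
      by (intro exI[of _ r] exI[of _ x] exI[of _ y] exI[of _ h]) blast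
  qed
  moreover have "|Field ?s| \<le>o c"
    unfolding F by (rule card_of_image_bound) (use g in \<open>simp add: balanced_order_def\<close>)
  moreover obtain Q where Q: "dense_in r Q" "|Q| \<le>o k" using g unfolding balanced_order_def by blast
  have "dense_in ?s (h ` Q)"
    unfolding dense_in_def F
  proof (intro conjI allI impI)
    show "h ` Q \<subseteq> h ` Field r" using Q(1) unfolding dense_in_def by blast
    fix u v assume "lt ?s u v"
    then obtain x y where xy: "u = h x" "v = h y" "lt r x y" using lt_dir_image[OF h] by blast
    then obtain q where "q \<in> Q" "lt r x q" "lt r q y" using Q(1) unfolding dense_in_def by blast
    then show "\<exists>q\<in>h ` Q. lt ?s u q \<and> lt ?s q v" unfolding lt_dir_image[OF h] using xy by blast
  qed
  moreover have "|h ` Q| \<le>o k" using Q(2) by (rule card_of_image_bound)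
  ultimately show ?thesis using lcs unfolding balanced_order_def by blast
qed

text \<open>
  An embedding between copies comes from one between the originals. As \<open>r\<close> has more than one point,
  every value of \<open>f\<close> is related to another one and therefore lies in the copy of \<open>s\<close>.
\<close>

lemma convex_emb_dir_image:
  assumes r: "ordered_continuum r" and h: "inj_on h (Field r)" and h': "inj_on h' (Field s)"
    and f: "convex_emb (dir_image r h) (dir_image s h') f"
  shows "\<exists>f. convex_emb r s f"
proof -
  interpret ordered_continuum r by (rule r)
  define f' where "f' x = inv_into (Field s) h' (f (h x))" for x
  have inc: "lt (dir_image s h') (f (h x)) (f (h y))" if "lt r x y" for x y
    using f that lt_dir_image[OF h] unfolding convex_emb_def by blast
  have img: "f (h x) \<in> h' ` Field s" if "x \<in> Field r" for x
  proof -
    have "lt r x (otop r) \<or> lt r (obot r) x"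
      using lt_otop_iff lt_obot_iff obot_lt_otop that by (metis lt_irrefl)
    then have "f (h x) \<in> Field (dir_image s h')"
      using inc[of x "otop r"] inc[of "obot r" x] unfolding lt_def Field_def by blast
    then show ?thesis by (simp add: dir_image_Field)
  qed
  have f': "f' x \<in> Field s" "h' (f' x) = f (h x)" if "x \<in> Field r" for x
    using img[OF that] unfolding f'_def by (simp_all add: inv_into_into f_inv_into_f)
  have "lt s (f' x) (f' y)" if xy: "lt r x y" for x y
  proof -
    have F: "x \<in> Field r" "y \<in> Field r" using lt_Field[OF xy] by auto
    have "lt (dir_image s h') (h' (f' x)) (h' (f' y))"
      using inc[OF xy] f'(2)[OF F(1)] f'(2)[OF F(2)] by simp
    then show ?thesis using dir_image_lt_iff[OF h'] f'(1) F by blast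
  qed
  moreover have "z \<in> f' ` Field r"
    if xy: "x \<in> Field r" "y \<in> Field r" and z: "lt s (f' x) z" "lt s z (f' y)" for x y z
  proof -
    have zF: "z \<in> Field s" using z unfolding lt_def Field_def by blast
    have "lt (dir_image s h') (f (h x)) (h' z)" "lt (dir_image s h') (h' z) (f (h y))"
      using dir_image_lt_iff[OF h' f'(1)[OF xy(1)] zF] dir_image_lt_iff[OF h' zF f'(1)[OF xy(2)]]
        z f'(2) xy by auto
    moreover have "h x \<in> Field (dir_image r h)" "h y \<in> Field (dir_image r h)"
      using xy by (simp_all add: dir_image_Field)
    ultimately have "h' z \<in> f ` Field (dir_image r h)" using f unfolding convex_emb_def by blast
    then obtain q where q: "q \<in> Field r" "h' z = f (h q)" by (auto simp: dir_image_Field)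
    then have "h' (f' q) = h' z" using f'(2) by simp
    then have "f' q = z" using h' f'(1)[OF q(1)] zF unfolding inj_on_def by blast
    then show ?thesis using q(1) by blast
  qed
  ultimately show ?thesis unfolding convex_emb_def by blast
qed

section \<open>Lexicographic products of well-orders\<close>

definition lex_prod_order :: "'a rel \<Rightarrow> 'b rel \<Rightarrow> ('a \<times> 'b) rel" where
  "lex_prod_order r s = of_strict (Field r \<times> Field s) (\<lambda>(a, b) (a', b'). lt r a a' \<or> a = a' \<and> lt s b b')"

lemma Field_lex_prod_order: "Field (lex_prod_order r s) = Field r \<times> Field s"
  unfolding lex_prod_order_def by (rule Field_of_strict)

lemma lt_lex_prod_order:
  "lt (lex_prod_order r s) (a, b) (a', b') \<longleftrightarrow>
     a \<in> Field r \<and> b \<in> Field s \<and> a' \<in> Field r \<and> b' \<in> Field s \<and> (lt r a a' \<or> a = a' \<and> lt s b b')"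
  unfolding lex_prod_order_def by (subst lt_of_strict) (auto simp: lt_def)

lemma Well_order_lex_prod_order:
  assumes r: "Well_order r" and s: "Well_order s"
  shows "Well_order (lex_prod_order r s)" (is "Well_order ?p")
proof -
  interpret R: linord r by (rule linord_Well_order[OF r])
  interpret S: linord s by (rule linord_Well_order[OF s])
  have "linord ?p"
    unfolding lex_prod_order_def
  proof (rule linord_of_strict)
    fix x y z :: "'a \<times> 'b"
    let ?l = "\<lambda>(a, b) (a', b'). lt r a a' \<or> a = a' \<and> lt s b b'"
    show "\<not> ?l x x" by (auto simp: lt_def)
    show "?l x z" if "?l x y" "?l y z"
      using that R.lt_trans S.lt_trans by (auto split: prod.splits)
    show "?l x y \<or> ?l y x" if "x \<in> Field r \<times> Field s" "y \<in> Field r \<times> Field s" "x \<noteq> y"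
    proof -
      obtain a b a' b' where xy: "x = (a, b)" "y = (a', b')" by (cases x, cases y) auto
      then show ?thesis using that R.lt_cases[of a a'] S.lt_cases[of b b'] by auto
    qed
  qed
  moreover have "wf (?p - Id)"
  proof (rule wf_subset)
    show "wf ((r - Id) <*lex*> (s - Id))"
      using r s by (intro wf_lex_prod) (simp_all add: well_order_on_def)
    show "?p - Id \<subseteq> (r - Id) <*lex*> (s - Id)"
      unfolding lex_prod_order_def of_strict_def by (auto simp: lt_def)
  qed
  ultimately show ?thesis by (simp add: well_order_on_def linord_def)
qed

section \<open>Coding subsets into ordered continua\<close>

text \<open>
  Here \<open>k\<close> and \<open>c\<close> are the weight and the cardinality aimed at, and \<open>L\<close> is the continuum of
  which all spaces of the family are built.
\<close>

locale coding =
  fixes k :: "'k rel" and m :: "'m rel" and c :: "'c rel" and L :: "'a rel"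
  assumes k: "Cinfinite k" and m: "Cinfinite m" and c: "Cinfinite c"
    and mk: "cardSuc m \<le>o k" and kc: "k \<le>o c"
    and L: "balanced_order k c L" and L_right: "\<And>x. x \<in> Field L \<Longrightarrow> right_small m L x" and L_top: "left_small m L (otop L)"
begin

abbreviation \<theta> :: "'m set rel" where "\<theta> \<equiv> cardSuc m"

lemma Card_order_\<theta>: "Card_order \<theta>" and Well_order_\<theta>: "Well_order \<theta>"
  and \<theta>_infinite: "infinite (Field \<theta>)"
  using m Cinfinite_cardSuc[OF m] by (simp_all add: cinfinite_def card_order_on_def)

sublocale \<theta>: linord \<theta> by (rule linord_Well_order[OF Well_order_\<theta>])

lemma bounded_in_\<theta>:
  assumes D: "D \<subseteq> Field \<theta>" "|D| \<le>o m"
  shows "\<exists>u\<in>Field \<theta>. \<forall>d\<in>D. lt \<theta> d u"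
proof -
  have reg: "regularCard \<theta>" using infinite_cardSuc_regularCard m unfolding cinfinite_def by blast
  have "\<not> |D| =o \<theta>"
  proof
    assume "|D| =o \<theta>"
    then have "\<theta> \<le>o m" using D(2) ordIso_ordLeq_trans ordIso_symmetric by blast
    then show False using cardSuc_greater[of m] m not_ordLess_ordLeq by blast
  qed
  then have "\<not> cofinal D \<theta>" using reg D(1) unfolding regularCard_def by blast
  then obtain a where a: "a \<in> Field \<theta>" "\<forall>b\<in>D. \<not> lt \<theta> a b"
    unfolding cofinal_def lt_def by blast
  obtain u where u: "u \<in> Field \<theta>" "a \<noteq> u" "(a, u) \<in> \<theta>"
    using infinite_Card_order_limit[OF Card_order_\<theta> \<theta>_infinite a(1)] by blast
  have "lt \<theta> d u" if "d \<in> D" for d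
  proof -
    have "(d, a) \<in> \<theta>" using a that D(1) \<theta>.le_lt_cases by blast
    moreover have "lt \<theta> a u" using u by (simp add: lt_def)
    ultimately show ?thesis by (rule \<theta>.le_lt_trans)
  qed
  then show ?thesis using u(1) by blast
qed

lemma card_of_below_\<theta>:
  assumes "v \<in> Field \<theta>"
  shows "|{u. lt \<theta> u v}| \<le>o m"
proof -
  have "{u. lt \<theta> u v} = underS \<theta> v" unfolding underS_def lt_def by blast
  then have "|{u. lt \<theta> u v}| <o \<theta>" using card_of_underS[OF Card_order_\<theta> assms] by simp
  then show ?thesis using cardSuc_ordLeq_ordLess[OF _ card_of_Card_order] m by blast
qed

lemma ex_b0_b1: "\<exists>b0 b1. (\<forall>v\<in>Field \<theta>. (b0, v) \<in> \<theta>) \<and> lt \<theta> b0 b1"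
proof -
  have "Field \<theta> \<noteq> {}" using \<theta>_infinite by auto
  then obtain b where b: "b \<in> Field \<theta>" "\<forall>v\<in>Field \<theta>. (b, v) \<in> \<theta>"
    using Well_order_least[OF Well_order_\<theta> subset_refl] by blast
  obtain u where "u \<in> Field \<theta>" "b \<noteq> u" "(b, u) \<in> \<theta>"
    using infinite_Card_order_limit[OF Card_order_\<theta> \<theta>_infinite b(1)] by blast
  then show ?thesis using b(2) unfolding lt_def by blast
qed

definition b0 :: "'m set" where "b0 = (SOME b. (\<forall>v\<in>Field \<theta>. (b, v) \<in> \<theta>) \<and> (\<exists>b1. lt \<theta> b b1))"
definition b1 :: "'m set" where "b1 = (SOME b. lt \<theta> b0 b)"

lemma b0_le: "v \<in> Field \<theta> \<Longrightarrow> (b0, v) \<in> \<theta>" and b0_lt_b1: "lt \<theta> b0 b1"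
proof -
  have "\<exists>b. (\<forall>v\<in>Field \<theta>. (b, v) \<in> \<theta>) \<and> (\<exists>b1. lt \<theta> b b1)" using ex_b0_b1 by blast
  from someI_ex[OF this] have *: "(\<forall>v\<in>Field \<theta>. (b0, v) \<in> \<theta>) \<and> (\<exists>b1. lt \<theta> b0 b1)"
    unfolding b0_def .
  then show "v \<in> Field \<theta> \<Longrightarrow> (b0, v) \<in> \<theta>" by blast
  from * have "\<exists>b1. lt \<theta> b0 b1" by blast
  from someI_ex[OF this] show "lt \<theta> b0 b1" unfolding b1_def .
qed

lemma b_Field: "b0 \<in> Field \<theta>" "b1 \<in> Field \<theta>"
  using \<theta>.lt_Field[OF b0_lt_b1] by auto

lemma not_lt_b0: "\<not> lt \<theta> v b0"
  using b0_le \<theta>.lt_Field \<theta>.lt_asym by blast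

sublocale L: ordered_continuum L using L unfolding balanced_order_def by blast

subsection \<open>The two kinds of pieces\<close>

definition piece_index :: "bool \<Rightarrow> 'm set rel" where
  "piece_index b = (if b then \<theta> else {(b0, b0)})"

text \<open>
  In the special piece, indexed by \<open>\<theta>\<close>, the bottom is approached from the right by a decreasing
  \<open>\<theta>\<close>-sequence of copies of \<open>L\<close>. The two reversals make these copies appear in their original
  direction, so that no further points fail to be right-small. The ordinary piece is a single copy
  of \<open>L\<close>, written as a sum with one summand in order to have the same type.
\<close>

definition piece :: "bool \<Rightarrow> ('m set \<times> 'a) option rel" where
  "piece b = (well_ordered_sum (piece_index b) (\<lambda>_. L\<inverse>))\<inverse>"

lemma sum_piece_index: "sum_of_continua (piece_index b) (\<lambda>_. L\<inverse>)"
proof (rule sum_of_continua.intro)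
  show "Field (piece_index b) \<noteq> {}" unfolding piece_index_def using b_Field by (auto simp: Field_def)
  have "Field {(b0, b0)} = {b0}" by (auto simp: Field_def)
  then have "Well_order {(b0, b0)}" by (simp add: well_order_on_def)
  then show "Well_order (piece_index b)" unfolding piece_index_def using Well_order_\<theta> by simp
  show "ordered_continuum (L\<inverse>)" by (rule L.ordered_continuum_converse)
qed

sublocale I: sum_of_continua "piece_index b" "\<lambda>_. L\<inverse>" for b by (rule sum_piece_index)

lemma Field_\<theta>_le: "|Field \<theta>| \<le>o k"
  using card_of_Field_ordIso[OF Card_order_\<theta>] mk ordIso_ordLeq_trans by blast

lemma balanced_order_piece: "balanced_order k c (piece b)"
proof -
  have "|Field (piece_index b)| \<le>o k"
  proof (cases b)
    case True
    then show ?thesis unfolding piece_index_def using Field_\<theta>_le by simp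
  next
    case False
    then have "Field (piece_index b) = {b0}" unfolding piece_index_def Field_def by auto
    then show ?thesis using card_of_countable_bound[OF _ k, of "{b0}"] by simp
  qed
  then show ?thesis
    unfolding piece_def using I.balanced_order_S[OF k c kc] balanced_order_converse[OF L] balanced_order_converse by blast
qed

lemma ordered_continuum_piece: "ordered_continuum (piece b)"
  using balanced_order_piece unfolding balanced_order_def by blast

lemma obot_piece: "obot (piece b) = None"
  unfolding piece_def by (simp add: I.otop_S)

lemma piece_top_left: "left_small m (piece b) (otop (piece b))"
proof -
  obtain w where w: "w \<in> Field (piece_index b)" "obot (I.S b) = Some (w, obot (L\<inverse>))"
    using I.obot_S by blast
  have F: "Some (w, obot (L\<inverse>)) \<in> Field (I.S b)" using I.S.obot(1)[of b] unfolding w(2) .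
  have "right_small m (I.S b) (Some (w, obot (L\<inverse>)))"
    unfolding I.right_small_Some[OF F] using L_top by simp
  then show ?thesis unfolding piece_def w(2) by simp
qed

lemma piece_right_Some:
  assumes x: "Some p \<in> Field (piece b)"
  shows "right_small m (piece b) (Some p)"
proof -
  obtain w t where p: "p = (w, t)" by (cases p)
  have xF: "Some (w, t) \<in> Field (I.S b)" using x unfolding piece_def p by simp
  then have w: "w \<in> Field (piece_index b)" and t: "lt (L\<inverse>) t (otop (L\<inverse>))" using I.Field_S_Some by blast+
  have L': "left_small m (L\<inverse>) s" if "s \<in> Field L" for s using L_right[OF that] by simp
  have tF: "t \<in> Field L" using t L.lt_Field by simp
  have top: "left_small m (L\<inverse>) (otop (L\<inverse>))" by (rule L'[OF L.obot(1)])
  have "|{u. lt (piece_index b) u w}| \<le>o m"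
  proof (cases b)
    case True
    then show ?thesis using card_of_below_\<theta> w unfolding piece_index_def by simp
  next
    case False
    then have "{u. lt (piece_index b) u w} = {}" unfolding piece_index_def lt_def by auto
    then show ?thesis using card_of_countable_bound[OF _ m, of "{}"] by simp
  qed
  then have "left_small m (I.S b) (Some (w, t))"
  proof (rule I.left_small_Some[OF m xF L'[OF tF]])
    show "\<exists>u\<in>{u. lt (piece_index b) u w}. (v, u) \<in> piece_index b" if "lt (piece_index b) v w" for v
      using that I.W.le_refl I.W.lt_Field by blast
  qed (use top in auto)
  then show ?thesis unfolding piece_def p .
qed

text \<open>
  Any \<open>m\<close> points above the bottom of the special piece are bounded away from it, because \<open>\<theta>\<close> is
  regular. Every other point, and the bottom of the ordinary piece, has at most \<open>m\<close> summands of
  the piece on its right side.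
\<close>

lemma piece_right: "x \<in> Field (piece b) \<Longrightarrow> right_small m (piece b) x \<longleftrightarrow> \<not> (b \<and> x = None)"
proof -
  assume x: "x \<in> Field (piece b)"
  have L': "left_small m (L\<inverse>) s" if "s \<in> Field L" for s using L_right[OF that] by simp
  show ?thesis
  proof (cases x)
    case (Some p)
    then show ?thesis using piece_right_Some x by simp
  next
    case None
    show ?thesis
    proof (cases b)
      case False
      then have "Field (piece_index b) = {b0}" unfolding piece_index_def Field_def by auto
      then have "|Field (piece_index b)| \<le>o m" using card_of_countable_bound[OF _ m, of "{b0}"] by simp
      then have "left_small m (I.S b) None" by (rule I.left_small_None[OF m]) (rule L'[OF L.obot(1)])
      then show ?thesis unfolding piece_def None using False by simp
    next
      case True
      then have i: "piece_index b = \<theta>" unfolding piece_index_def by simp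
      have "\<not> left_small m (I.S b) None"
      proof (rule I.not_left_small[where V = "Field \<theta>"])
        show "lt (I.S b) (Some (v, obot (L\<inverse>))) None" if "v \<in> Field \<theta>" for v
        proof -
          have "Some (v, obot (L\<inverse>)) \<in> Field (I.S b)"
            unfolding I.Field_S_Some using that i L.obot_lt_otop by simp
          then show ?thesis using I.lt_S_None by blast
        qed
        show "\<exists>u\<in>Field \<theta>. (v, u) \<in> piece_index b" if "lt (I.S b) (Some (v, s)) None" for v s
        proof -
          have "v \<in> Field \<theta>" using I.S.lt_Field[OF that] I.Field_S_Some[of v s b] i by simp
          then show ?thesis using i \<theta>.le_refl by auto
        qed
        show "\<exists>u\<in>Field \<theta>. \<forall>d\<in>D. lt (piece_index b) d u" if "D \<subseteq> Field (piece_index b)" "|D| \<le>o m" for D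
          using bounded_in_\<theta> that i by simp
      qed
      then show ?thesis unfolding piece_def None using True by simp
    qed
  qed
qed

subsection \<open>Words and their continua\<close>

abbreviation N :: "('k \<times> nat) rel" where "N \<equiv> lex_prod_order k natLeq"
abbreviation W :: "(('k \<times> nat) \<times> 'm set) rel" where "W \<equiv> lex_prod_order N \<theta>"
abbreviation succ :: "'k \<times> nat \<Rightarrow> 'k \<times> nat" where "succ n \<equiv> (fst n, Suc (snd n))"

text \<open>
  Each position \<open>n\<close> owns the block of all \<open>(n, v)\<close> with \<open>v\<close> in \<open>\<theta>\<close>. If \<open>n \<in> C\<close>, its
  special piece is the first one of the next block and has the whole block of \<open>n\<close> on its left.
  Otherwise it stands inside the block with only \<open>m\<close> or fewer pieces before it there. Both places
  come after the start of the block of \<open>n\<close> and no later than the start of the next one, so special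
  pieces of different positions are different and in the right order.
\<close>

definition mark :: "('k \<times> nat) set \<Rightarrow> 'k \<times> nat \<Rightarrow> ('k \<times> nat) \<times> 'm set" where
  "mark C n = (if n \<in> C then (succ n, b0) else (n, b1))"

definition word_order :: "('k \<times> nat) set \<Rightarrow> ((('k \<times> nat) \<times> 'm set) \<times> ('m set \<times> 'a) option) option rel" where
  "word_order C = well_ordered_sum W (\<lambda>w. piece (w \<in> mark C ` Field N))"

text \<open>
  The bottom of a piece is \<open>None\<close> (\<open>obot_piece\<close>).
\<close>

definition marker :: "('k \<times> nat) set \<Rightarrow> 'k \<times> nat \<Rightarrow> ((('k \<times> nat) \<times> 'm set) \<times> ('m set \<times> 'a) option) option" where
  "marker C n = Some (mark C n, None)"

lemma Well_order_k: "Well_order k"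
  using k by (simp add: card_order_on_def)

lemma Well_order_N: "Well_order N"
  by (rule Well_order_lex_prod_order[OF Well_order_k natLeq_Well_order])

lemma Well_order_W: "Well_order W"
  by (rule Well_order_lex_prod_order[OF Well_order_N Well_order_\<theta>])

sublocale k: linord k by (rule linord_Well_order[OF Well_order_k])
sublocale N: linord N by (rule linord_Well_order[OF Well_order_N])

lemma Field_N: "n \<in> Field N \<longleftrightarrow> fst n \<in> Field k"
  by (cases n) (simp add: Field_lex_prod_order Field_natLeq)

lemma lt_N: "lt N n n' \<longleftrightarrow> fst n \<in> Field k \<and> fst n' \<in> Field k \<and>
    (lt k (fst n) (fst n') \<or> fst n = fst n' \<and> snd n < snd n')"
  by (cases n, cases n') (auto simp: lt_lex_prod_order Field_natLeq)

lemma lt_W: "lt W (n, v) (n', v') \<longleftrightarrow> n \<in> Field N \<and> v \<in> Field \<theta> \<and> n' \<in> Field N \<and> v' \<in> Field \<theta> \<and>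
    (lt N n n' \<or> n = n' \<and> lt \<theta> v v')"
  by (rule lt_lex_prod_order)

lemma Field_W: "(n, v) \<in> Field W \<longleftrightarrow> n \<in> Field N \<and> v \<in> Field \<theta>"
  by (simp add: Field_lex_prod_order)

lemma succ_N: "n \<in> Field N \<Longrightarrow> succ n \<in> Field N" "n \<in> Field N \<Longrightarrow> lt N n (succ n)"
  by (simp_all add: Field_N lt_N)

lemma lt_succ_N: "lt N n' (succ n) \<Longrightarrow> (n', n) \<in> N"
  unfolding N.le_iff Field_N lt_N by (cases n, cases n') auto

lemma succ_le_N: "lt N n n' \<Longrightarrow> succ n = n' \<or> lt N (succ n) n'"
  unfolding lt_N by (cases n, cases n') auto

lemma sum_W: "sum_of_continua W (\<lambda>w. piece (w \<in> mark C ` Field N))"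
proof (rule sum_of_continua.intro)
  have "Field k \<noteq> {}" using k unfolding cinfinite_def by auto
  then show "Field W \<noteq> {}" using b_Field by (auto simp: Field_lex_prod_order Field_natLeq)
qed (rule Well_order_W ordered_continuum_piece)+

sublocale X: sum_of_continua W "\<lambda>w. piece (w \<in> mark C ` Field N)" for C by (rule sum_W)

lemma ordered_continuum_word_order: "ordered_continuum (word_order C)"
  unfolding word_order_def by (rule X.ordered_continuum_S)

lemma balanced_order_word_order: "balanced_order k c (word_order C)"
  unfolding word_order_def
proof (rule X.balanced_order_S[OF k c kc _ balanced_order_piece])
  have "|Field k| \<le>o k" using card_of_Field_ordIso k ordIso_iff_ordLeq by blast
  moreover have "|UNIV :: nat set| \<le>o k" by (rule card_of_countable_bound[OF _ k]) simp
  ultimately show "|Field W| \<le>o k"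
    unfolding Field_lex_prod_order Field_natLeq by (intro card_of_Times_bound k Field_\<theta>_le)
qed

lemma mark_Field: "n \<in> Field N \<Longrightarrow> mark C n \<in> Field W"
  unfolding mark_def using succ_N b_Field by (simp add: Field_W)

lemma piece_bot: "lt (piece b) None (otop (piece b))" "\<not> lt (piece b) x None"
  using ordered_continuum.obot_lt_otop[OF ordered_continuum_piece, of b] ordered_continuum.not_lt_obot[OF ordered_continuum_piece, of b x]
  by (simp_all add: obot_piece)

lemma Some_None_Field: "Some (w, None) \<in> Field (word_order C) \<longleftrightarrow> w \<in> Field W"
  unfolding word_order_def X.Field_S_Some using piece_bot by blast

lemma marker_Field: "n \<in> Field N \<Longrightarrow> marker C n \<in> Field (word_order C)"
  unfolding marker_def Some_None_Field by (rule mark_Field)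

lemma lt_word_order_Some:
  "lt (word_order C) (Some (v, None)) (Some (w, t)) \<longleftrightarrow> v \<in> Field W \<and> Some (w, t) \<in> Field (word_order C) \<and>
     (lt W v w \<or> v = w \<and> lt (piece (v \<in> mark C ` Field N)) None t)"
  using X.lt_S_Some[of C v None w t] Some_None_Field[of v C] unfolding word_order_def by blast

lemma lt_mark_bot: "n \<in> Field N \<Longrightarrow> lt W (n, b0) (mark C n)"
  unfolding mark_def using succ_N b_Field b0_lt_b1 by (auto simp: lt_W)

lemma mark_strict_mono:
  assumes "lt N n n'"
  shows "lt W (mark C n) (mark C n')"
proof -
  have F: "n \<in> Field N" "n' \<in> Field N" using N.lt_Field[OF assms] by auto
  have 1: "mark C n = (succ n, b0) \<or> lt W (mark C n) (succ n, b0)"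
    unfolding mark_def using succ_N[OF F(1)] F b_Field by (auto simp: lt_W)
  have 2: "lt W (n', b0) (mark C n')" by (rule lt_mark_bot[OF F(2)])
  have 3: "(succ n, b0) = (n', b0) \<or> lt W (succ n, b0) (n', b0)"
    using succ_le_N[OF assms] succ_N[OF F(1)] F b_Field by (auto simp: lt_W)
  show ?thesis using 1 2 3 X.W.lt_trans by metis
qed

lemma marker_strict_mono: "lt N n n' \<Longrightarrow> lt (word_order C) (marker C n) (marker C n')"
proof -
  assume nn: "lt N n n'"
  then have F: "n \<in> Field N" "n' \<in> Field N" using N.lt_Field by blast+
  show ?thesis
    using mark_strict_mono[OF nn] mark_Field[OF F(1)] marker_Field[OF F(2)]
    unfolding marker_def lt_word_order_Some by blast
qed

lemma marker_lt_iff: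
  assumes "n \<in> Field N" "n' \<in> Field N"
  shows "lt (word_order C) (marker C n) (marker C n') \<longleftrightarrow> lt N n n'"
proof -
  interpret ordered_continuum "word_order C" by (rule ordered_continuum_word_order)
  show ?thesis
    using marker_strict_mono[of n n' C] marker_strict_mono[of n' n C] N.lt_cases[OF assms] lt_trans lt_irrefl
    by metis
qed

lemma marker_inj: "n \<in> Field N \<Longrightarrow> n' \<in> Field N \<Longrightarrow> marker C n = marker C n' \<Longrightarrow> n = n'"
  using marker_lt_iff[of n n' C] marker_lt_iff[of n' n C] N.lt_cases[of n n'] by (auto simp: lt_def)

text \<open>
  A point of a sum has on its right side the character that it has in its summand, so exactly the
  bottoms of the special pieces fail to be right-small.
\<close>

lemma word_order_right:
  assumes x: "x \<in> Field (word_order C)"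
  shows "\<not> right_small m (word_order C) x \<longleftrightarrow> (\<exists>n\<in>Field N. x = marker C n)"
proof (cases x)
  case None
  have "\<not> lt (word_order C) None y" for y using X.not_None_lt[of C y] unfolding word_order_def .
  then have "right_small m (word_order C) None" by (rule right_small_if_maximal) (rule m)
  then show ?thesis unfolding None marker_def by simp
next
  case (Some p)
  then obtain w t where xw: "x = Some (w, t)" by (cases p) auto
  let ?b = "w \<in> mark C ` Field N"
  have F: "Some (w, t) \<in> Field (X.S C)" using x xw unfolding word_order_def by simp
  then have "lt (piece ?b) t (otop (piece ?b))" using X.Field_S_Some by blast
  then have "t \<in> Field (piece ?b)" using linord.lt_Field[OF ordered_continuum.axioms(1)[OF ordered_continuum_piece]] by blast
  then have "right_small m (word_order C) x \<longleftrightarrow> \<not> (?b \<and> t = None)"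
    using X.right_small_Some[OF F, of m] piece_right[of t ?b] xw unfolding word_order_def by simp
  then show ?thesis unfolding xw marker_def by auto
qed

text \<open>
  For \<open>n \<notin> C\<close> the pieces of the block of \<open>n\<close> before the marker are cofinal on its left, and
  there are at most \<open>m\<close> of them. For \<open>n \<in> C\<close> all pieces of the block are needed, and no \<open>m\<close> of
  them are cofinal.
\<close>

lemma marker_left:
  assumes n: "n \<in> Field N"
  shows "left_small m (word_order C) (marker C n) \<longleftrightarrow> n \<notin> C"
proof (cases "n \<in> C")
  case False
  then have mk: "mark C n = (n, b1)" unfolding mark_def by simp
  have F: "Some ((n, b1), None) \<in> Field (X.S C)"
    using marker_Field[OF n, of C] unfolding marker_def mk word_order_def .
  have "left_small m (X.S C) (Some ((n, b1), None))"
  proof (rule X.left_small_Some[OF m F])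
    show "left_small m (piece b) None" for b
      by (rule right_small_if_maximal[OF _ m]) (use piece_bot(2) in simp)
    let ?D = "Pair n ` {v. lt \<theta> v b1}"
    show "|?D| \<le>o m" by (rule card_of_image_bound[OF card_of_below_\<theta>[OF b_Field(2)]])
    show "lt W d (n, b1)" if "d \<in> ?D" for d using that n \<theta>.lt_Field by (auto simp: lt_W)
    show "\<exists>d\<in>?D. (v, d) \<in> W" if v: "lt W v (n, b1)" for v
    proof -
      obtain n' u where nu: "v = (n', u)" by (cases v)
      from v[unfolded nu lt_W] consider "lt N n' n" | "n' = n" "lt \<theta> u b1" by blast
      then show ?thesis
      proof cases
        case 1
        then have "lt W v (n, b0)" using v b_Field unfolding nu lt_W by blast
        then show ?thesis using b0_lt_b1 X.W.lt_le by blast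
      next
        case 2
        then have "v \<in> ?D" using nu by blast
        then show ?thesis using X.W.le_refl X.W.lt_Field[OF v] by blast
      qed
    qed
    show "left_small m (piece (d \<in> mark C ` Field N)) (otop (piece (d \<in> mark C ` Field N)))" for d
      by (rule piece_top_left)
  qed
  then show ?thesis using False unfolding marker_def mk word_order_def by simp
next
  case True
  then have mk: "mark C n = (succ n, b0)" unfolding mark_def by simp
  have F: "Some ((succ n, b0), None) \<in> Field (X.S C)"
    using marker_Field[OF n, of C] unfolding marker_def mk word_order_def .
  have below: "n' \<in> Field N \<and> u \<in> Field \<theta> \<and> (n', n) \<in> N" if "lt W (n', u) (succ n, b0)" for n' u
    using that not_lt_b0 lt_succ_N unfolding lt_W by blast
  have "\<not> left_small m (X.S C) (Some ((succ n, b0), None))"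
  proof (rule X.not_left_small[where V = "Pair n ` Field \<theta>"])
    fix v assume "v \<in> Pair n ` Field \<theta>"
    then have "lt W v (succ n, b0)" using n succ_N[OF n] b_Field by (auto simp: lt_W)
    then show "lt (X.S C) (Some (v, obot (piece (v \<in> mark C ` Field N)))) (Some ((succ n, b0), None))"
      unfolding obot_piece using lt_word_order_Some[unfolded word_order_def] F X.W.lt_Field by blast
  next
    fix v s assume vs: "lt (X.S C) (Some (v, s)) (Some ((succ n, b0), None))"
    obtain n' u where nu: "v = (n', u)" by (cases v)
    have "lt W v (succ n, b0)" using vs piece_bot(2) X.lt_S_Some by blast
    then have b: "n' \<in> Field N" "u \<in> Field \<theta>" "(n', n) \<in> N" using below nu by blast+
    then have "n' = n \<or> lt N n' n" by (auto simp: lt_def)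
    then have "(v, (n, u)) \<in> W"
      using b n nu lt_W[of n' u n u] X.W.lt_le X.W.le_refl[of "(n, u)"] Field_W by blast
    then show "\<exists>u\<in>Pair n ` Field \<theta>. (v, u) \<in> W" using b(2) by blast
  next
    fix D assume D: "D \<subseteq> Field W" "|D| \<le>o m" "\<forall>d\<in>D. \<exists>u\<in>Pair n ` Field \<theta>. (d, u) \<in> W"
    have "snd ` D \<subseteq> Field \<theta>" using D(1) by (auto simp: Field_lex_prod_order)
    then obtain u where u: "u \<in> Field \<theta>" "\<forall>d\<in>snd ` D. lt \<theta> d u"
      using bounded_in_\<theta>[OF _ card_of_image_bound[OF D(2)]] by blast
    have "lt W d (n, u)" if d: "d \<in> D" for d
    proof -
      obtain n' v where nv: "d = (n', v)" by (cases d)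
      have F: "n' \<in> Field N" "v \<in> Field \<theta>" using D(1) d nv Field_W by blast+
      obtain v' where v': "v' \<in> Field \<theta>" "(d, (n, v')) \<in> W" using D(3) d by blast
      have "n' = n \<or> lt N n' n"
        using v'(2) lt_W[of n' v n v'] nv by (auto simp: lt_def[of W])
      moreover have "lt \<theta> v u" using u(2) d nv by force
      ultimately show ?thesis unfolding nv lt_W using F n u(1) by blast
    qed
    then show "\<exists>u\<in>Pair n ` Field \<theta>. \<forall>d\<in>D. lt W d u" using u(1) by blast
  qed
  then show ?thesis using True unfolding marker_def mk word_order_def by simp
qed

lemma marker_not_extreme:
  assumes n: "n \<in> Field N"
  shows "\<exists>y. lt (word_order C) (marker C n) y" "\<exists>y. lt (word_order C) y (marker C n)"
proof -
  show "\<exists>y. lt (word_order C) (marker C n) y" using marker_strict_mono[OF succ_N(2)[OF n]] by blast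
  have "lt (word_order C) (Some ((n, b0), None)) (marker C n)"
    using lt_mark_bot[OF n, of C] marker_Field[OF n, of C] n b_Field
    unfolding marker_def lt_word_order_Some Field_W by blast
  then show "\<exists>y. lt (word_order C) y (marker C n)" by blast
qed

subsection \<open>Comparing codes\<close>

text \<open>
  Markers are recognised by their right side and their letters by their left side, and both are
  preserved by embeddings with convex range. Hence the embedding acts on the positions, and it does so
  with convex range as well.
\<close>

lemma embedding_of_words:
  assumes f: "convex_emb (word_order C) (word_order D) f"
  shows "\<exists>g. (\<forall>n\<in>Field N. g n \<in> Field N \<and> (n \<in> C \<longleftrightarrow> g n \<in> D)) \<and> convex_emb N N g"
proof -
  let ?X = "word_order C" and ?Y = "word_order D"
  interpret XC: ordered_continuum ?X by (rule ordered_continuum_word_order)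
  interpret YC: ordered_continuum ?Y by (rule ordered_continuum_word_order)
  have inc: "lt ?Y (f x) (f y)" if "lt ?X x y" for x y using f that unfolding convex_emb_def by blast
  have "\<exists>p. p \<in> Field N \<and> f (marker C n) = marker D p" if n: "n \<in> Field N" for n
  proof -
    obtain y where y: "lt ?X (marker C n) y" using marker_not_extreme(1)[OF n] by blast
    have "\<not> right_small m ?X (marker C n)" using word_order_right[OF marker_Field[OF n]] n by blast
    then have "\<not> right_small m ?Y (f (marker C n))"
      using convex_emb_right_small[where m = m, OF XC.linord_axioms YC.linord_axioms f y] by blast
    then show ?thesis using word_order_right YC.lt_Field[OF inc[OF y]] by blast
  qed
  then have "\<forall>n. \<exists>p. n \<in> Field N \<longrightarrow> p \<in> Field N \<and> f (marker C n) = marker D p" by blast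
  from choice[OF this] obtain g where
    g: "\<forall>n. n \<in> Field N \<longrightarrow> g n \<in> Field N \<and> f (marker C n) = marker D (g n)" ..
  have label: "n \<in> C \<longleftrightarrow> g n \<in> D" if n: "n \<in> Field N" for n
  proof -
    obtain y where y: "lt ?X y (marker C n)" using marker_not_extreme(2)[OF n] by blast
    have "left_small m ?Y (f (marker C n)) \<longleftrightarrow> left_small m ?X (marker C n)"
      using convex_emb_right_small[where m = m, OF XC.linord_converse YC.linord_converse convex_emb_converse[OF f]] y by simp
    then show ?thesis using marker_left[OF n, of C] marker_left[of "g n" D] g n by simp
  qed
  have mono: "lt N (g n) (g n')" if "lt N n n'" for n n'
  proof -
    have F: "n \<in> Field N" "n' \<in> Field N" using N.lt_Field[OF that] by auto
    have "lt ?Y (marker D (g n)) (marker D (g n'))"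
      using inc[OF marker_strict_mono[OF that]] g[rule_format, OF F(1)] g[rule_format, OF F(2)] by metis
    then show ?thesis using marker_lt_iff g F by blast
  qed
  have conv: "p \<in> g ` Field N"
    if n: "n \<in> Field N" "n' \<in> Field N" and p: "lt N (g n) p" "lt N p (g n')" for n n' p
  proof -
    have pF: "p \<in> Field N" using N.lt_Field[OF p(1)] by blast
    have "lt ?Y (f (marker C n)) (marker D p)" "lt ?Y (marker D p) (f (marker C n'))"
      using marker_strict_mono[OF p(1)] marker_strict_mono[OF p(2)]
        g[rule_format, OF n(1)] g[rule_format, OF n(2)] by metis+
    then have "marker D p \<in> f ` Field ?X"
      using f marker_Field[OF n(1)] marker_Field[OF n(2)] unfolding convex_emb_def by blast
    then obtain x where x: "x \<in> Field ?X" "f x = marker D p" by force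
    have "lt ?X x (marker C n')"
      using XC.lt_cases[OF x(1) marker_Field[OF n(2)]] inc[of "marker C n'" x] x(2)
        \<open>lt ?Y (marker D p) (f (marker C n'))\<close> YC.lt_trans YC.lt_irrefl by metis
    then have "right_small m ?Y (f x) \<longleftrightarrow> right_small m ?X x"
      by (rule convex_emb_right_small[where m = m, OF XC.linord_axioms YC.linord_axioms f])
    moreover have "\<not> right_small m ?Y (f x)"
      using word_order_right[OF marker_Field[OF pF]] pF x(2) by auto
    ultimately obtain q where q: "q \<in> Field N" "x = marker C q"
      using word_order_right[OF x(1)] by blast
    then have "marker D (g q) = marker D p" using g[rule_format, OF q(1)] x(2) by metis
    then have "g q = p" using marker_inj g q(1) pF by blast
    then show ?thesis using q(1) by blast
  qed
  have "convex_emb N N g" unfolding convex_emb_def using mono conv by blast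
  then show ?thesis using g label by blast
qed

text \<open>
  A marker of a position in \<open>C\<close> is neither left- nor right-small, so even an order-reversing
  embedding takes it to a marker. An increasing sequence of such positions would yield a decreasing
  one in the well-order of positions.
\<close>

lemma no_decreasing_embedding_of_words:
  assumes f: "convex_emb (word_order C) ((word_order D)\<inverse>) f"
    and e: "\<And>i. e i \<in> C" "\<And>i. lt N (e i) (e (Suc i))"
  shows False
proof -
  let ?X = "word_order C" and ?Y = "word_order D"
  interpret XC: ordered_continuum ?X by (rule ordered_continuum_word_order)
  interpret YC: ordered_continuum ?Y by (rule ordered_continuum_word_order)
  have eF: "e i \<in> Field N" for i using N.lt_Field[OF e(2)] by blast
  have dec: "lt ?Y (f y) (f x)" if "lt ?X x y" for x y using f that unfolding convex_emb_def by simp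
  have "\<exists>p. p \<in> Field N \<and> f (marker C (e i)) = marker D p" for i
  proof -
    obtain y where y: "lt ?X y (marker C (e i))" using marker_not_extreme(2)[OF eF] by blast
    have "\<not> left_small m ?X (marker C (e i))" using marker_left[OF eF, of C] e(1) by blast
    then have "\<not> right_small m ?Y (f (marker C (e i)))"
      using convex_emb_right_small[where m = m, OF XC.linord_converse YC.linord_axioms convex_emb_converse[OF f, simplified], of "marker C (e i)" y]
        y by simp
    then show ?thesis using word_order_right YC.lt_Field[OF dec[OF y]] by blast
  qed
  then have "\<forall>i. \<exists>p. p \<in> Field N \<and> f (marker C (e i)) = marker D p" by blast
  from choice[OF this] obtain g where
    g: "\<forall>i. g i \<in> Field N \<and> f (marker C (e i)) = marker D (g i)" ..
  have "(g (Suc i), g i) \<in> N - Id" for i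
  proof -
    have "lt ?Y (marker D (g (Suc i))) (marker D (g i))"
      using dec[OF marker_strict_mono[OF e(2)[of i]]] g by simp
    then have "lt N (g (Suc i)) (g i)" using marker_lt_iff g by blast
    then show ?thesis by (simp add: lt_def)
  qed
  moreover have "wf (N - Id)" using Well_order_N by (simp add: well_order_on_def)
  ultimately show False unfolding wf_iff_no_infinite_down_chain by blast
qed

subsection \<open>Rigid words\<close>

definition a0 :: 'k where "a0 = (SOME a. a \<in> Field k \<and> (\<forall>b\<in>Field k. (a, b) \<in> k))"

lemma a0: "a0 \<in> Field k" "b \<in> Field k \<Longrightarrow> (a0, b) \<in> k"
proof -
  have "Field k \<noteq> {}" using k unfolding cinfinite_def by auto
  then have "\<exists>a. a \<in> Field k \<and> (\<forall>b\<in>Field k. (a, b) \<in> k)"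
    using Well_order_least[OF Well_order_k subset_refl] by blast
  from someI_ex[OF this] show "a0 \<in> Field k" "b \<in> Field k \<Longrightarrow> (a0, b) \<in> k"
    unfolding a0_def by blast+
qed

text \<open>
  The membership of \<open>a\<close> in \<open>S\<close> is recorded at \<open>(a, 3)\<close>. The ones at \<open>(a0, 0)\<close> and
  \<open>(a0, 1)\<close> form the only pair of adjacent ones and mark the beginning; the ones at all odd places
  from \<open>5\<close> on provide an infinite supply against order-reversing embeddings.
\<close>

definition word :: "'k set \<Rightarrow> ('k \<times> nat) set" where
  "word S = {(a, i). a = a0 \<and> i \<le> 1 \<or> i = 3 \<and> a \<in> S \<or> odd i \<and> i \<ge> 5}"

lemma adjacent_in_word: "n \<in> word S \<Longrightarrow> succ n \<in> word S \<Longrightarrow> n = (a0, 0)"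
  unfolding word_def by (cases n) (auto; presburger)

text \<open>
  The first two ones go to adjacent ones, by convexity, and so the least position is fixed. A strictly
  increasing map of a well-order into itself with convex range that fixes the least element is the
  identity.
\<close>

lemma word_rigid:
  assumes g: "\<And>n. n \<in> Field N \<Longrightarrow> g n \<in> Field N \<and> (n \<in> word S \<longleftrightarrow> g n \<in> word T)"
    and emb: "convex_emb N N g" and n: "n \<in> Field N"
  shows "g n = n"
proof -
  have mono: "lt N (g x) (g y)" if "lt N x y" for x y using emb that unfolding convex_emb_def by blast
  have conv: "\<exists>q\<in>Field N. g q = z" if "x \<in> Field N" "y \<in> Field N" "lt N (g x) z" "lt N z (g y)" for x y z
    using emb that unfolding convex_emb_def by blast
  have refl: "lt N x y" if "x \<in> Field N" "y \<in> Field N" "lt N (g x) (g y)" for x y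
    using N.lt_cases[OF that(1,2)] mono[of y x] that(3) N.lt_trans N.lt_irrefl by metis
  let ?s = "(a0, 0 :: nat)"
  have sF: "?s \<in> Field N" "succ ?s \<in> Field N" using a0(1) by (simp_all add: Field_N)
  have s_in: "?s \<in> word S" "succ ?s \<in> word S" unfolding word_def by auto
  have step: "lt N (g ?s) (g (succ ?s))" by (rule mono[OF succ_N(2)[OF sF(1)]])
  have "g (succ ?s) = succ (g ?s)"
  proof (rule ccontr)
    assume "g (succ ?s) \<noteq> succ (g ?s)"
    then have "lt N (succ (g ?s)) (g (succ ?s))" using succ_le_N[OF step] by metis
    moreover have gs: "lt N (g ?s) (succ (g ?s))" using succ_N(2) g[OF sF(1)] by blast
    ultimately obtain q where q: "q \<in> Field N" "g q = succ (g ?s)" using conv[OF sF] by blast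
    have "lt N ?s q" using refl[OF sF(1) q(1)] gs q(2) by simp
    moreover have "lt N q (succ ?s)"
      using refl[OF q(1) sF(2)] \<open>lt N (succ (g ?s)) (g (succ ?s))\<close> q(2) by simp
    then have "(q, ?s) \<in> N" by (rule lt_succ_N)
    ultimately show False using N.lt_asym by blast
  qed
  then have "g ?s \<in> word T" "succ (g ?s) \<in> word T" using g[OF sF(1)] g[OF sF(2)] s_in by simp_all
  then have gs: "g ?s = ?s" by (rule adjacent_in_word)
  have s_le: "(?s, n) \<in> N" if "n \<in> Field N" for n
  proof -
    have "(a0, fst n) \<in> k" using that Field_N a0(2) by blast
    then have "a0 = fst n \<or> lt k a0 (fst n)" by (auto simp: lt_def)
    then show ?thesis
      unfolding N.le_iff lt_N Field_N using that a0(1) by (cases n) (auto simp: Field_N)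
  qed
  have wf: "wf (N - Id)" using Well_order_N by (simp add: well_order_on_def)
  show ?thesis using n
  proof (induction n rule: wf_induct_rule[OF wf])
    case (1 n)
    have IH: "g q = q" if "lt N q n" for q
      using 1(1)[of q] that N.lt_Field[OF that] by (simp add: lt_def)
    have gF: "g n \<in> Field N" using g[OF 1(2)] by blast
    show ?case
    proof (rule ccontr)
      assume ne: "g n \<noteq> n"
      then consider "lt N (g n) n" | "lt N n (g n)" using N.lt_cases[OF gF 1(2)] by blast
      then show False
      proof cases
        case 1
        then show ?thesis using IH[OF 1] mono[OF 1] N.lt_irrefl by simp
      next
        case 2
        have "n \<noteq> ?s" using ne gs by blast
        then have "lt N ?s n" using s_le[OF 1(2)] by (simp add: lt_def)
        then obtain q where q: "q \<in> Field N" "g q = n" using conv[OF sF(1) 1(2) _ 2] gs by metis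
        consider "lt N q n" | "q = n" | "lt N n q" using N.lt_cases q(1) 1(2) by blast
        then show ?thesis
        proof cases
          case 1
          then show ?thesis using IH q(2) N.lt_irrefl by metis
        next
          case 2
          then show ?thesis using q(2) ne by blast
        next
          case 3
          then show ?thesis using mono[OF 3] q(2) 2 N.lt_trans N.lt_irrefl by metis
        qed
      qed
    qed
  qed
qed

lemma word_orders_incomparable:
  assumes S: "S \<subseteq> Field k" and T: "T \<subseteq> Field k"
    and f: "convex_emb (word_order (word S)) (word_order (word T)) f \<or>
      convex_emb (word_order (word S)) ((word_order (word T))\<inverse>) f"
  shows "S = T"
  using f
proof
  assume "convex_emb (word_order (word S)) (word_order (word T)) f"
  then obtain g where g: "\<forall>n\<in>Field N. g n \<in> Field N \<and> (n \<in> word S \<longleftrightarrow> g n \<in> word T)"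
    and emb: "convex_emb N N g" using embedding_of_words by blast
  have "a \<in> S \<longleftrightarrow> a \<in> T" if "a \<in> Field k" for a
  proof -
    have n: "(a, 3) \<in> Field N" using that by (simp add: Field_N)
    have "g (a, 3) = (a, 3)" using word_rigid[OF _ emb n] g by blast
    then have "(a, 3) \<in> word S \<longleftrightarrow> (a, 3) \<in> word T" using g n by metis
    then show ?thesis unfolding word_def by simp
  qed
  then show ?thesis using S T by blast
next
  assume f: "convex_emb (word_order (word S)) ((word_order (word T))\<inverse>) f"
  have False
  proof (rule no_decreasing_embedding_of_words[OF f])
    show "(a0, 2 * i + 5) \<in> word S" for i unfolding word_def by simp
    show "lt N (a0, 2 * i + 5) (a0, 2 * Suc i + 5)" for i using a0(1) by (simp add: lt_N)
  qed
  then show ?thesis ..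
qed

end

section \<open>The family of spaces\<close>

theorem theorem6:
  fixes kappa :: "'k rel" and lambda :: "'l rel" and mu :: "'m rel"
  assumes "Cinfinite kappa" and "Cinfinite lambda" and "Cinfinite mu"
    and "cardSuc mu \<le>o kappa" and "cexp_less lambda mu \<le>o kappa"
    and "kappa \<le>o lambda ^c mu"
  shows "\<exists>(I :: 'k set set) (X :: 'k set \<Rightarrow> ('m \<Rightarrow> 'l) topology).
    |I| =o ctwo ^c kappa \<and> incomparable_spaces I X \<and>
    (\<forall>i\<in>I. linearly_ordered_space (X i) \<and> continuum (X i) \<and> balanced_space (X i) \<and>
           weight (X i) =o kappa \<and> |topspace (X i)| =o lambda ^c mu)"
proof -
  let ?c = "lambda ^c mu"
  have c: "Cinfinite ?c" by (rule Cinfinite_cexp[OF ctwo_ordLeq_Cinfinite[OF assms(2)] assms(3)])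
  have "mu <o cardSuc mu" using cardSuc_greater assms(3) by blast
  then have "mu \<le>o kappa" using assms(4) ordLess_ordLeq_trans ordLess_imp_ordLeq by blast
  then obtain L :: "(nat \<Rightarrow> 'm \<Rightarrow> ('l \<times> real) option) rel" where L: "balanced_order kappa ?c L"
    "\<forall>x\<in>Field L. right_small mu L x" "left_small mu L (otop L)"
    using base_continuum[OF assms(1-3) _ assms(5,6)] by blast
  interpret coding kappa mu ?c L
    by (rule coding.intro) (use assms(1,3,4,6) c L in blast)+
  define M where "M S = word_order (word S)" for S
  have "\<exists>h :: _ \<Rightarrow> ('m \<Rightarrow> 'l). inj_on h (Field (M S))" for S
  proof -
    have "|Field (M S)| \<le>o ?c" using balanced_order_word_order unfolding M_def balanced_order_def by blast
    then have "|Field (M S)| \<le>o |Func (Field mu) (Field lambda)|" unfolding cexp_def .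
    then show ?thesis using card_of_ordLeq by metis
  qed
  then have "\<forall>S. \<exists>h :: _ \<Rightarrow> ('m \<Rightarrow> 'l). inj_on h (Field (M S))" by (rule allI)
  from choice[OF this] obtain h :: "'k set \<Rightarrow> _ \<Rightarrow> ('m \<Rightarrow> 'l)"
    where h: "\<forall>S. inj_on (h S) (Field (M S))" ..
  \<comment> \<open>The orders are moved into the function type, which has at least \<open>lambda ^c mu\<close> elements.\<close>
  define R where "R S = dir_image (M S) (h S)" for S
  define X where "X S = order_topology_of (Field (R S)) (R S)" for S
  have lcO: "ordered_continuum (M S)" for S unfolding M_def by (rule ordered_continuum_word_order)
  have balanced_order: "balanced_order kappa ?c (R S)" for S
    unfolding R_def M_def by (rule balanced_order_dir_image[OF balanced_order_word_order]) (use h M_def in metis)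
  have lc: "ordered_continuum (R S)" for S using balanced_order unfolding balanced_order_def by blast
  have "incomparable_spaces (Pow (Field kappa)) X"
    unfolding incomparable_spaces_def
  proof (intro ballI impI notI)
    fix S T assume ST: "S \<in> Pow (Field kappa)" "T \<in> Pow (Field kappa)" "S \<noteq> T"
      and "\<exists>Z\<subseteq>topspace (X T). X S homeomorphic_space subtopology (X T) Z"
    then obtain Z where "X S homeomorphic_space subtopology (X T) Z" by blast
    then obtain f where "convex_emb (R S) (R T) f \<or> convex_emb (R S) ((R T)\<inverse>) f"
      using homeomorphic_subspace_monotone[OF lc ordered_continuum.axioms(1)[OF lc]] unfolding X_def by blast
    then have "(\<exists>f. convex_emb (M S) (M T) f) \<or> (\<exists>f. convex_emb (M S) ((M T)\<inverse>) f)"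
      using convex_emb_dir_image[OF lcO[of S] h[rule_format], of "h T" "M T" f]
        convex_emb_dir_image[OF lcO[of S] h[rule_format], of "h T" "(M T)\<inverse>" f] h
      unfolding R_def dir_image_converse Field_converse by blast
    then show False using word_orders_incomparable[of S T] ST unfolding M_def by blast
  qed
  moreover have "|Pow (Field kappa)| =o ctwo ^c kappa"
    using card_of_Pow_Func[of "Field kappa"] unfolding cexp_def ctwo_def Field_card_of .
  moreover have "\<forall>S\<in>Pow (Field kappa). linearly_ordered_space (X S) \<and> continuum (X S) \<and>
      balanced_space (X S) \<and> weight (X S) =o kappa \<and> |topspace (X S)| =o ?c"
    using order_topology_of_balanced_order[OF balanced_order assms(1) c X_def] by blast
  ultimately show ?thesis by blast
qed

end
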